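(* Let $m,n\ge 1$ be integers and let $W$ be an edge-weight function on the toroidal Fisher graph of size $m\times n$ such that all triangular edges and all $a$-edges have weight $1$, and all other edges (the $b$-edges and $c$-edges) have weights in $(0,1)$. Let $P(z,w)=\det K(z,w)$ be its characteristic polynomial. Then: (1) the spectral curve $\{P(z,w)=0\}$ is a Harnack curve; (2) the only possible intersection of $P(z,w)=0$ with the unit torus $\mathbb{T}^2=\{(z,w)\in\mathbb{C}^2:|z|=1,|w|=1\}$ is a single real point of multiplicity $2$; that is, the intersection is either empty or consists of exactly one point, which lies in $\{\pm1\}^2$ and is a zero of $P$ of multiplicity $2$.
   Context: The Fisher graph is the honeycomb lattice with every vertex replaced by a triangle. A bi-periodic weighted Fisher graph is encoded by its quotient, the toroidal Fisher graph of size $m\times n$, with vertices $\beta_s(x,y),\omega_s(x,y)$, $s\in\{a,b,c\}$, $x\in\mathbb{Z}/n\mathbb{Z}$, $y\in\mathbb{Z}/m\mathbb{Z}$ ($6mn$ vertices). Its oriented edges are: triangular edges $\beta_a\to\beta_b\to\beta_c\to\beta_a$ and $\omega_a\to\omega_b\to\omega_c\to\omega_a$ at each $(x,y)$; and non-triangular edges: $a$-edges $\beta_a(x,y)\to\omega_a(x,y)$, $b$-edges $\beta_b(x,y)\to\omega_b(x+1,y)$, $c$-edges $\beta_c(x,y)\to\omega_c(x,y+1)$. The $z$-edges are the $m$ $b$-edges from $x=n-1$ to $x=0$; the $w$-edges are the $n$ $c$-edges from $y=m-1$ to $y=0$. For $z,w\in\mathbb{C}\setminus\{0\}$, $K(z,w)$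 is the $6mn\times6mn$ matrix indexed by vertices such that for each oriented edge $u\to v$: $K(z,w)_{u,v}=W(uv)\,\zeta$ and $K(z,w)_{v,u}=-W(uv)\,\zeta^{-1}$, where $\zeta=z$ for $z$-edges, $\zeta=w$ for $w$-edges and $\zeta=1$ for all other edges; all other entries are $0$. $P(z,w)=\det K(z,w)$ is a real Laurent polynomial, and the spectral curve is $\{P(z,w)=0\}\subset(\mathbb{C}\setminus\{0\})^2$. Harnack curve: the curve $P(z,w)=0$ is Harnack if for all $x,y>0$ the number of zeros of $P$ on the torus $\{(z,w):|z|=x,|w|=y\}$ is at most $2$, counting multiplicities. The multiplicity of a zero is the order of vanishing of $P$ at that point. *)

theory Defs
  imports "HOL-Analysis.Derivative" "HOL-Library.Extended_Nat" "Jordan_Normal_Form.Determinant"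
begin

datatype edge_kind = Kind_a | Kind_b | Kind_c

text \<open>The vertices \<open>\<beta>\<^sub>s(x,y)\<close> and \<open>\<omega>\<^sub>s(x,y)\<close>; the residue classes \<open>x\<close> modulo \<open>n\<close> and \<open>y\<close>
  modulo \<open>m\<close> are represented by \<open>x < n\<close> and \<open>y < m\<close>.\<close>

datatype vertex = Beta edge_kind nat nat | Omega edge_kind nat nat

definition fisher_vertices :: "nat \<Rightarrow> nat \<Rightarrow> vertex list" where
  "fisher_vertices m n =
     [V s x y. V \<leftarrow> [Beta, Omega], s \<leftarrow> [Kind_a, Kind_b, Kind_c], x \<leftarrow> [0..<n], y \<leftarrow> [0..<m]]"

lemma set_fisher_vertices:
  "set (fisher_vertices m n) =
     {Beta s x y | s x y. x < n \<and> y < m} \<union> {Omega s x y | s x y. x < n \<and> y < m}"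
proof (rule Set.set_eqI)
  fix v
  show "v \<in> set (fisher_vertices m n) \<longleftrightarrow>
    v \<in> {Beta s x y | s x y. x < n \<and> y < m} \<union> {Omega s x y | s x y. x < n \<and> y < m}"
  proof (cases v)
    case (Beta s x y)
    then show ?thesis by (cases s) (simp_all add: fisher_vertices_def image_iff)
  next
    case (Omega s x y)
    then show ?thesis by (cases s) (simp_all add: fisher_vertices_def image_iff)
  qed
qed

lemma length_fisher_vertices: "length (fisher_vertices m n) = 6 * m * n"
  by (simp add: fisher_vertices_def length_concat comp_def sum_list_triv)

lemma distinct_fisher_vertices: "distinct (fisher_vertices m n)"
proof -
  have block: "distinct (concat (map (\<lambda>x. map (V s x) [0..<m]) [0..<n]))"
    if "\<And>x y x' y'. V s x y = V s x' y' \<longleftrightarrow> x = x' \<and> y = y'"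
    for V :: "edge_kind \<Rightarrow> nat \<Rightarrow> nat \<Rightarrow> vertex" and s
    by (induction n) (auto simp: distinct_map inj_on_def that)
  have "distinct (concat (map (\<lambda>x. map (Beta s x) [0..<m]) [0..<n]))"
    "distinct (concat (map (\<lambda>x. map (Omega s x) [0..<m]) [0..<n]))" for s
    by (rule block, simp)+
  then show ?thesis
    unfolding fisher_vertices_def by auto
qed

text \<open>A pair \<open>(u, v)\<close> stands for the oriented edge \<open>u \<rightarrow> v\<close>.\<close>

definition triangular_edges :: "nat \<Rightarrow> nat \<Rightarrow> (vertex \<times> vertex) set" where
  "triangular_edges m n =
     {(V s x y, V t x y) | V s t x y. V \<in> {Beta, Omega} \<and>
        (s, t) \<in> {(Kind_a, Kind_b), (Kind_b, Kind_c), (Kind_c, Kind_a)} \<and> x < n \<and> y < m}"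

definition a_edges :: "nat \<Rightarrow> nat \<Rightarrow> (vertex \<times> vertex) set" where
  "a_edges m n = {(Beta Kind_a x y, Omega Kind_a x y) | x y. x < n \<and> y < m}"

definition b_edges :: "nat \<Rightarrow> nat \<Rightarrow> (vertex \<times> vertex) set" where
  "b_edges m n = {(Beta Kind_b x y, Omega Kind_b ((x + 1) mod n) y) | x y. x < n \<and> y < m}"

definition c_edges :: "nat \<Rightarrow> nat \<Rightarrow> (vertex \<times> vertex) set" where
  "c_edges m n = {(Beta Kind_c x y, Omega Kind_c x ((y + 1) mod m)) | x y. x < n \<and> y < m}"

definition oriented_edges :: "nat \<Rightarrow> nat \<Rightarrow> (vertex \<times> vertex) set" where
  "oriented_edges m n = triangular_edges m n \<union> a_edges m n \<union> b_edges m n \<union> c_edges m n"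

definition z_edges :: "nat \<Rightarrow> nat \<Rightarrow> (vertex \<times> vertex) set" where
  "z_edges m n = {(Beta Kind_b (n - 1) y, Omega Kind_b 0 y) | y. y < m}"

definition w_edges :: "nat \<Rightarrow> nat \<Rightarrow> (vertex \<times> vertex) set" where
  "w_edges m n = {(Beta Kind_c x (m - 1), Omega Kind_c x 0) | x. x < n}"

definition edge_factor ::
  "nat \<Rightarrow> nat \<Rightarrow> complex \<Rightarrow> complex \<Rightarrow> vertex \<times> vertex \<Rightarrow> complex" where
  "edge_factor m n z w e = (if e \<in> z_edges m n then z else if e \<in> w_edges m n then w else 1)"

text \<open>Each undirected edge carries exactly one orientation, so the weight of the edge \<open>uv\<close> oriented
  \<open>u \<rightarrow> v\<close> is \<open>W (u, v)\<close>; values of \<open>W\<close> on other pairs play no role.\<close>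

definition kasteleyn_entry ::
  "nat \<Rightarrow> nat \<Rightarrow> (vertex \<times> vertex \<Rightarrow> real) \<Rightarrow> complex \<Rightarrow> complex \<Rightarrow> vertex \<Rightarrow> vertex \<Rightarrow> complex" where
  "kasteleyn_entry m n W z w u v =
     (if (u, v) \<in> oriented_edges m n then of_real (W (u, v)) * edge_factor m n z w (u, v)
      else if (v, u) \<in> oriented_edges m n
        then - of_real (W (v, u)) * inverse (edge_factor m n z w (v, u))
      else 0)"

lemma oriented_edges_antisym:
  "(u, v) \<in> oriented_edges m n \<Longrightarrow> (v, u) \<notin> oriented_edges m n"
  unfolding oriented_edges_def triangular_edges_def a_edges_def b_edges_def c_edges_def
  by auto

text \<open>Rows and columns are ordered by \<^const>\<open>fisher_vertices\<close>; the determinant does not depend on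
  this order.\<close>

definition kasteleyn_matrix ::
  "nat \<Rightarrow> nat \<Rightarrow> (vertex \<times> vertex \<Rightarrow> real) \<Rightarrow> complex \<Rightarrow> complex \<Rightarrow> complex mat" where
  "kasteleyn_matrix m n W z w =
     mat (6 * m * n) (6 * m * n)
       (\<lambda>(i, j). kasteleyn_entry m n W z w (fisher_vertices m n ! i) (fisher_vertices m n ! j))"

definition char_polynomial ::
  "nat \<Rightarrow> nat \<Rightarrow> (vertex \<times> vertex \<Rightarrow> real) \<Rightarrow> complex \<Rightarrow> complex \<Rightarrow> complex" where
  "char_polynomial m n W z w = Determinant.det (kasteleyn_matrix m n W z w)"

definition mixed_deriv ::
  "nat \<Rightarrow> nat \<Rightarrow> (complex \<Rightarrow> complex \<Rightarrow> complex) \<Rightarrow> complex \<Rightarrow> complex \<Rightarrow> complex" where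
  "mixed_deriv i j F z w = (deriv ^^ i) (\<lambda>u. (deriv ^^ j) (F u) w) z"

text \<open>Order of vanishing of \<open>F\<close> at \<open>(z, w)\<close>: the least total order of a nonvanishing partial
  derivative (\<open>\<infinity>\<close> if there is none). It is meaningful for \<open>F\<close> holomorphic near \<open>(z, w)\<close>, such as
  a Laurent polynomial at a point with nonzero coordinates.\<close>

definition vanishing_order ::
  "(complex \<Rightarrow> complex \<Rightarrow> complex) \<Rightarrow> complex \<times> complex \<Rightarrow> enat" where
  "vanishing_order F = (\<lambda>(z, w). INF (i, j) \<in> {(i, j). mixed_deriv i j F z w \<noteq> 0}. enat (i + j))"

definition torus_zeros ::
  "(complex \<Rightarrow> complex \<Rightarrow> complex) \<Rightarrow> real \<Rightarrow> real \<Rightarrow> (complex \<times> complex) set" where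
  "torus_zeros F x y = {(z, w). norm z = x \<and> norm w = y \<and> F z w = 0}"

text \<open>Finiteness has to be required separately because a sum over an infinite set is \<open>0\<close>.\<close>

definition harnack :: "(complex \<Rightarrow> complex \<Rightarrow> complex) \<Rightarrow> bool" where
  "harnack F \<longleftrightarrow> (\<forall>x y. x > 0 \<and> y > 0 \<longrightarrow>
     finite (torus_zeros F x y) \<and> (\<Sum>p\<in>torus_zeros F x y. vanishing_order F p) \<le> 2)"

end

theory Submission
  imports "HOL-Analysis.Analysis" Defs
begin

text \<open>A vector in the kernel of \<open>K(z, w)\<close> lifts to a \<open>(z, w)\<close>-quasiperiodic function on the Fisher graph
  covering the torus. On suitable combinations \<open>x, y\<close> of its values along the corners of the
  underlying square lattice, in light-cone coordinates, the kernel equations become a network of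
  hyperbolic gates: the outputs are \<open>c x + s y\<close> and \<open>s x + c y\<close> with \<open>c, s > 0\<close> and
  \<open>c\<^sup>2 = 1 + s\<^sup>2\<close>. For a solution with values in a Euclidean space, consider the polygonal path
  formed by the spherical directions along a space-like row of the lattice. By the triangle
  inequality its length does not increase from one row to the next. A system of up to three
  eigenfunctions whose multipliers have equal moduli is quasiperiodic up to similarity, hence its
  length is constant and all triangle inequalities are equalities. This rigidity forces
  any three such eigenfunctions to be linearly dependent, excludes Jordan chains at nonreal points, and
  shows that a real generalized eigenfunction cannot vanish at both inputs of a gate. A zero of order \<open>\<mu>\<close> of
  \<open>P\<close> yields \<open>\<mu>\<close> independent generalized eigenfunctions, so at most two zeros, counted with
  multiplicity, lie on a torus. On the unit torus \<open>P\<close> is real-valued because \<open>K\<close> is skew-Hermitian of even size;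
  a simple zero would then be a sign change and produce infinitely many zeros. So there is only one
  zero, it is double, and by complex conjugation it is real.\<close>

text \<open>The relation \<open>c\<^sup>2 = 1 + s\<^sup>2\<close> places both outputs of a gate on
  the arc joining its inputs, so inserting the outputs costs no length and omitting the inputs
  afterwards can only save. A period shift multiplies three eigenfunctions by different numbers;
  equality of the moduli is what makes this a similarity of the real space underlying
  \<open>complex \<times> complex \<times> complex\<close>, hence angle-preserving, and it is why
  zeros on one torus can be treated together. A Jordan block is no similarity: there the lengths far
  up and far down the lattice are compared with that of the leading eigenfunction, which requires
  angles to converge. At nonreal points rigidity itself excludes zero values, so they do. At real
  points zeros occur and the angle jumps there; but for real values only signs count, and a zero of
  a tight function sits between opposite signs, so perturbing it does not change the length. The
  generalized eigenfunctions come from deforming \<open>w\<close> alone with \<open>z\<close> fixed: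
  the order of \<open>P\<close> along this line is at least \<open>\<mu>\<close>, which already
  produces enough of them.\<close>

no_notation Matrix.scalar_prod (infix "\<bullet>" 70)

section \<open>Spherical angles\<close>

text \<open>A zero vector has distance \<open>pi / 2\<close> from every nonzero vector, since \<open>sgn 0 = 0\<close>; this keeps the
  triangle inequality \<open>ang_triangle\<close> valid.\<close>

definition ang :: "'a::real_inner \<Rightarrow> 'a \<Rightarrow> real" where
  "ang u v = (if u = 0 \<and> v = 0 then 0 else arccos (sgn u \<bullet> sgn v))"

lemma sgn_inner_bound: "\<bar>sgn u \<bullet> sgn v\<bar> \<le> (1::real)" for u v :: "'a::real_inner"
proof -
  have "\<bar>sgn u \<bullet> sgn v\<bar> \<le> norm (sgn u) * norm (sgn v)" by (rule Cauchy_Schwarz_ineq2)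
  also have "\<dots> \<le> 1" by (simp add: norm_sgn)
  finally show ?thesis .
qed

lemma ang_nonneg: "0 \<le> ang u v"
  using sgn_inner_bound[of u v] by (auto simp: ang_def abs_le_iff intro!: arccos_lbound)

lemma ang_le_pi: "ang u v \<le> pi"
  using sgn_inner_bound[of u v] by (auto simp: ang_def abs_le_iff intro!: arccos_ubound)

lemma ang_commute: "ang u v = ang v u"
  by (auto simp: ang_def inner_commute)

lemma ang_zero_left: "v \<noteq> 0 \<Longrightarrow> ang 0 v = pi / 2"
  by (simp add: ang_def)

lemma ang_zero_right: "v \<noteq> 0 \<Longrightarrow> ang v 0 = pi / 2"
  by (simp add: ang_def)

lemma ang_zero_zero [simp]: "ang 0 0 = 0"
  by (simp add: ang_def)

lemma ang_scale: "k > 0 \<Longrightarrow> l > 0 \<Longrightarrow> ang (k *\<^sub>R u) (l *\<^sub>R v) = ang u v"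
  by (simp add: ang_def sgn_scaleR)

lemma cos_ang: "u \<noteq> 0 \<Longrightarrow> v \<noteq> 0 \<Longrightarrow> cos (ang u v) = sgn u \<bullet> sgn v"
  using sgn_inner_bound[of u v] by (simp add: ang_def cos_arccos_abs)

lemma sin_ang_nonneg: "0 \<le> sin (ang u v)"
  by (simp add: ang_nonneg ang_le_pi sin_ge_zero)

lemma ang_self: "ang u u = 0"
proof (cases "u = 0")
  case False
  then have "sgn u \<bullet> sgn u = 1" by (simp add: dot_square_norm norm_sgn)
  then show ?thesis by (simp add: ang_def)
qed simp

text \<open>The component of \<open>p\<close> orthogonal to \<open>q\<close>, for directions \<open>p\<close> and \<open>q\<close>.\<close>

definition orth :: "'a::real_inner \<Rightarrow> 'a \<Rightarrow> 'a" where
  "orth p q = sgn p - (sgn p \<bullet> sgn q) *\<^sub>R sgn q"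

lemma sgn_inner_self: "u \<noteq> 0 \<Longrightarrow> sgn u \<bullet> sgn u = (1::real)" for u :: "'a::real_inner"
  by (simp add: dot_square_norm norm_sgn)

lemma norm_orth:
  assumes "p \<noteq> 0" "q \<noteq> 0" shows "norm (orth p q) = sin (ang p q)"
proof -
  have "(norm (orth p q))\<^sup>2 = 1 - (sgn p \<bullet> sgn q)\<^sup>2"
    unfolding orth_def power2_norm_eq_inner
    by (simp add: inner_diff sgn_inner_self assms inner_commute power2_eq_square algebra_simps)
  also have "\<dots> = (sin (ang p q))\<^sup>2"
    using assms by (simp add: sin_squared_eq cos_ang)
  finally show ?thesis
    using sin_ang_nonneg[of p q] by (simp add: power2_eq_iff_nonneg)
qed

lemma inner_orth:
  assumes "q \<noteq> 0"
  shows "orth p q \<bullet> orth r q = sgn p \<bullet> sgn r - (sgn p \<bullet> sgn q) * (sgn r \<bullet> sgn q)"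
  unfolding orth_def
  by (simp add: inner_diff sgn_inner_self assms inner_commute algebra_simps)

text \<open>The bracket is nonnegative by Cauchy-Schwarz, which gives the triangle inequality; it
  vanishes when the components orthogonal to \<open>q\<close> are antiparallel, which is the
  equality case.\<close>

lemma cos_ang_add:
  assumes "p \<noteq> 0" "q \<noteq> 0" "r \<noteq> 0"
  shows "cos (ang p q + ang q r)
    = sgn p \<bullet> sgn r - (orth p q \<bullet> orth r q + norm (orth p q) * norm (orth r q))"
  using assms by (simp add: cos_add cos_ang norm_orth inner_orth ang_commute[of r q] inner_commute)

lemma ang_triangle: "ang p r \<le> ang p q + ang q r"
proof (cases "p = 0 \<or> q = 0 \<or> r = 0")
  case True
  \<comment> \<open>A zero vector in the middle contributes two legs of length
    \<open>pi / 2\<close>, which already reach the maximal angle \<open>pi\<close>; a zero endpoint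
    contributes \<open>pi / 2\<close> on both sides.\<close>
  then show ?thesis
    using ang_nonneg[of p q] ang_nonneg[of q r] ang_le_pi[of p r]
    by (cases "p = 0"; cases "q = 0"; cases "r = 0") (auto simp: ang_zero_left ang_zero_right)
next
  case False
  have "- (orth p q \<bullet> orth r q) \<le> norm (orth p q) * norm (orth r q)"
    using Cauchy_Schwarz_ineq2[of "orth p q" "orth r q"] by linarith
  then have le: "cos (ang p q + ang q r) \<le> cos (ang p r)"
    using False by (simp add: cos_ang_add cos_ang)
  show ?thesis
  proof (rule ccontr)
    assume "\<not> ?thesis"
    then have "cos (ang p r) < cos (ang p q + ang q r)"
      by (intro cos_monotone_0_pi) (auto simp: ang_nonneg ang_le_pi)
    with le show False by simp
  qed
qed

section \<open>Betweenness: equality in the spherical triangle inequality\<close>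

definition btw :: "'a::real_inner \<Rightarrow> 'a \<Rightarrow> 'a \<Rightarrow> bool" where
  "btw p q r \<longleftrightarrow> ang p q + ang q r = ang p r"

lemma btw_sym: "btw p q r \<longleftrightarrow> btw r q p"
  by (auto simp: btw_def ang_commute)

text \<open>Equality in Cauchy-Schwarz makes the components of \<open>p\<close> and \<open>r\<close>
  orthogonal to \<open>q\<close> antiparallel. The result is the formula of spherical linear
  interpolation for the point \<open>q\<close> of the arc.\<close>

lemma btw_identity:
  assumes "btw p q r" "p \<noteq> 0" "q \<noteq> 0" "r \<noteq> 0"
  shows "sin (ang q r) *\<^sub>R sgn p + sin (ang p q) *\<^sub>R sgn r = sin (ang p r) *\<^sub>R sgn q"
proof -
  have "cos (ang p q + ang q r) = sgn p \<bullet> sgn r"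
    using assms by (simp add: btw_def cos_ang)
  then have "orth p q \<bullet> orth r q = - (norm (orth p q) * norm (orth r q))"
    using cos_ang_add[OF assms(2-4)] by linarith
  then have "orth p q \<bullet> (- orth r q) = norm (orth p q) * norm (- orth r q)" by simp
  then have "norm (orth p q) *\<^sub>R (- orth r q) = norm (- orth r q) *\<^sub>R orth p q"
    by (simp only: norm_cauchy_schwarz_eq)
  then have eq: "sin (ang p q) *\<^sub>R orth r q + sin (ang q r) *\<^sub>R orth p q = 0"
    using assms by (simp add: norm_orth ang_commute[of r q] neg_eq_iff_add_eq_0)
  have "sin (ang p r) = sin (ang p q) * (sgn q \<bullet> sgn r) + (sgn p \<bullet> sgn q) * sin (ang q r)"
    using assms(2-4) unfolding assms(1)[unfolded btw_def, symmetric] by (simp add: sin_add cos_ang)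
  then show ?thesis
    using eq unfolding orth_def by (simp add: algebra_simps inner_commute)
qed

lemma ang_eq_0_iff: "ang p q = 0 \<longleftrightarrow> (p = 0 \<and> q = 0) \<or> (p \<noteq> 0 \<and> (\<exists>k>0. q = k *\<^sub>R p))"
proof
  assume 0: "ang p q = 0"
  show "(p = 0 \<and> q = 0) \<or> (p \<noteq> 0 \<and> (\<exists>k>0. q = k *\<^sub>R p))"
  proof (cases "p = 0 \<or> q = 0")
    case True
    with 0 show ?thesis
      by (cases "p = 0"; cases "q = 0") (auto simp: ang_zero_left ang_zero_right)
  next
    case False
    then have "norm (orth q p) = 0" by (simp add: norm_orth ang_commute[of q p] 0)
    moreover have "sgn q \<bullet> sgn p = 1" using False 0 cos_ang[of p q] by (simp add: inner_commute)
    ultimately have "sgn q = sgn p" by (simp add: orth_def)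
    have "q = norm q *\<^sub>R sgn q" using False by (simp add: sgn_div_norm)
    also have "\<dots> = (norm q / norm p) *\<^sub>R p"
      using False \<open>sgn q = sgn p\<close> by (simp add: sgn_div_norm divide_inverse)
    finally have "q = (norm q / norm p) *\<^sub>R p" .
    then show ?thesis using False by (intro disjI2 conjI exI[of _ "norm q / norm p"]) auto
  qed
next
  assume "(p = 0 \<and> q = 0) \<or> (p \<noteq> 0 \<and> (\<exists>k>0. q = k *\<^sub>R p))"
  then show "ang p q = 0"
    using ang_scale[of 1 _ p p] by (auto simp: ang_self)
qed

lemma ang_minus_right: "u \<noteq> 0 \<Longrightarrow> v \<noteq> 0 \<Longrightarrow> ang u (- v) = pi - ang u v"
  using sgn_inner_bound[of u v] by (simp add: ang_def sgn_minus arccos_minus abs_le_iff)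

lemma ang_eq_pi_iff: "ang p q = pi \<longleftrightarrow> p \<noteq> 0 \<and> (\<exists>k>0. q = - (k *\<^sub>R p))"
proof (cases "p = 0 \<or> q = 0")
  case True
  then show ?thesis by (cases "p = 0"; cases "q = 0") (auto simp: ang_zero_left ang_zero_right)
next
  case False
  then have "ang p q = pi \<longleftrightarrow> ang p (- q) = 0" by (auto simp: ang_minus_right)
  also have "\<dots> \<longleftrightarrow> p \<noteq> 0 \<and> (\<exists>k>0. - q = k *\<^sub>R p)" using False by (simp add: ang_eq_0_iff)
  also have "\<dots> \<longleftrightarrow> p \<noteq> 0 \<and> (\<exists>k>0. q = - (k *\<^sub>R p))" by (metis minus_minus)
  finally show ?thesis .
qed

lemma sin_nonneg_gt_pi:
  assumes "0 \<le> s" "s \<le> 2 * pi" "0 < sin s" shows "s < pi"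
  using assms sin_le_zero[of s] by (cases "s = 2 * pi") force+

text \<open>The components of \<open>x\<close> and \<open>y\<close> orthogonal to \<open>v\<close>
  are opposite, so Cauchy-Schwarz is an equality, and the two partial angles have a sum with the
  same cosine as the whole angle.\<close>

lemma btw_cone_sgn:
  assumes xy: "x \<noteq> 0" "y \<noteq> 0" and nz: "v \<noteq> 0" and kl: "k > 0" "l > 0" and N: "N > 0"
    and v: "k *\<^sub>R sgn x + l *\<^sub>R sgn y = N *\<^sub>R sgn v"
  shows "btw x v y"
proof -
  let ?\<theta> = "ang x v" and ?\<phi> = "ang v y"
  have "k *\<^sub>R orth x v + l *\<^sub>R orth y v
      = (k *\<^sub>R sgn x + l *\<^sub>R sgn y) - ((k *\<^sub>R sgn x + l *\<^sub>R sgn y) \<bullet> sgn v) *\<^sub>R sgn v"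
    unfolding orth_def by (simp add: algebra_simps inner_add_left)
  also have "\<dots> = 0" unfolding v using nz by (simp add: sgn_inner_self)
  finally have "k *\<^sub>R orth x v = - (l *\<^sub>R orth y v)" by (simp add: eq_neg_iff_add_eq_0)
  then have "(1 / k) *\<^sub>R (k *\<^sub>R orth x v) = (1 / k) *\<^sub>R (- (l *\<^sub>R orth y v))" by simp
  then have o: "orth x v = (- (l / k)) *\<^sub>R orth y v" using kl by simp
  then have "norm (orth x v) = l / k * norm (orth y v)" using kl by simp
  then have n: "k * sin ?\<theta> = l * sin ?\<phi>"
    using kl xy nz by (simp add: norm_orth ang_commute[of y] field_simps)
  have io: "orth x v \<bullet> orth y v = - (norm (orth x v) * norm (orth y v))"
    unfolding o using kl by (simp add: dot_square_norm power2_eq_square)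
  have c: "cos (?\<theta> + ?\<phi>) = cos (ang x y)"
    using cos_ang_add[OF xy(1) nz xy(2)] io xy by (simp add: cos_ang)
  have "k * cos ?\<theta> + l * cos ?\<phi> = (k *\<^sub>R sgn x + l *\<^sub>R sgn y) \<bullet> sgn v"
    using xy nz by (simp add: cos_ang inner_add_left ang_commute[of v y])
  also have "\<dots> = N" unfolding v using nz by (simp add: sgn_inner_self)
  finally have pos: "k * cos ?\<theta> + l * cos ?\<phi> = N" .
  \<comment> \<open>Cosine determines the sum only up to reflection at \<open>pi\<close>. The inner
    product of the cone combination with the direction of \<open>v\<close> is \<open>N > 0\<close>,
    which rules out a sum beyond \<open>pi\<close>.\<close>
  have "?\<theta> + ?\<phi> \<le> pi"
  proof (cases "sin ?\<phi> = 0")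
    case True
    with n kl have s0: "sin ?\<theta> = 0" by simp
    have dich: "a = 0 \<or> a = pi" if "0 \<le> a" "a \<le> pi" "sin a = 0" for a
      using that sin_gt_zero[of a] by fastforce
    have "?\<theta> = 0 \<or> ?\<theta> = pi" "?\<phi> = 0 \<or> ?\<phi> = pi"
      using dich[OF ang_nonneg ang_le_pi s0] dich[OF ang_nonneg ang_le_pi True] by auto
    moreover have "\<not> (?\<theta> = pi \<and> ?\<phi> = pi)"
      using pos kl N by auto
    ultimately show ?thesis by auto
  next
    case False
    then have sp: "sin ?\<phi> > 0" using sin_ang_nonneg[of v y] by linarith
    have "k * sin (?\<theta> + ?\<phi>) = (k * sin ?\<theta>) * cos ?\<phi> + k * cos ?\<theta> * sin ?\<phi>"
      by (simp add: sin_add algebra_simps)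
    also have "\<dots> = (k * cos ?\<theta> + l * cos ?\<phi>) * sin ?\<phi>"
      unfolding n by (simp add: algebra_simps)
    also have "\<dots> > 0" unfolding pos using sp N by simp
    finally have "sin (?\<theta> + ?\<phi>) > 0" using kl by (simp add: zero_less_mult_iff)
    then have "?\<theta> + ?\<phi> < pi"
      by (intro sin_nonneg_gt_pi)
        (use ang_nonneg[of x v] ang_nonneg[of v y] ang_le_pi[of x v] ang_le_pi[of v y] in auto)
    then show ?thesis by simp
  qed
  then have "?\<theta> + ?\<phi> = ang x y"
    using c ang_nonneg[of x v] ang_nonneg[of v y] ang_nonneg[of x y] ang_le_pi[of x y]
      cos_inj_pi[of "?\<theta> + ?\<phi>" "ang x y"] by linarith
  then show ?thesis by (simp add: btw_def)
qed

lemma btw_cone: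
  assumes "k > 0" "l > 0"
  shows "btw x (k *\<^sub>R x + l *\<^sub>R y) y"
proof (cases "x = 0 \<or> y = 0")
  case True
  then show ?thesis
    using ang_scale[of 1 k x x] ang_scale[of l 1 y y] ang_scale[of 1 l 0 y] ang_scale[of k 1 x 0] assms
    by (auto simp: btw_def ang_self ang_zero_left ang_zero_right)
next
  case False
  then have xy: "x \<noteq> 0" "y \<noteq> 0" by auto
  define v where "v = k *\<^sub>R x + l *\<^sub>R y"
  have "btw x v y"
  proof (cases "v = 0")
    \<comment> \<open>A cancelling combination means that \<open>x\<close> and \<open>y\<close> are
      antipodal; the zero vector then acts as the midpoint of an arc of length
      \<open>pi\<close>.\<close>
    case True
    then have "l *\<^sub>R y = - (k *\<^sub>R x)" by (simp add: v_def eq_neg_iff_add_eq_0 add.commute)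
    then have "(1 / l) *\<^sub>R l *\<^sub>R y = (1 / l) *\<^sub>R - (k *\<^sub>R x)" by simp
    then have "y = - ((k / l) *\<^sub>R x)" using assms by simp
    then have "ang x y = pi"
      using xy assms by (subst ang_eq_pi_iff) (auto intro!: exI[of _ "k / l"])
    then show ?thesis
      unfolding btw_def True using xy by (simp add: ang_zero_left ang_zero_right)
  next
    case nz: False
    have sg: "norm u *\<^sub>R sgn u = u" for u :: 'a by (cases "u = 0") (auto simp: sgn_div_norm)
    have "(k * norm x) *\<^sub>R sgn x + (l * norm y) *\<^sub>R sgn y = k *\<^sub>R x + l *\<^sub>R y"
      unfolding scaleR_scaleR[symmetric] sg ..
    also have "\<dots> = norm v *\<^sub>R sgn v" by (simp only: sg v_def)
    finally show ?thesis
      using xy nz assms by (intro btw_cone_sgn[of x y v "k * norm x" "l * norm y" "norm v"]) auto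
  qed
  then show ?thesis by (simp add: v_def)
qed

section \<open>Rays, and betweenness with zero, antipodal or dependent points\<close>

definition ray :: "'a::real_vector \<Rightarrow> 'a \<Rightarrow> bool" where
  "ray p q \<longleftrightarrow> p \<noteq> 0 \<and> (\<exists>k>0. q = k *\<^sub>R p)"

lemma ang_eq_0: "ang p q = 0 \<longleftrightarrow> (p = 0 \<and> q = 0) \<or> ray p q"
  by (simp add: ang_eq_0_iff ray_def)

lemma ang_eq_pi: "ang p q = pi \<longleftrightarrow> ray p (- q)"
proof -
  have "q = - (k *\<^sub>R p) \<longleftrightarrow> - q = k *\<^sub>R p" for k by (metis minus_minus)
  then show ?thesis by (simp add: ang_eq_pi_iff ray_def)
qed

lemma ray_sym: "ray p q \<longleftrightarrow> ray q p"
proof -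
  have "ray q p" if pq: "ray p q" for p q :: 'a
  proof -
    from pq obtain k where k: "p \<noteq> 0" "k > 0" "q = k *\<^sub>R p" by (auto simp: ray_def)
    then have "p = (1 / k) *\<^sub>R q" by simp
    then show ?thesis using k unfolding ray_def by (intro conjI exI[of _ "1 / k"]) auto
  qed
  then show ?thesis by blast
qed

lemma ray_nz: "ray p q \<Longrightarrow> p \<noteq> 0 \<and> q \<noteq> 0"
  by (auto simp: ray_def)

lemma ray_trans: "ray p q \<Longrightarrow> ray q r \<Longrightarrow> ray p r"
  unfolding ray_def by (metis mult_pos_pos scaleR_scaleR)

lemma ray_minus: "ray (- p) (- q) \<longleftrightarrow> ray p q"
  by (auto simp: ray_def)

lemma ray_minus_left: "ray (- p) q \<longleftrightarrow> ray p (- q)"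
  by (metis ray_minus minus_minus)

lemma ray_antisym: "ray p q \<Longrightarrow> \<not> ray p (- q)"
proof
  assume "ray p q" "ray p (- q)"
  then obtain k l where *: "p \<noteq> 0" "k > 0" "l > 0" "q = k *\<^sub>R p" "- q = l *\<^sub>R p" by (auto simp: ray_def)
  then have "(k + l) *\<^sub>R p = 0" by (simp add: scaleR_add_left flip: *(4,5))
  then show False using * by auto
qed

text \<open>A strict triangle inequality for one of these triples would make the whole chain longer
  than the angle between its ends.\<close>

lemma chain4:
  assumes "ang p1 p2 + ang p2 p3 + ang p3 p4 = ang p1 p4"
  shows "btw p1 p2 p3" "btw p1 p2 p4" "btw p1 p3 p4" "btw p2 p3 p4"
  using assms ang_triangle[of p1 p3 p2] ang_triangle[of p1 p4 p3]
    ang_triangle[of p2 p4 p3] ang_triangle[of p1 p4 p2] unfolding btw_def by linarith+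

text \<open>The zero vector is at distance \<open>pi / 2\<close> from both \<open>q\<close> and a
  nonzero \<open>r\<close>, which leaves length zero for the leg from \<open>q\<close> to
  \<open>r\<close>.\<close>

lemma btw_zero_left: "btw 0 q r \<Longrightarrow> q \<noteq> 0 \<Longrightarrow> ray q r"
  using ang_nonneg[of q r] ang_eq_0[of q r]
  by (cases "r = 0") (auto simp: btw_def ang_zero_left ang_zero_right)

lemma btw_zero_right: "btw p q 0 \<Longrightarrow> q \<noteq> 0 \<Longrightarrow> ray q p"
  using btw_zero_left btw_sym by blast

text \<open>The first leg already has the maximal length \<open>pi\<close>.\<close>

lemma btw_opp: "btw p q r \<Longrightarrow> ray p (- q) \<Longrightarrow> ray q r"
  using ang_le_pi[of p r] ang_nonneg[of q r] ang_eq_0[of q r] ray_nz[of p "- q"]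
  by (auto simp: btw_def ang_eq_pi[symmetric])

lemma btw_ray: "btw p q r \<Longrightarrow> ray p r \<Longrightarrow> ray p q"
  using ang_nonneg[of q r] ang_nonneg[of p q] ang_eq_0[of p q] ray_nz[of p r] ang_eq_0[of p r]
  by (auto simp: btw_def)

text \<open>The interpolation identity is solved for \<open>r\<close>; independence of
  \<open>p\<close> and \<open>q\<close> keeps its coefficient \<open>sin (ang p q)\<close> away from
  zero.\<close>

lemma btw_in_span:
  assumes "btw p q r" "p \<noteq> 0" "\<not> (\<exists>k. q = k *\<^sub>R p)"
  shows "r \<in> span {p, q}"
proof (cases "r = 0")
  case False
  have q: "q \<noteq> 0" using assms(3) by (metis scaleR_zero_left)
  have "ang p q \<noteq> 0"
    using assms by (auto simp: ang_eq_0 ray_def)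
  moreover have "ang p q \<noteq> pi"
  proof
    assume "ang p q = pi"
    then obtain k where "- q = k *\<^sub>R p" by (auto simp: ang_eq_pi ray_def)
    then have "q = (- k) *\<^sub>R p" by (metis minus_minus scaleR_minus_left)
    with assms(3) show False by blast
  qed
  ultimately have s: "sin (ang p q) > 0"
    using ang_nonneg[of p q] ang_le_pi[of p q] by (intro sin_gt_zero) auto
  have "sin (ang q r) *\<^sub>R sgn p + sin (ang p q) *\<^sub>R sgn r = sin (ang p r) *\<^sub>R sgn q"
    by (rule btw_identity) (use assms q False in auto)
  then have "sin (ang p q) *\<^sub>R sgn r = sin (ang p r) *\<^sub>R sgn q - sin (ang q r) *\<^sub>R sgn p"
    by (simp add: algebra_simps)
  also have "\<dots> \<in> span {p, q}"
    by (intro span_diff span_scale) (simp_all add: sgn_div_norm span_base span_scale)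
  finally have "(1 / (sin (ang p q) / norm r)) *\<^sub>R (sin (ang p q) *\<^sub>R sgn r) \<in> span {p, q}"
    by (rule span_scale)
  then show ?thesis using s False by (simp add: sgn_div_norm)
qed (simp add: span_zero)

lemma btw_mid_in_span:
  assumes "btw p q r" "p \<noteq> 0" "\<not> (\<exists>k. r = k *\<^sub>R p)"
  shows "q \<in> span {p, r}"
proof (cases "q = 0")
  case False
  have r: "r \<noteq> 0" using assms(3) by (metis scaleR_zero_left)
  have "ang p r \<noteq> 0"
    using assms by (auto simp: ang_eq_0 ray_def)
  moreover have "ang p r \<noteq> pi"
  proof
    assume "ang p r = pi"
    then obtain k where "- r = k *\<^sub>R p" by (auto simp: ang_eq_pi ray_def)
    then have "r = (- k) *\<^sub>R p" by (metis minus_minus scaleR_minus_left)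
    with assms(3) show False by blast
  qed
  ultimately have s: "sin (ang p r) > 0"
    using ang_nonneg[of p r] ang_le_pi[of p r] by (intro sin_gt_zero) auto
  have "sin (ang q r) *\<^sub>R sgn p + sin (ang p q) *\<^sub>R sgn r = sin (ang p r) *\<^sub>R sgn q"
    by (rule btw_identity) (use assms r False in auto)
  then have "sin (ang p r) *\<^sub>R sgn q = sin (ang q r) *\<^sub>R sgn p + sin (ang p q) *\<^sub>R sgn r" by simp
  also have "\<dots> \<in> span {p, r}"
    by (intro span_add span_scale) (simp_all add: sgn_div_norm span_base span_scale)
  finally have "(1 / (sin (ang p r) / norm q)) *\<^sub>R (sin (ang p r) *\<^sub>R sgn q) \<in> span {p, r}"
    by (rule span_scale)
  then show ?thesis using s False by (simp add: sgn_div_norm)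
qed (simp add: span_zero)

section \<open>Sums over one period\<close>

lemma sum_cyclic_shift:
  fixes f :: "int \<Rightarrow> 'a::comm_monoid_add"
  assumes "p \<ge> 0" "f p = f 0"
  shows "(\<Sum>a\<in>{0..<p}. f (a + 1)) = (\<Sum>a\<in>{0..<p}. f a)"
proof (cases "p = 0")
  case False
  with assms have p: "p > 0" by simp
  have "(\<Sum>a\<in>{0..<p}. f (a + 1)) = (\<Sum>a\<in>{1..<p+1}. f a)"
    by (rule sum.reindex_bij_witness[of _ "\<lambda>a. a - 1" "\<lambda>a. a + 1"]) auto
  also have "{1..<p+1} = insert p {1..<p}" using p by auto
  also have "sum f \<dots> = f p + sum f {1..<p}" by simp
  also have "\<dots> = sum f (insert 0 {1..<p})" using assms by simp
  also have "insert 0 {1..<p} = {0..<p}" using p by auto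
  finally show ?thesis .
qed simp

lemma sum_cyclic_shift_int:
  fixes f :: "int \<Rightarrow> 'a::comm_monoid_add"
  assumes p: "p \<ge> 0" and per: "\<And>a. f (a + p) = f a"
  shows "(\<Sum>a\<in>{0..<p}. f (a + k)) = (\<Sum>a\<in>{0..<p}. f a)"
proof -
  have 1: "(\<Sum>a\<in>{0..<p}. f (a + (k + 1))) = (\<Sum>a\<in>{0..<p}. f (a + k))" for k
    using sum_cyclic_shift[of p "\<lambda>a. f (a + k)"] p per[of k] by (simp add: add.commute add.left_commute)
  show ?thesis
  proof (induction k rule: int_induct[of _ 0])
    case (step2 i)
    then show ?case using 1[of "i - 1"] by simp
  qed (use 1 in simp_all)
qed

section \<open>Gate networks\<close>

locale gates =
  fixes c s :: "int \<Rightarrow> int \<Rightarrow> real"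
  assumes c_pos: "c a b > 0" and s_pos: "s a b > 0" and cs: "(c a b)\<^sup>2 = 1 + (s a b)\<^sup>2"

text \<open>The output in direction \<open>b\<close> leans towards \<open>x\<close> and the one in
  direction \<open>a\<close> towards \<open>y\<close>; this is their order on the arc from
  \<open>x a b\<close> to \<open>y a b\<close>.\<close>

definition gate_solution ::
    "(int \<Rightarrow> int \<Rightarrow> real) \<Rightarrow> (int \<Rightarrow> int \<Rightarrow> real) \<Rightarrow> (int \<Rightarrow> int \<Rightarrow> 'a::real_vector) \<Rightarrow> (int \<Rightarrow> int \<Rightarrow> 'a) \<Rightarrow> bool" where
  "gate_solution c s x y \<longleftrightarrow> (\<forall>a b.
     y a (b + 1) = c a b *\<^sub>R x a b + s a b *\<^sub>R y a b \<and>
     x (a + 1) b = s a b *\<^sub>R x a b + c a b *\<^sub>R y a b)"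

text \<open>Equality in the triangle inequalities that make \<open>row_length\<close> nonincreasing.\<close>

definition tight :: "(int \<Rightarrow> int \<Rightarrow> 'a::real_inner) \<Rightarrow> (int \<Rightarrow> int \<Rightarrow> 'a) \<Rightarrow> bool" where
  "tight x y \<longleftrightarrow> (\<forall>a b.
     ang (x (a + 1) b) (y a b) + ang (y a b) (x (a + 1) (b - 1)) + ang (x (a + 1) (b - 1)) (y (a + 1) b)
       = ang (x (a + 1) b) (y (a + 1) b))"

text \<open>One period of the polygon through \<open>x a b\<close>, \<open>y a b\<close>,
  \<open>x (a + 1) (b - 1)\<close>, \<open>y (a + 1) (b - 1)\<close> and so on, along the
  antidiagonal \<open>a + b = t\<close>.\<close>

definition row_length :: "int \<Rightarrow> (int \<Rightarrow> int \<Rightarrow> 'a::real_inner) \<Rightarrow> (int \<Rightarrow> int \<Rightarrow> 'a) \<Rightarrow> int \<Rightarrow> real" where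
  "row_length p x y t = (\<Sum>a\<in>{0..<p}. ang (x a (t - a)) (y a (t - a)) + ang (y a (t - a)) (x (a + 1) (t - a - 1)))"

text \<open>The length saved when the detour over \<open>y a b\<close> and
  \<open>x (a + 1) (b - 1)\<close>, two points of the old row, is replaced by a direct arc of the
  new row.\<close>

definition defect :: "(int \<Rightarrow> int \<Rightarrow> 'a::real_inner) \<Rightarrow> (int \<Rightarrow> int \<Rightarrow> 'a) \<Rightarrow> int \<Rightarrow> int \<Rightarrow> real" where
  "defect x y a b =
     ang (x (a + 1) b) (y a b) + ang (y a b) (x (a + 1) (b - 1)) + ang (x (a + 1) (b - 1)) (y (a + 1) b)
       - ang (x (a + 1) b) (y (a + 1) b)"

lemma defect_nonneg: "defect x y a b \<ge> 0"
  unfolding defect_def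
  using ang_triangle[of "x (a + 1) b" "y (a + 1) b" "y a b"]
    ang_triangle[of "y a b" "y (a + 1) b" "x (a + 1) (b - 1)"] by linarith

lemma tight_iff_defect: "tight x y \<longleftrightarrow> (\<forall>a b. defect x y a b = 0)"
  by (auto simp: tight_def defect_def)

context gates begin

lemma gate_ang:
  "ang u (c a b *\<^sub>R u + s a b *\<^sub>R v) + ang (c a b *\<^sub>R u + s a b *\<^sub>R v) (s a b *\<^sub>R u + c a b *\<^sub>R v)
     + ang (s a b *\<^sub>R u + c a b *\<^sub>R v) v = ang u v"
proof -
  let ?c = "c a b" and ?s = "s a b"
  have 1: "btw u (?c *\<^sub>R u + ?s *\<^sub>R v) v" using c_pos s_pos by (rule btw_cone)
  \<comment> \<open>The second output lies in the cone of the first output and \<open>v\<close>.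
    Rewriting the coefficient of \<open>v\<close> as \<open>?c\<close> is where the relation between
    \<open>c\<close> and \<open>s\<close> enters.\<close>
  have "btw (?c *\<^sub>R u + ?s *\<^sub>R v) ((?s / ?c) *\<^sub>R (?c *\<^sub>R u + ?s *\<^sub>R v) + (1 / ?c) *\<^sub>R v) v"
    using c_pos[of a b] s_pos[of a b] by (intro btw_cone) auto
  also have "(?s / ?c) *\<^sub>R (?c *\<^sub>R u + ?s *\<^sub>R v) + (1 / ?c) *\<^sub>R v
      = ?s *\<^sub>R u + ((1 + ?s\<^sup>2) / ?c) *\<^sub>R v"
    using c_pos[of a b] by (simp add: scaleR_add_right add_divide_distrib scaleR_add_left power2_eq_square)
  also have "(1 + ?s\<^sup>2) / ?c = ?c" using c_pos[of a b] unfolding cs[symmetric] by (simp add: power2_eq_square)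
  finally show ?thesis using 1 unfolding btw_def by linarith
qed

text \<open>Both rows are compared with the polygon that contains the inputs and the outputs of all
  gates between them: inserting the outputs is free by \<open>gate_ang\<close>, and dropping the
  inputs saves the defects. The map \<open>\<phi>\<close> closes up the cyclic sums.\<close>

lemma row_length_step:
  assumes sol: "gate_solution c s x y" and p: "p \<ge> 0"
    and per: "\<And>a b. x (a + p) (b - p) = \<phi> (x a b)" "\<And>a b. y (a + p) (b - p) = \<phi> (y a b)"
    and iso: "\<And>u v. ang (\<phi> u) (\<phi> v) = ang u v"
  shows "row_length p x y t - row_length p x y (t + 1) = (\<Sum>a\<in>{0..<p}. defect x y a (t - a))"
proof -
  define f where "f a = ang (x a (t - a)) (y a (t - a + 1))" for a
  define g where "g a = ang (x a (t + 1 - a)) (y a (t + 1 - a))" for a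
  have fp: "f p = f 0"
    using per(1)[of 0 t] per(2)[of 0 "t + 1"] iso by (simp add: f_def algebra_simps)
  have gp: "g p = g 0"
    using per(1)[of 0 "t + 1"] per(2)[of 0 "t + 1"] iso by (simp add: g_def)
  have seg: "ang (x a (t - a)) (y a (t - a)) = f a + ang (y a (t - a + 1)) (x (a + 1) (t - a))
      + ang (x (a + 1) (t - a)) (y a (t - a))" for a
    using gate_ang[of "x a (t - a)" a "t - a" "y a (t - a)"] sol
    unfolding gate_solution_def f_def by simp
  have "row_length p x y t = (\<Sum>a\<in>{0..<p}. f a) + (\<Sum>a\<in>{0..<p}. ang (y a (t - a + 1)) (x (a + 1) (t - a)))
      + (\<Sum>a\<in>{0..<p}. ang (x (a + 1) (t - a)) (y a (t - a)) + ang (y a (t - a)) (x (a + 1) (t - a - 1)))"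
    unfolding row_length_def seg by (simp add: sum.distrib algebra_simps)
  moreover have "row_length p x y (t + 1) = (\<Sum>a\<in>{0..<p}. g a)
      + (\<Sum>a\<in>{0..<p}. ang (y a (t - a + 1)) (x (a + 1) (t - a)))"
    unfolding row_length_def g_def by (simp add: sum.distrib algebra_simps)
  moreover have "(\<Sum>a\<in>{0..<p}. f a) = (\<Sum>a\<in>{0..<p}. ang (x (a + 1) (t - a - 1)) (y (a + 1) (t - a)))"
    unfolding sum_cyclic_shift[of p f, OF p fp, symmetric] by (simp add: f_def algebra_simps)
  moreover have "(\<Sum>a\<in>{0..<p}. g a) = (\<Sum>a\<in>{0..<p}. ang (x (a + 1) (t - a)) (y (a + 1) (t - a)))"
    unfolding sum_cyclic_shift[of p g, OF p gp, symmetric] by (simp add: g_def algebra_simps)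
  ultimately show ?thesis
    by (simp add: defect_def sum.distrib sum_subtractf)
qed

text \<open>A nonincreasing function of the row with the same limit at both ends is constant, so
  every defect vanishes. By monotonicity it is enough to know the limits along multiples of
  \<open>T\<close>, where quasiperiodicity gives access to them.\<close>

lemma tight_if_limits:
  assumes sol: "gate_solution c s x y" and p: "p > 0" and T: "T > 0"
    and per: "\<And>a b. x (a + p) (b - p) = \<phi> (x a b)" "\<And>a b. y (a + p) (b - p) = \<phi> (y a b)"
    and iso: "\<And>u v. ang (\<phi> u) (\<phi> v) = ang u v"
    and lim: "(\<lambda>k::nat. row_length p x y (T * int k)) \<longlonglongrightarrow> L"
      "(\<lambda>k::nat. row_length p x y (- (T * int k))) \<longlonglongrightarrow> L"
  shows "tight x y"
proof -
  let ?R = "row_length p x y"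
  have step: "?R t - ?R (t + 1) = (\<Sum>a\<in>{0..<p}. defect x y a (t - a))" for t
    using sol less_imp_le[OF p] per(1) per(2) iso
    by (rule row_length_step[where \<phi> = \<phi> and x = x and y = y and p = p])
  have mono1: "?R (t + 1) \<le> ?R t" for t
  proof -
    have "0 \<le> (\<Sum>a\<in>{0..<p}. defect x y a (t - a))" by (intro sum_nonneg defect_nonneg)
    then show ?thesis using step[of t] by linarith
  qed
  have mono: "?R t' \<le> ?R t" if "t \<le> t'" for t t'
    using that
  proof (induction t' rule: int_ge_induct)
    case (step i)
    then show ?case using mono1[of i] by simp
  qed simp
  have const: "?R t = L" for t
  proof (rule antisym)
    have big: "\<bar>t\<bar> \<le> T * int k" if "k \<ge> nat \<bar>t\<bar>" for k
    proof -
      have "\<bar>t\<bar> \<le> int k" using that by linarith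
      also have "\<dots> \<le> T * int k" using T by (simp add: mult_le_cancel_right1)
      finally show ?thesis .
    qed
    show "?R t \<le> L"
      by (rule tendsto_lowerbound[OF lim(2)])
        (auto intro!: eventually_sequentiallyI[of "nat \<bar>t\<bar>"] mono dest!: big)
    show "L \<le> ?R t"
      by (rule tendsto_upperbound[OF lim(1)])
        (auto intro!: eventually_sequentiallyI[of "nat \<bar>t\<bar>"] mono dest!: big)
  qed
  have z: "defect x y a (t - a) = 0" if "a \<in> {0..<p}" for a t
  proof -
    have "(\<Sum>a\<in>{0..<p}. defect x y a (t - a)) = 0"
      using step[of t] const[of t] const[of "t + 1"] by linarith
    then show ?thesis
      using that by (subst (asm) sum_nonneg_eq_0_iff) (auto intro: defect_nonneg)
  qed
  have shift: "defect x y (a + p) (b - p) = defect x y a b" for a b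
  proof -
    have "x (a + p + 1) (b - p) = \<phi> (x (a + 1) b)" "x (a + p + 1) (b - p - 1) = \<phi> (x (a + 1) (b - 1))"
      "y (a + p + 1) (b - p) = \<phi> (y (a + 1) b)"
      using per(1)[of "a + 1" b] per(1)[of "a + 1" "b - 1"] per(2)[of "a + 1" b] by (simp_all add: algebra_simps)
    then show ?thesis unfolding defect_def using per by (simp add: iso)
  qed
  have shift': "defect x y (a + p * k) (b - p * k) = defect x y a b" for a b k
  proof (induction k rule: int_induct[of _ 0])
    case (step1 i)
    then show ?case using shift[of "a + p * i" "b - p * i"] by (simp add: algebra_simps)
  next
    case (step2 i)
    then show ?case using shift[of "a + p * (i - 1)" "b - p * (i - 1)"] by (simp add: algebra_simps)
  qed simp
  show ?thesis unfolding tight_iff_defect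
  proof (intro allI)
    fix a b
    \<comment> \<open>Each gate is moved along its antidiagonal into the summation range
      \<open>{0..<p}\<close>.\<close>
    have "defect x y (a mod p) ((a + b) - a mod p) = 0" using p by (intro z) auto
    moreover have "a mod p + p * (a div p) = a" "(a + b) - a mod p - p * (a div p) = b"
      using mult_div_mod_eq[of p a] by linarith+
    ultimately show "defect x y a b = 0"
      using shift'[of "a mod p" "a div p" "(a + b) - a mod p"] by metis
  qed
qed

end

section \<open>Rigidity of tight solutions\<close>

text \<open>Dimension at most one. The zero space is included so that a gate with two vanishing
  inputs is covered by the same argument.\<close>

definition line :: "'a::real_vector set \<Rightarrow> bool" where
  "line S \<longleftrightarrow> subspace S \<and> (\<forall>p\<in>S. \<forall>r\<in>S. p \<noteq> 0 \<longrightarrow> (\<exists>k. r = k *\<^sub>R p))"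

lemma line_span: "line (span {q})"
  unfolding line_def
proof (intro conjI ballI impI)
  fix p r assume "p \<in> span {q}" "r \<in> span {q}" "p \<noteq> 0"
  then obtain k l where kl: "p = k *\<^sub>R q" "r = l *\<^sub>R q" by (auto simp: span_singleton)
  then have "r = (l / k) *\<^sub>R p" using \<open>p \<noteq> 0\<close> by auto
  then show "\<exists>k. r = k *\<^sub>R p" ..
qed simp

lemma line_ray:
  assumes "line S" "p \<in> S" "r \<in> S" "p \<noteq> 0" "r \<noteq> 0"
  shows "ray p r \<or> ray p (- r)"
proof -
  obtain k where k: "r = k *\<^sub>R p" using assms unfolding line_def by blast
  then have "k \<noteq> 0" using assms by auto
  show ?thesis
  proof (cases "k > 0")
    case False
    then have "- k > 0" "- r = (- k) *\<^sub>R p" using k \<open>k \<noteq> 0\<close> by auto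
    then show ?thesis using assms(4) unfolding ray_def by blast
  qed (use k assms(4) in \<open>auto simp: ray_def\<close>)
qed

lemma ray_mem: "subspace S \<Longrightarrow> ray p r \<Longrightarrow> p \<in> S \<Longrightarrow> r \<in> S"
  by (auto simp: ray_def subspace_scale)

lemma ray_mem': "subspace S \<Longrightarrow> ray p r \<Longrightarrow> r \<in> S \<Longrightarrow> p \<in> S"
  using ray_mem ray_sym by blast

text \<open>Only antipodal points are joined by a minimal arc that leaves their line; a zero
  endpoint would force \<open>v\<close> onto the ray of the other one.\<close>

lemma btw_line_outer:
  assumes S: "line S" and "p \<in> S" "r \<in> S" "v \<notin> S" "btw p v r"
  shows "ray p (- r)"
proof -
  have sub: "subspace S" using S by (simp add: line_def)
  have v: "v \<noteq> 0" using assms subspace_0[OF sub] by auto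
  have "p \<noteq> 0" using btw_zero_left[of v r] v assms ray_mem'[OF sub] by auto
  moreover have "r \<noteq> 0" using btw_zero_right[of p v] v assms ray_mem'[OF sub] by auto
  moreover have "\<not> ray p r" using btw_ray[of p v r] assms ray_mem[OF sub] by auto
  ultimately show ?thesis using line_ray assms by blast
qed

text \<open>If \<open>r\<close> were antipodal to \<open>p\<close>, the leg from \<open>p\<close> to
  \<open>r\<close> would use up the whole length \<open>pi\<close> and put \<open>v\<close> on the
  ray of \<open>p\<close>.\<close>

lemma btw_line_inner:
  assumes S: "line S" and "p \<in> S" "r \<in> S" "v \<notin> S" "p \<noteq> 0" "btw v p r"
  shows "ray p r"
proof -
  have sub: "subspace S" using S by (simp add: line_def)
  have "r \<noteq> 0" using btw_zero_right[of v p] assms ray_mem[OF sub] by auto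
  moreover have "\<not> ray p (- r)"
  proof
    assume "ray p (- r)"
    then have "ray p v"
      using btw_opp[of r p v] assms(6) btw_sym ray_sym ray_minus_left by metis
    then show False using assms ray_mem[OF sub] by auto
  qed
  ultimately show ?thesis using line_ray assms by blast
qed

lemma btw_zero_mid: "btw p 0 r \<Longrightarrow> p \<noteq> 0 \<Longrightarrow> r \<noteq> 0 \<Longrightarrow> ray p (- r)"
  by (simp add: btw_def ang_zero_left ang_zero_right flip: ang_eq_pi)

lemma linear_inj_eq_0: "linear f \<Longrightarrow> inj f \<Longrightarrow> f u = 0 \<longleftrightarrow> u = 0"
  using linear_injective_0[of f] linear_0[of f] by blast

lemma ray_linear:
  assumes "linear f" "inj f" shows "ray (f u) (f v) \<longleftrightarrow> ray u v"
proof -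
  have "f v = k *\<^sub>R f u \<longleftrightarrow> v = k *\<^sub>R u" for k
    using assms by (simp add: inj_eq flip: linear_scale)
  then show ?thesis using assms by (simp add: ray_def linear_inj_eq_0)
qed

text \<open>A single nonzero vector of \<open>S\<close> with image in \<open>S\<close> certifies
  that \<open>f\<close> maps the line onto itself. This is how membership in \<open>S\<close>
  becomes periodic.\<close>

lemma line_shift:
  assumes "line S" "linear f" "inj f" "w \<in> S" "w \<noteq> 0" "f w \<in> S"
  shows "f u \<in> S \<longleftrightarrow> u \<in> S"
proof
  have sub: "subspace S" using assms(1) by (simp add: line_def)
  {
    assume "u \<in> S"
    then obtain k where "u = k *\<^sub>R w" using assms unfolding line_def by blast
    then show "f u \<in> S" using assms sub by (simp add: linear_scale subspace_scale)
  }
  assume "f u \<in> S"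
  moreover have "f w \<noteq> 0" using assms by (simp add: linear_inj_eq_0)
  ultimately obtain k where "f u = k *\<^sub>R f w" using assms unfolding line_def by blast
  then have "u = k *\<^sub>R w" using assms(2,3) by (simp add: linear_scale[symmetric] inj_eq)
  then show "u \<in> S" using assms sub by (simp add: subspace_scale)
qed

lemma int_shift_iff:
  fixes P :: "int \<Rightarrow> bool"
  assumes "\<And>b. P (b + N) \<longleftrightarrow> P b"
  shows "P (b + N * k) \<longleftrightarrow> P b"
proof (induction k rule: int_induct[of _ 0])
  case (step1 i)
  then show ?case using assms[of "b + N * i"] by (simp add: algebra_simps)
next
  case (step2 i)
  then show ?case using assms[of "b + N * (i - 1)"] by (simp add: algebra_simps)
qed simp

lemma int_shift_all_below:
  fixes P :: "int \<Rightarrow> bool"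
  assumes "\<And>b. P (b + N) \<longleftrightarrow> P b" "N > 0" "\<And>b. b \<le> b0 \<Longrightarrow> P b"
  shows "P b"
proof -
  have "b - b0 \<le> \<bar>b - b0\<bar>" by simp
  also have "\<dots> \<le> N * \<bar>b - b0\<bar>" using assms(2) by (simp add: mult_le_cancel_right1)
  finally have "P (b + N * (- \<bar>b - b0\<bar>))" by (intro assms(3)) (simp add: algebra_simps)
  then show ?thesis using int_shift_iff[of P N] assms(1) by blast
qed

lemma int_shift_all_above:
  fixes P :: "int \<Rightarrow> bool"
  assumes "\<And>b. P (b + N) \<longleftrightarrow> P b" "N > 0" "\<And>b. b \<ge> b0 \<Longrightarrow> P b"
  shows "P b"
proof -
  have "b0 - b \<le> \<bar>b - b0\<bar>" by simp
  also have "\<dots> \<le> N * \<bar>b - b0\<bar>" using assms(2) by (simp add: mult_le_cancel_right1)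
  finally have "P (b + N * \<bar>b - b0\<bar>)" by (intro assms(3)) (simp add: algebra_simps)
  then show ?thesis using int_shift_iff[of P N] assms(1) by blast
qed

section \<open>Gates of a tight solution with both inputs on a given line\<close>

locale tight_solution = gates +
  fixes x y :: "int \<Rightarrow> int \<Rightarrow> 'a::real_inner"
  assumes sol: "gate_solution c s x y" and tight: "tight x y"
begin

lemma rec_y: "y a (b + 1) = c a b *\<^sub>R x a b + s a b *\<^sub>R y a b"
  and rec_x: "x (a + 1) b = s a b *\<^sub>R x a b + c a b *\<^sub>R y a b"
  using sol by (auto simp: gate_solution_def)

lemma x_from_out: "x a b = c a b *\<^sub>R y a (b + 1) - s a b *\<^sub>R x (a + 1) b"
proof -
  have "c a b *\<^sub>R y a (b + 1) - s a b *\<^sub>R x (a + 1) b = ((c a b)\<^sup>2 - (s a b)\<^sup>2) *\<^sub>R x a b"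
    unfolding rec_y rec_x by (simp add: algebra_simps power2_eq_square)
  then show ?thesis by (simp add: cs)
qed

lemma y_from_out: "y a b = c a b *\<^sub>R x (a + 1) b - s a b *\<^sub>R y a (b + 1)"
proof -
  have "c a b *\<^sub>R x (a + 1) b - s a b *\<^sub>R y a (b + 1) = ((c a b)\<^sup>2 - (s a b)\<^sup>2) *\<^sub>R y a b"
    unfolding rec_y rec_x by (simp add: algebra_simps power2_eq_square)
  then show ?thesis by (simp add: cs)
qed

text \<open>The digits number the four points of the chain in \<open>tight\<close>:
  \<open>x (a + 1) b\<close>, \<open>y a b\<close>, \<open>x (a + 1) (b - 1)\<close>,
  \<open>y (a + 1) b\<close>.\<close>

lemma btw123: "btw (x (a + 1) b) (y a b) (x (a + 1) (b - 1))"
  and btw124: "btw (x (a + 1) b) (y a b) (y (a + 1) b)"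
  and btw134: "btw (x (a + 1) b) (x (a + 1) (b - 1)) (y (a + 1) b)"
  and btw234: "btw (y a b) (x (a + 1) (b - 1)) (y (a + 1) b)"
  using tight unfolding tight_def by (blast intro: chain4)+

definition inputs_in :: "'a set \<Rightarrow> int \<Rightarrow> int \<Rightarrow> bool" where
  "inputs_in S a b \<longleftrightarrow> x a b \<in> S \<and> y a b \<in> S"

lemma inputs_in_out: "subspace S \<Longrightarrow> inputs_in S a b \<Longrightarrow> x (a + 1) b \<in> S \<and> y a (b + 1) \<in> S"
  by (simp add: inputs_in_def rec_x rec_y subspace_add subspace_scale)

lemma inputs_in_from_out: "subspace S \<Longrightarrow> x (a + 1) b \<in> S \<Longrightarrow> y a (b + 1) \<in> S \<Longrightarrow> inputs_in S a b"
  using x_from_out[of a b] y_from_out[of a b] unfolding inputs_in_def by (metis subspace_diff subspace_scale)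

lemma scale_mem_iff: "subspace S \<Longrightarrow> k \<noteq> 0 \<Longrightarrow> k *\<^sub>R v \<in> S \<longleftrightarrow> v \<in> S" for S :: "'a set"
  by (metis scaleR_one scaleR_scaleR subspace_scale left_inverse)

lemma inputs_in_from_right:
  assumes "subspace S" "x (a + 1) b \<in> S" "y a b \<in> S" shows "inputs_in S a b"
proof -
  have "s a b *\<^sub>R x a b = x (a + 1) b - c a b *\<^sub>R y a b" by (simp add: rec_x)
  also have "\<dots> \<in> S" using assms by (simp add: subspace_diff subspace_scale)
  finally show ?thesis using assms s_pos[of a b] by (simp add: inputs_in_def scale_mem_iff)
qed

lemma inputs_in_from_left:
  assumes "subspace S" "y a (b + 1) \<in> S" "x a b \<in> S" shows "inputs_in S a b"
proof -
  have "s a b *\<^sub>R y a b = y a (b + 1) - c a b *\<^sub>R x a b" by (simp add: rec_y)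
  also have "\<dots> \<in> S" using assms by (simp add: subspace_diff subspace_scale)
  finally show ?thesis using assms s_pos[of a b] by (simp add: inputs_in_def scale_mem_iff)
qed

text \<open>Since \<open>y (a - 1) b\<close> lies outside \<open>S\<close> but between the two
  inputs, these are antipodal. Since \<open>x a b\<close> lies between the outside value
  \<open>y (a - 1) (b + 1)\<close> and the output \<open>y a (b + 1)\<close>, the gate cannot
  reverse its direction.\<close>

lemma left_boundary:
  assumes S: "line S" and g: "inputs_in S a b" and ng: "\<not> inputs_in S (a - 1) b"
  shows "ray (x a b) (- y a b)" "ray (x a b) (y a (b + 1))"
proof -
  have sub: "subspace S" using S by (simp add: line_def)
  have xS: "x a b \<in> S" and yS: "y a b \<in> S" using g by (auto simp: inputs_in_def)
  have "y (a - 1) b \<notin> S" using inputs_in_from_right[OF sub, of "a - 1" b] xS ng by auto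
  then show r: "ray (x a b) (- y a b)"
    using btw124[of "a - 1" b] btw_line_outer[OF S xS yS] by simp
  have "y (a - 1) (b + 1) \<notin> S" using inputs_in_from_out[OF sub, of "a - 1" b] xS ng by auto
  then show "ray (x a b) (y a (b + 1))"
    using btw234[of "a - 1" "b + 1"] btw_line_inner[OF S xS, of "y a (b + 1)" "y (a - 1) (b + 1)"]
      ray_nz[OF r] inputs_in_out[OF sub g] by simp
qed

text \<open>The value \<open>x (a + 1) (b + 1)\<close> leaves \<open>S\<close>, and the minimal arc
  from it through one output of the gate ends at the other; within the line it cannot turn
  back.\<close>

lemma up_left_boundary:
  assumes S: "line S" and g: "inputs_in S a b" and ng: "\<not> inputs_in S a (b + 1)" and nz: "y a (b + 1) \<noteq> 0"
  shows "ray (y a (b + 1)) (x (a + 1) b)"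
proof -
  have sub: "subspace S" using S by (simp add: line_def)
  have "x (a + 1) (b + 1) \<notin> S" using inputs_in_from_right[OF sub, of a "b + 1"] inputs_in_out[OF sub g] ng by auto
  then show ?thesis
    using btw123[of a "b + 1"] btw_line_inner[OF S, of "y a (b + 1)" "x (a + 1) b" "x (a + 1) (b + 1)"]
      nz inputs_in_out[OF sub g] by simp
qed

text \<open>The mismatch is forced on the gate below: \<open>y a b\<close> is one of its outputs,
  and as \<open>x (a + 1) b\<close> is antipodal to \<open>y a b\<close>, no length is left between
  \<open>y a b\<close> and the next point \<open>x (a + 1) (b - 1)\<close>.\<close>

lemma flip_down:
  assumes S: "line S" and g: "inputs_in S a b" and ng: "\<not> inputs_in S (a - 1) b"
    and flip: "ray (y a b) (- x (a + 1) b)"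
  shows "inputs_in S a (b - 1) \<and> \<not> inputs_in S (a - 1) (b - 1) \<and> ray (y a (b - 1)) (- x (a + 1) (b - 1))"
proof -
  have sub: "subspace S" using S by (simp add: line_def)
  have xS: "x a b \<in> S" and yS: "y a b \<in> S" using g by (auto simp: inputs_in_def)
  have "ray (x (a + 1) b) (- y a b)" using flip ray_sym ray_minus_left by blast
  then have r: "ray (y a b) (x (a + 1) (b - 1))" using btw123 btw_opp by blast
  then have g': "inputs_in S a (b - 1)" using inputs_in_from_out[OF sub, of a "b - 1"] ray_mem[OF sub] yS by simp
  moreover have ng': "\<not> inputs_in S (a - 1) (b - 1)"
    using inputs_in_out[OF sub, of "a - 1" "b - 1"] inputs_in_from_right[OF sub, of "a - 1" b] xS ng by auto
  moreover have "ray (y a (b - 1)) (- x (a + 1) (b - 1))"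
    using left_boundary[OF S g' ng'] r ray_sym ray_trans ray_minus_left
    by (metis diff_add_cancel)
  ultimately show ?thesis by blast
qed

end

section \<open>Spreading of degenerate gates under two periods\<close>

locale periodic_tight_solution = tight_solution +
  fixes N :: int and \<phi> \<psi> :: "'a::real_inner \<Rightarrow> 'a"
  assumes N: "N > 0" and lin: "linear \<phi>" "inj \<phi>" "linear \<psi>" "inj \<psi>"
    and per_a: "x (a + N) b = \<phi> (x a b)" "y (a + N) b = \<phi> (y a b)"
    and per_b: "x a (b + N) = \<psi> (x a b)" "y a (b + N) = \<psi> (y a b)"
begin

lemma inputs_in_shift_b:
  assumes "line S" "w \<in> S" "w \<noteq> 0" "\<psi> w \<in> S"
  shows "inputs_in S a (b + N) \<longleftrightarrow> inputs_in S a b"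
  using line_shift[OF assms(1) lin(3,4) assms(2-4)] by (simp add: inputs_in_def per_b)

lemma inputs_in_shift_a:
  assumes "line S" "w \<in> S" "w \<noteq> 0" "\<phi> w \<in> S"
  shows "inputs_in S (a + N) b \<longleftrightarrow> inputs_in S a b"
  using line_shift[OF assms(1) lin(1,2) assms(2-4)] by (simp add: inputs_in_def per_a)

text \<open>Otherwise the mismatch of \<open>flip_down\<close> descends by a whole period, past a
  translate of the gate above, which therefore has its inputs in \<open>S\<close>; periodicity
  carries this back up.\<close>

lemma left_boundary_up:
  assumes S: "line S" and g: "inputs_in S a b" and ng: "\<not> inputs_in S (a - 1) b"
  shows "inputs_in S a (b + 1)"
proof (rule ccontr)
  assume up: "\<not> inputs_in S a (b + 1)"
  note L = left_boundary[OF S g ng]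
  have "ray (y a (b + 1)) (x (a + 1) b)" using up_left_boundary[OF S g up] ray_nz[OF L(2)] by blast
  then have flip: "ray (y a b) (- x (a + 1) b)"
    using L ray_sym ray_trans ray_minus_left by metis
  have down: "inputs_in S a (b - int k) \<and> \<not> inputs_in S (a - 1) (b - int k) \<and> ray (y a (b - int k)) (- x (a + 1) (b - int k))" for k
  proof (induction k)
    case (Suc k)
    then show ?case using flip_down[OF S, of a "b - int k"] by (simp add: algebra_simps)
  qed (use g ng flip in simp)
  have "inputs_in S a (b - N)" "\<not> inputs_in S (a - 1) (b - N)" using down[of "nat N"] N by auto
  then have w: "x a (b - N) \<in> S" "x a (b - N) \<noteq> 0"
    using left_boundary[OF S, of a "b - N"] ray_nz by (auto simp: inputs_in_def)
  have "\<psi> (x a (b - N)) \<in> S" using per_b(1)[of a "b - N"] g by (simp add: inputs_in_def)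
  from inputs_in_shift_b[OF S w this, of a "b + 1 - N"] have "inputs_in S a (b + 1) \<longleftrightarrow> inputs_in S a (b + 1 - N)" by simp
  moreover have "inputs_in S a (b + 1 - N)" using down[of "nat (N - 1)"] N by (simp add: algebra_simps)
  ultimately show False using up by simp
qed

text \<open>The sign pattern forced by a left boundary: antipodal inputs, and a
  \<open>b\<close>-output in the direction of \<open>x\<close>. Consequently \<open>y\<close>
  alternates along the column.\<close>

definition column :: "'a set \<Rightarrow> int \<Rightarrow> bool" where
  "column S a \<longleftrightarrow> (\<forall>b. inputs_in S a b \<and> ray (x a b) (- y a b) \<and> ray (x a b) (y a (b + 1)))"

text \<open>Upwards the pattern continues by \<open>left_boundary_up\<close>; if a gate of the left
  column entered \<open>S\<close>, the gate below it would have both outputs, hence both inputs, in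
  \<open>S\<close>. Periodicity supplies the gates below the starting point.\<close>

lemma left_boundary_column:
  assumes S: "line S" and g: "inputs_in S a b" and ng: "\<not> inputs_in S (a - 1) b"
  shows "column S a"
proof -
  have sub: "subspace S" using S by (simp add: line_def)
  have up: "inputs_in S a (b + int k) \<and> \<not> inputs_in S (a - 1) (b + int k)" for k
  proof (induction k)
    case (Suc k)
    let ?b = "b + int k"
    have "inputs_in S a (?b + 1)" using left_boundary_up[OF S] Suc by blast
    moreover have "\<not> inputs_in S (a - 1) (?b + 1)"
    proof
      assume "inputs_in S (a - 1) (?b + 1)"
      then have "inputs_in S (a - 1) ?b"
        using inputs_in_from_out[OF sub, of "a - 1" ?b] Suc by (simp add: inputs_in_def)
      with Suc show False by blast
    qed
    ultimately show ?case by (simp add: algebra_simps)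
  qed (use g ng in simp)
  have ge: "inputs_in S a b' \<and> \<not> inputs_in S (a - 1) b'" if "b' \<ge> b" for b'
    using up[of "nat (b' - b)"] that by simp
  have w: "x a b \<in> S" "x a b \<noteq> 0" "\<psi> (x a b) \<in> S"
    using g ray_nz[OF left_boundary(1)[OF S g ng]] ge[of "b + N"] N by (auto simp: inputs_in_def per_b)
  have "inputs_in S a b' \<and> \<not> inputs_in S (a - 1) b'" for b'
    by (rule int_shift_all_above[of _ N b]) (use N ge inputs_in_shift_b[OF S w] in auto)
  then show ?thesis using left_boundary[OF S] by (auto simp: column_def)
qed

text \<open>Only two patterns between \<open>y a\<close> and \<open>x (a + 1)\<close> are possible:
  agreement everywhere, or a mismatch that spreads downwards and, by periodicity, everywhere. In
  both cases the alternation of \<open>y a\<close> passes to \<open>x (a + 1)\<close>.\<close>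

lemma column_next:
  assumes S: "line S" and L: "column S a"
  shows "column S (a + 1)"
proof -
  have sub: "subspace S" using S by (simp add: line_def)
  have g: "inputs_in S a b" and xy: "ray (x a b) (- y a b)" and xy': "ray (x a b) (y a (b + 1))" for b
    using L by (auto simp: column_def)
  have x'S: "x (a + 1) b \<in> S" for b using inputs_in_out[OF sub g] by blast
  have yS: "y a b \<in> S" "y a b \<noteq> 0" for b using g[of b] xy[of b] ray_nz[OF xy[of b]] by (auto simp: inputs_in_def)
  \<comment> \<open>If the next gate left \<open>S\<close>, a nonzero \<open>x (a + 1) b\<close>
    would be antipodal to \<open>y a b\<close>, and betweenness would put \<open>y (a + 1) b\<close>
    on the ray of \<open>y a b\<close>, inside \<open>S\<close>.\<close>
  have right: "inputs_in S (a + 1) b" for b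
  proof (rule ccontr)
    assume ng: "\<not> inputs_in S (a + 1) b"
    have y'n: "y (a + 1) (b + 1) \<notin> S" using inputs_in_from_left[OF sub _ x'S] ng by blast
    have yn: "y (a + 1) b \<notin> S" using x'S ng by (auto simp: inputs_in_def)
    have t: "btw (y a (b + 1)) (x (a + 1) b) (y (a + 1) (b + 1))" using btw234[of a "b + 1"] by simp
    show False
    proof (cases "x (a + 1) b = 0")
      case True
      have "y (a + 1) (b + 1) \<noteq> 0" using y'n subspace_0[OF sub] by auto
      then have "ray (y a (b + 1)) (- y (a + 1) (b + 1))"
        using btw_zero_mid t yS True by auto
      then show False using ray_mem[OF sub] yS y'n subspace_neg[OF sub] by fastforce
    next
      case False
      then have "ray (x (a + 1) b) (y a (b + 1))"
        using btw_line_inner[OF S x'S _ y'n] yS t btw_sym by blast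
      then have "ray (x (a + 1) b) (- y a b)" using xy[of b] xy'[of b] ray_sym ray_trans by blast
      then have "ray (y a b) (y (a + 1) b)" using btw124 btw_opp by blast
      then show False using ray_mem[OF sub] yS yn by blast
    qed
  qed
  have alt: "ray (y a (b + 1)) (- y a b)" for b using xy[of b] xy'[of b] ray_sym ray_trans by blast
  have down: "ray (y a (b - 1)) (- x (a + 1) (b - 1))" if "\<not> ray (y a b) (x (a + 1) b)" for b
  proof -
    have "ray (y a b) (x (a + 1) (b - 1))"
    proof (cases "x (a + 1) b = 0")
      case True
      then show ?thesis using btw_zero_left[of "y a b" "x (a + 1) (b - 1)"] btw123[of a b] yS[of b] by simp
    next
      case False
      then have "ray (y a b) (- x (a + 1) b)" using line_ray[OF S] yS x'S that by blast
      then have "ray (x (a + 1) b) (- y a b)" using ray_sym ray_minus_left by blast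
      then show ?thesis using btw123 btw_opp by blast
    qed
    then show ?thesis using alt[of "b - 1"] ray_sym ray_trans ray_minus_left by (metis diff_add_cancel)
  qed
  have xalt: "ray (x (a + 1) (b + 1)) (- x (a + 1) b)" for b
  proof (cases "\<forall>b. ray (y a b) (x (a + 1) b)")
    case True
    then show ?thesis using alt[of b] ray_sym ray_trans ray_minus by meson
  next
    case False
    then obtain b0 where "\<not> ray (y a b0) (x (a + 1) b0)" by blast
    then have F0: "ray (y a (b0 - 1)) (- x (a + 1) (b0 - 1))" by (rule down)
    have F: "ray (y a (b0 - 1 - int k)) (- x (a + 1) (b0 - 1 - int k))" for k
    proof (induction k)
      case (Suc k)
      then have "\<not> ray (y a (b0 - 1 - int k)) (x (a + 1) (b0 - 1 - int k))" using ray_antisym by blast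
      from down[OF this] show ?case by (simp add: algebra_simps)
    qed (use F0 in simp)
    have "ray (y a b) (- x (a + 1) b)" for b
    proof (rule int_shift_all_below[of _ N "b0 - 1"])
      show "ray (y a (b + N)) (- x (a + 1) (b + N)) \<longleftrightarrow> ray (y a b) (- x (a + 1) b)" for b
        using lin(3,4) by (simp add: per_b ray_linear linear_neg[symmetric])
      show "ray (y a b) (- x (a + 1) b)" if "b \<le> b0 - 1" for b
        using F[of "nat (b0 - 1 - b)"] that by simp
    qed (rule N)
    then show ?thesis using alt[of b] ray_sym ray_trans ray_minus ray_minus_left by meson
  qed
  have "ray (x (a + 1) b) (y (a + 1) (b + 1))" for b
    using btw134[of a "b + 1"] btw_opp xalt[of b] by simp
  moreover have "ray (x (a + 1) b) (- y (a + 1) b)" for b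
    using calculation[of "b - 1"] xalt[of "b - 1"] ray_minus ray_trans by (metis diff_add_cancel)
  ultimately show ?thesis using right by (simp add: column_def)
qed

text \<open>A boundary starts a column pattern that continues to the right forever; within one
  period it reaches the translate of the very gate that was supposed to lie outside
  \<open>S\<close>.\<close>

lemma inputs_in_left:
  assumes S: "line S" and g: "inputs_in S a b"
  shows "inputs_in S (a - 1) b"
proof (rule ccontr)
  assume ng: "\<not> ?thesis"
  have "column S (a + int k)" for k
  proof (induction k)
    case (Suc k)
    then show ?case using column_next[OF S, of "a + int k"] by (simp add: algebra_simps)
  qed (use left_boundary_column[OF S g ng] in simp)
  then have gk: "inputs_in S (a + int k) b" for k by (simp add: column_def)
  have w: "x a b \<in> S" "x a b \<noteq> 0" "\<phi> (x a b) \<in> S"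
    using g ray_nz[OF left_boundary(1)[OF S g ng]] gk[of "nat N"] N by (auto simp: inputs_in_def per_a)
  have "inputs_in S (a - 1) b \<longleftrightarrow> inputs_in S (a - 1 + N) b" using inputs_in_shift_a[OF S w] by simp
  also have "\<dots>" using gk[of "nat (N - 1)"] N by (simp add: algebra_simps)
  finally show False using ng by simp
qed

text \<open>Reflecting the light-cone lattice exchanges the two families of lines.\<close>

lemma mirror: "periodic_tight_solution (\<lambda>a b. c b a) (\<lambda>a b. s b a) (\<lambda>a b. y b a) (\<lambda>a b. x b a) N \<psi> \<phi>"
proof (intro periodic_tight_solution.intro tight_solution.intro gates.intro tight_solution_axioms.intro
    periodic_tight_solution_axioms.intro)
  show "gate_solution (\<lambda>a b. c b a) (\<lambda>a b. s b a) (\<lambda>a b. y b a) (\<lambda>a b. x b a)"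
    using sol by (auto simp: gate_solution_def add.commute)
  show "tight (\<lambda>a b. y b a) (\<lambda>a b. x b a)"
    unfolding tight_def
  proof (intro allI)
    fix a b
    show "ang (y b (a + 1)) (x b a) + ang (x b a) (y (b - 1) (a + 1)) + ang (y (b - 1) (a + 1)) (x b (a + 1))
      = ang (y b (a + 1)) (x b (a + 1))"
      using tight[unfolded tight_def, rule_format, of "b - 1" "a + 1"] by (simp add: ang_commute)
  qed
qed (use c_pos s_pos cs N lin per_a per_b in auto)

lemma inputs_in_right: "line S \<Longrightarrow> inputs_in S a b \<Longrightarrow> inputs_in S a (b - 1)"
proof -
  interpret m: periodic_tight_solution "\<lambda>a b. c b a" "\<lambda>a b. s b a" "\<lambda>a b. y b a" "\<lambda>a b. x b a" N \<psi> \<phi>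
    by (rule mirror)
  have "m.inputs_in S b a \<longleftrightarrow> inputs_in S a b" for a b by (auto simp: m.inputs_in_def inputs_in_def)
  then show "line S \<Longrightarrow> inputs_in S a b \<Longrightarrow> inputs_in S a (b - 1)" using m.inputs_in_left by blast
qed

text \<open>A line containing the inputs of one gate spreads to all smaller indices by
  \<open>inputs_in_left\<close> and \<open>inputs_in_right\<close>; periodicity then covers the
  whole lattice.\<close>

lemma degenerate_gate_spreads:
  assumes "x a0 b0 \<in> span {q}" "y a0 b0 \<in> span {q}"
  shows "\<exists>q. \<forall>a b. x a b \<in> span {q} \<and> y a b \<in> span {q}"
proof -
  \<comment> \<open>If both inputs vanish, no nonzero vector would be at hand to show that the
    period maps preserve the line; the zero space is preserved by every injective linear
    map.\<close>
  define q' where "q' = (if x a0 b0 = 0 \<and> y a0 b0 = 0 then 0 else q)"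
  define S where "S = span {q'}"
  have S: "line S" unfolding S_def by (rule line_span)
  have g: "inputs_in S a0 b0" using assms by (auto simp: inputs_in_def S_def q'_def span_zero)
  have la: "inputs_in S (a0 - int k) b0" for k
  proof (induction k)
    case (Suc k)
    then show ?case using inputs_in_left[OF S, of "a0 - int k" b0] by (simp add: algebra_simps)
  qed (use g in simp)
  have lb: "inputs_in S (a0 - int k) (b0 - int l)" for k l
  proof (induction l)
    case (Suc l)
    then show ?case using inputs_in_right[OF S, of "a0 - int k" "b0 - int l"] by (simp add: algebra_simps)
  qed (use la in simp)
  have below: "inputs_in S a b" if "a \<le> a0" "b \<le> b0" for a b
    using lb[of "nat (a0 - a)" "nat (b0 - b)"] that by simp
  have sa: "inputs_in S (a + N) b \<longleftrightarrow> inputs_in S a b" for a b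
  proof -
    consider "x a0 b0 = 0 \<and> y a0 b0 = 0" | "x a0 b0 \<noteq> 0" | "y a0 b0 \<noteq> 0" by blast
    then show ?thesis
    proof cases
      case 1
      then show ?thesis using lin by (simp add: S_def q'_def inputs_in_def per_a linear_inj_eq_0)
    next
      case 2
      \<comment> \<open>The certificate for \<open>line_shift\<close>: the preimage one period
        earlier already lies in \<open>S\<close>.\<close>
      have x0: "x a0 b0 = \<phi> (x (a0 - N) b0)" using per_a(1)[of "a0 - N" b0] by simp
      show ?thesis
        by (rule inputs_in_shift_a[OF S, of "x (a0 - N) b0"])
          (use 2 x0 below[of "a0 - N" b0] g N lin linear_0[of \<phi>] in \<open>auto simp: inputs_in_def\<close>)
    next
      case 3
      have x0: "y a0 b0 = \<phi> (y (a0 - N) b0)" using per_a(2)[of "a0 - N" b0] by simp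
      show ?thesis
        by (rule inputs_in_shift_a[OF S, of "y (a0 - N) b0"])
          (use 3 x0 below[of "a0 - N" b0] g N lin linear_0[of \<phi>] in \<open>auto simp: inputs_in_def\<close>)
    qed
  qed
  have sb: "inputs_in S a (b + N) \<longleftrightarrow> inputs_in S a b" for a b
  proof -
    consider "x a0 b0 = 0 \<and> y a0 b0 = 0" | "x a0 b0 \<noteq> 0" | "y a0 b0 \<noteq> 0" by blast
    then show ?thesis
    proof cases
      case 1
      then show ?thesis using lin by (simp add: S_def q'_def inputs_in_def per_b linear_inj_eq_0)
    next
      case 2
      have x0: "x a0 b0 = \<psi> (x a0 (b0 - N))" using per_b(1)[of a0 "b0 - N"] by simp
      show ?thesis
        by (rule inputs_in_shift_b[OF S, of "x a0 (b0 - N)"])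
          (use 2 x0 below[of a0 "b0 - N"] g N lin linear_0[of \<psi>] in \<open>auto simp: inputs_in_def\<close>)
    next
      case 3
      have x0: "y a0 b0 = \<psi> (y a0 (b0 - N))" using per_b(2)[of a0 "b0 - N"] by simp
      show ?thesis
        by (rule inputs_in_shift_b[OF S, of "y a0 (b0 - N)"])
          (use 3 x0 below[of a0 "b0 - N"] g N lin linear_0[of \<psi>] in \<open>auto simp: inputs_in_def\<close>)
    qed
  qed
  have "inputs_in S a b" if "a \<le> a0" for a b
    by (rule int_shift_all_below[of _ N b0]) (use sb N below that in auto)
  then have "inputs_in S a b" for a b
    by (rule int_shift_all_below[of "\<lambda>a. inputs_in S a b" N a0, rotated 2]) (use sa N in auto)
  then show ?thesis unfolding inputs_in_def S_def by blast
qed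

text \<open>If some gate has dependent inputs, everything lies on one line. Otherwise suitable pairs
  of points of every chain in \<open>tight\<close> are independent, so each chain spans a single
  plane, and overlapping chains share it.\<close>

lemma plane: "\<exists>q1 q2. \<forall>a b. x a b \<in> span {q1, q2} \<and> y a b \<in> span {q1, q2}"
proof (cases "\<exists>a b q. x a b \<in> span {q} \<and> y a b \<in> span {q}")
  case True
  then obtain q where "\<forall>a b. x a b \<in> span {q} \<and> y a b \<in> span {q}" using degenerate_gate_spreads by blast
  then show ?thesis by (intro exI[of _ q]) simp
next
  case False
  have sub: "subspace (span T)" for T :: "'a set" by simp
  have ind: "x a b \<noteq> 0" "y a b \<noteq> 0" "\<not> (\<exists>k. y a b = k *\<^sub>R x a b)" "\<not> (\<exists>k. x a b = k *\<^sub>R y a b)" for a b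
    using False by (metis scaleR_zero_left span_base span_scale singletonI span_0)+
  define S where "S = span {x 0 0, y 0 0}"
  have sS: "subspace S" by (simp add: S_def)
  have mem: "u \<in> S" if "u \<in> span {v, w}" "v \<in> S" "w \<in> S" for u v w
    using that sS by (metis span_minimal insert_subset empty_subsetI subsetD)
  have ind': "y a (b + 1) \<noteq> 0" "\<not> (\<exists>k. x (a + 1) b = k *\<^sub>R y a (b + 1))" for a b
  proof -
    show "y a (b + 1) \<noteq> 0" by (rule ind)
    show "\<not> (\<exists>k. x (a + 1) b = k *\<^sub>R y a (b + 1))"
    proof
      assume "\<exists>k. x (a + 1) b = k *\<^sub>R y a (b + 1)"
      then have "x (a + 1) b \<in> span {y a (b + 1)}" by (auto simp: span_base span_scale)
      then have "inputs_in (span {y a (b + 1)}) a b" by (intro inputs_in_from_out) (auto simp: span_base)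
      then show False using False by (auto simp: inputs_in_def)
    qed
  qed
  have ind12: "\<not> (\<exists>k. y a b = k *\<^sub>R x (a + 1) b)" for a b
  proof
    assume "\<exists>k. y a b = k *\<^sub>R x (a + 1) b"
    then have "y a b \<in> span {x (a + 1) b}" by (auto simp: span_base span_scale)
    then have "inputs_in (span {x (a + 1) b}) a b" by (intro inputs_in_from_right) (auto simp: span_base)
    then show False using False by (auto simp: inputs_in_def)
  qed
  have ind43: "\<not> (\<exists>k. x (a + 1) (b - 1) = k *\<^sub>R y (a + 1) b)" for a b
  proof
    assume "\<exists>k. x (a + 1) (b - 1) = k *\<^sub>R y (a + 1) b"
    then have "x (a + 1) (b - 1) \<in> span {y (a + 1) b}" by (auto simp: span_base span_scale)
    then have "inputs_in (span {y (a + 1) b}) (a + 1) (b - 1)"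
      by (intro inputs_in_from_left) (auto simp: span_base)
    then show False using False by (auto simp: inputs_in_def)
  qed
  have right: "inputs_in S (a + 1) b" "inputs_in S (a + 1) (b - 1)" if "inputs_in S a b" for a b
  proof -
    have p: "x (a + 1) b \<in> S" "y a b \<in> S" using that inputs_in_out[OF sS] by (auto simp: inputs_in_def)
    have p3: "x (a + 1) (b - 1) \<in> S"
      by (rule mem[OF btw_in_span[OF btw123 ind(1) ind12] p])
    have p4: "y (a + 1) b \<in> S"
      by (rule mem[OF btw_in_span[OF btw124 ind(1) ind12] p])
    show "inputs_in S (a + 1) b" using p p4 by (simp add: inputs_in_def)
    show "inputs_in S (a + 1) (b - 1)" using inputs_in_from_left[OF sS, of "a + 1" "b - 1"] p3 p4 by simp
  qed
  have left: "inputs_in S a b" if "inputs_in S (a + 1) b" for a b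
  proof -
    have p: "x (a + 1) b \<in> S" "y (a + 1) b \<in> S" using that by (auto simp: inputs_in_def)
    have "y a b \<in> S"
      by (rule mem[OF btw_mid_in_span[OF btw124 ind(1) ind(3)] p])
    then show ?thesis using p inputs_in_from_right[OF sS] by simp
  qed
  have left': "inputs_in S a b" if "inputs_in S (a + 1) (b - 1)" for a b
  proof -
    have p: "x (a + 1) (b - 1) \<in> S" "y (a + 1) b \<in> S"
      using that inputs_in_out[OF sS, of "a + 1" "b - 1"] by (auto simp: inputs_in_def)
    have b1: "btw (y (a + 1) b) (x (a + 1) (b - 1)) (y a b)" using btw234 btw_sym by blast
    have b2: "btw (y (a + 1) b) (x (a + 1) (b - 1)) (x (a + 1) b)" using btw134 btw_sym by blast
    have "y a b \<in> S" by (rule mem[OF btw_in_span[OF b1 ind(2) ind43] p(2,1)])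
    moreover have "x (a + 1) b \<in> S" by (rule mem[OF btw_in_span[OF b2 ind(2) ind43] p(2,1)])
    ultimately show ?thesis using inputs_in_from_right[OF sS] by simp
  qed
  \<comment> \<open>Every gate is reached from the origin along the antidiagonal and then in
    direction \<open>a\<close>.\<close>
  have diag: "inputs_in S a (- a)" for a
  proof (induction a rule: int_induct[of _ 0])
    case base
    then show ?case by (simp add: inputs_in_def S_def span_base)
  next
    case (step1 i)
    then show ?case using right(2)[of i "- i"] by simp
  next
    case (step2 i)
    then show ?case using left'[of "i - 1" "- (i - 1)"] by simp
  qed
  have "inputs_in S (a + k) (- a)" for a k
  proof (induction k rule: int_induct[of _ 0])
    case (step1 i)
    then show ?case using right(1)[of "a + i" "- a"] by (simp add: algebra_simps)
  next
    case (step2 i)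
    then show ?case using left[of "a + i - 1" "- a"] by (simp add: algebra_simps)
  qed (use diag in simp)
  from this[of "- b" "a + b" for a b] have "inputs_in S a b" for a b by simp
  then show ?thesis unfolding inputs_in_def S_def by blast
qed

end

section \<open>Quasiperiodic solutions are tight\<close>

lemma ang_similarity:
  assumes "\<rho> > 0" "\<And>u v. f u \<bullet> f v = \<rho>\<^sup>2 * (u \<bullet> v)"
  shows "ang (f u) (f v) = ang u v"
proof -
  have n: "norm (f u) = \<rho> * norm u" for u
    using assms by (simp add: norm_eq_sqrt_inner real_sqrt_mult)
  then have z: "f u = 0 \<longleftrightarrow> u = 0" for u using assms(1) by (metis mult_eq_0_iff norm_eq_zero less_irrefl)
  have "sgn (f u) \<bullet> sgn (f v) = sgn u \<bullet> sgn v"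
    using assms n by (simp add: sgn_div_norm power2_eq_square field_simps)
  then show ?thesis by (simp add: ang_def z)
qed

text \<open>The limits are nonzero because \<open>ang\<close> jumps at zero vectors, by its
  convention there.\<close>

lemma tendsto_ang:
  assumes "(f \<longlongrightarrow> u) F" "(g \<longlongrightarrow> v) F" "u \<noteq> 0" "v \<noteq> 0"
  shows "((\<lambda>t. ang (f t) (g t)) \<longlongrightarrow> ang u v) F"
proof -
  have "((\<lambda>t. sgn (f t) \<bullet> sgn (g t)) \<longlongrightarrow> sgn u \<bullet> sgn v) F"
    by (intro tendsto_inner tendsto_sgn assms)
  then have "((\<lambda>t. arccos (sgn (f t) \<bullet> sgn (g t))) \<longlongrightarrow> arccos (sgn u \<bullet> sgn v)) F"
    by (rule continuous_on_tendsto_compose[OF continuous_on_arccos'])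
      (use sgn_inner_bound in \<open>auto simp: abs_le_iff minus_le_iff intro!: always_eventually\<close>)
  moreover have "\<forall>\<^sub>F t in F. f t \<noteq> 0" using assms(1,3) by (rule tendsto_imp_eventually_ne)
  then have "\<forall>\<^sub>F t in F. arccos (sgn (f t) \<bullet> sgn (g t)) = ang (f t) (g t)"
    by eventually_elim (simp add: ang_def)
  ultimately show ?thesis using assms by (simp add: ang_def tendsto_cong)
qed

text \<open>Row \<open>t + 2 * k\<close> is row \<open>t\<close> moved by \<open>(k, k)\<close>, up
  to rotating the period along the row.\<close>

lemma row_length_shift:
  assumes p: "p \<ge> 0"
    and per: "\<And>a b. x (a + p) (b - p) = \<phi> (x a b)" "\<And>a b. y (a + p) (b - p) = \<phi> (y a b)"
    and iso: "\<And>u v. ang (\<phi> u) (\<phi> v) = ang u v"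
  shows "row_length p x y (t + 2 * k) =
    (\<Sum>a\<in>{0..<p}. ang (x (a + k) (t - a + k)) (y (a + k) (t - a + k))
       + ang (y (a + k) (t - a + k)) (x (a + 1 + k) (t - a - 1 + k)))"
proof -
  define g where "g a = ang (x a (t + 2 * k - a)) (y a (t + 2 * k - a))
      + ang (y a (t + 2 * k - a)) (x (a + 1) (t + 2 * k - a - 1))" for a
  have "g (a + p) = g a" for a
    using per(1)[of a "t + 2 * k - a"] per(2)[of a "t + 2 * k - a"] per(1)[of "a + 1" "t + 2 * k - a - 1"]
    by (simp add: g_def iso algebra_simps)
  then have "(\<Sum>a\<in>{0..<p}. g a) = (\<Sum>a\<in>{0..<p}. g (a + k))"
    using sum_cyclic_shift_int[OF p] by metis
  then show ?thesis unfolding row_length_def g_def by (simp add: algebra_simps)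
qed

context gates begin

text \<open>The shift by \<open>(m, m)\<close> takes row \<open>t\<close> to row
  \<open>t + 2 * m\<close> and preserves angles, so the monotone row length is periodic.\<close>

lemma tight_if_similar:
  assumes sol: "gate_solution c s x y" and nm: "n > 0" "m > 0"
    and X: "\<And>a b. x (a + n) (b - n) = \<phi> (x a b)" "\<And>a b. y (a + n) (b - n) = \<phi> (y a b)"
    and Y: "\<And>a b. x (a + m) (b + m) = \<psi> (x a b)" "\<And>a b. y (a + m) (b + m) = \<psi> (y a b)"
    and iso: "\<And>u v. ang (\<phi> u) (\<phi> v) = ang u v" "\<And>u v. ang (\<psi> u) (\<psi> v) = ang u v"
  shows "tight x y"
proof -
  have step: "row_length n x y (t + 2 * m) = row_length n x y t" for t
    using row_length_shift[where x = x and y = y and \<phi> = \<phi> and p = n and t = t and k = m] nm X iso(1)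
    by (simp add: Y iso(2) row_length_def)
  have 1: "row_length n x y (2 * m * int k) = row_length n x y 0" for k
  proof (induction k)
    case (Suc k)
    then show ?case using step[of "2 * m * int k"] by (simp add: algebra_simps)
  qed simp
  have 2: "row_length n x y (- (2 * m * int k)) = row_length n x y 0" for k
  proof (induction k)
    case (Suc k)
    then show ?case using step[of "- (2 * m * int (Suc k))"] by (simp add: algebra_simps)
  qed simp
  show ?thesis
    by (rule tight_if_limits[where \<phi> = \<phi> and p = n and T = "2 * m" and L = "row_length n x y 0"])
      (use sol nm X iso 1 2 in simp_all)
qed

text \<open>The given periods \<open>(n, - n)\<close> and \<open>(m, m)\<close> are diagonal,
  whereas rigidity uses axis periods. \<open>(2 * n * m, 0)\<close> and
  \<open>(0, 2 * n * m)\<close> are their combinations with coefficients \<open>m, n\<close> and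
  \<open>- m, n\<close>; the negative one calls for the inverse \<open>\<phi>'\<close>.\<close>

lemma periodic_tightI:
  assumes sol: "gate_solution c s x y" and tight: "tight x y" and nm: "n > 0" "m > 0"
    and X: "\<And>a b. x (a + n) (b - n) = \<phi> (x a b)" "\<And>a b. y (a + n) (b - n) = \<phi> (y a b)"
    and Y: "\<And>a b. x (a + m) (b + m) = \<psi> (x a b)" "\<And>a b. y (a + m) (b + m) = \<psi> (y a b)"
    and lin: "linear \<phi>" "linear \<phi>'" "linear \<psi>" and inv: "\<And>u. \<phi> (\<phi>' u) = u" "\<And>u. \<phi>' (\<phi> u) = u"
    and inj: "inj \<psi>"
  shows "\<exists>f g. periodic_tight_solution c s x y (2 * n * m) f g"
proof -
  have Xk: "x (a + n * int k) (b - n * int k) = (\<phi> ^^ k) (x a b)" "y (a + n * int k) (b - n * int k) = (\<phi> ^^ k) (y a b)" for k a b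
  proof (induction k)
    case (Suc k)
    case 1
    then show ?case using X(1)[of "a + n * int k" "b - n * int k"] Suc(1) by (simp add: algebra_simps)
    case 2
    then show ?case using X(2)[of "a + n * int k" "b - n * int k"] Suc(2) by (simp add: algebra_simps)
  qed simp_all
  have Yk: "x (a + m * int k) (b + m * int k) = (\<psi> ^^ k) (x a b)" "y (a + m * int k) (b + m * int k) = (\<psi> ^^ k) (y a b)" for k a b
  proof (induction k)
    case (Suc k)
    case 1
    then show ?case using Y(1)[of "a + m * int k" "b + m * int k"] Suc(1) by (simp add: algebra_simps)
    case 2
    then show ?case using Y(2)[of "a + m * int k" "b + m * int k"] Suc(2) by (simp add: algebra_simps)
  qed simp_all
  have X': "x (a - n) (b + n) = \<phi>' (x a b)" "y (a - n) (b + n) = \<phi>' (y a b)" for a b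
    using X(1)[of "a - n" "b + n"] X(2)[of "a - n" "b + n"] inv(2) by simp_all
  have X'k: "x (a - n * int k) (b + n * int k) = (\<phi>' ^^ k) (x a b)" "y (a - n * int k) (b + n * int k) = (\<phi>' ^^ k) (y a b)" for k a b
  proof (induction k)
    case (Suc k)
    case 1
    then show ?case using X'(1)[of "a - n * int k" "b + n * int k"] Suc(1) by (simp add: algebra_simps)
    case 2
    then show ?case using X'(2)[of "a - n * int k" "b + n * int k"] Suc(2) by (simp add: algebra_simps)
  qed simp_all
  have linpow: "linear (f ^^ k) \<and> inj (f ^^ k)" if "linear f" "inj f" for f :: "'a \<Rightarrow> 'a" and k
  proof (induction k)
    case 0
    then show ?case using linear_id by (simp add: id_def)
  next
    case (Suc k)
    then show ?case using that by (auto simp only: funpow.simps intro: linear_compose inj_compose)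
  qed
  have i1: "inj \<phi>" by (rule inj_on_inverseI[of _ \<phi>']) (rule inv)
  have i2: "inj \<phi>'" by (rule inj_on_inverseI[of _ \<phi>]) (rule inv)
  let ?f = "(\<phi> ^^ nat m) \<circ> (\<psi> ^^ nat n)" and ?g = "(\<phi>' ^^ nat m) \<circ> (\<psi> ^^ nat n)"
  have "periodic_tight_solution c s x y (2 * n * m) ?f ?g"
  proof (intro periodic_tight_solution.intro tight_solution.intro tight_solution_axioms.intro
      periodic_tight_solution_axioms.intro gates_axioms sol tight)
    show "2 * n * m > 0" using nm by simp
    show "linear ?f" "inj ?f" "linear ?g" "inj ?g"
      using linpow[OF lin(1) i1] linpow[OF lin(2) i2] linpow[OF lin(3) inj]
      by (auto intro: linear_compose inj_compose)
    fix a b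
    show "x (a + 2 * n * m) b = ?f (x a b)" "y (a + 2 * n * m) b = ?f (y a b)"
      using Xk[of "a + m * int (nat n)" "nat m" "b + m * int (nat n)"] nm
      by (simp_all add: Yk[of _ "nat n", simplified, symmetric] algebra_simps flip: Yk(1)[of a "nat n" b] Yk(2)[of a "nat n" b])
    show "x a (b + 2 * n * m) = ?g (x a b)" "y a (b + 2 * n * m) = ?g (y a b)"
      using X'k[of "a + m * int (nat n)" "nat m" "b + m * int (nat n)"] nm
      by (simp_all add: algebra_simps flip: Yk(1)[of a "nat n" b] Yk(2)[of a "nat n" b])
  qed
  then show ?thesis by blast
qed

end

section \<open>From a real plane to a complex linear relation\<close>

lemma span_pair: "u \<in> span {p, q} \<Longrightarrow> \<exists>k l. u = k *\<^sub>R p + l *\<^sub>R q"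
proof -
  assume "u \<in> span {p, q}"
  then obtain k where "u - k *\<^sub>R p \<in> span {q}" by (auto simp: span_insert)
  then obtain l where "u - k *\<^sub>R p = l *\<^sub>R q" by (auto simp: span_singleton)
  then have "u = k *\<^sub>R p + l *\<^sub>R q" by (simp add: algebra_simps)
  then show ?thesis by blast
qed

text \<open>Two equations in three unknowns: the cross product solves them unless it vanishes, and
  then the equations are dependent.\<close>

lemma common_annihilator:
  fixes p1 p2 p3 q1 q2 q3 :: complex
  obtains c1 c2 c3 where "(c1, c2, c3) \<noteq> (0, 0, 0)"
    "c1 * p1 + c2 * p2 + c3 * p3 = 0" "c1 * q1 + c2 * q2 + c3 * q3 = 0"
proof -
  let ?P = "\<lambda>c1 c2 c3. (c1, c2, c3) \<noteq> (0, 0, 0) \<and> c1 * p1 + c2 * p2 + c3 * p3 = 0 \<and> c1 * q1 + c2 * q2 + c3 * q3 = 0"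
  let ?d1 = "p2 * q3 - p3 * q2" and ?d2 = "p3 * q1 - p1 * q3" and ?d3 = "p1 * q2 - p2 * q1"
  have "\<exists>c1 c2 c3. ?P c1 c2 c3"
  proof (cases "(?d1, ?d2, ?d3) = (0, 0, 0)")
    case False
    then have "?P ?d1 ?d2 ?d3" by (auto simp: algebra_simps)
    then show ?thesis by blast
  next
    case True
    then have d: "p2 * q3 = p3 * q2" "p3 * q1 = p1 * q3" "p1 * q2 = p2 * q1" by auto
    consider "p1 \<noteq> 0 \<or> p2 \<noteq> 0" | "p1 = 0" "p2 = 0" "p3 \<noteq> 0" | "p1 = 0" "p2 = 0" "p3 = 0" by blast
    then show ?thesis
    proof cases
      case 1
      then have "?P p2 (- p1) 0" using d by (auto simp: algebra_simps)
      then show ?thesis by blast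
    next
      case 2
      then have "?P 1 0 0" using d by auto
      then show ?thesis by blast
    next
      case 3
      then have "?P q2 (- q1) 0 \<or> ?P 1 0 0" by (auto simp: algebra_simps)
      then show ?thesis by blast
    qed
  qed
  then show ?thesis using that by blast
qed

context periodic_tight_solution begin

text \<open>All values lie in the real span of two vectors, and a complex functional on three
  coordinates has room to kill both.\<close>

lemma complex_dependent:
  fixes pr :: "'a \<Rightarrow> complex \<times> complex \<times> complex"
  assumes "linear pr"
  shows "\<exists>c1 c2 c3. (c1, c2, c3) \<noteq> (0, 0, 0) \<and>
    (\<forall>a b. \<forall>u\<in>{x a b, y a b}. c1 * fst (pr u) + c2 * fst (snd (pr u)) + c3 * snd (snd (pr u)) = 0)"
proof -
  obtain q1 q2 where q: "\<And>a b. x a b \<in> span {q1, q2} \<and> y a b \<in> span {q1, q2}" using plane by blast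
  obtain c1 c2 c3 where c: "(c1, c2, c3) \<noteq> (0, 0, 0)"
    "c1 * fst (pr q1) + c2 * fst (snd (pr q1)) + c3 * snd (snd (pr q1)) = 0"
    "c1 * fst (pr q2) + c2 * fst (snd (pr q2)) + c3 * snd (snd (pr q2)) = 0"
    by (rule common_annihilator)
  have "c1 * fst (pr u) + c2 * fst (snd (pr u)) + c3 * snd (snd (pr u)) = 0" if "u \<in> span {q1, q2}" for u
  proof -
    obtain k l where u: "u = k *\<^sub>R q1 + l *\<^sub>R q2" using span_pair \<open>u \<in> span {q1, q2}\<close> by blast
    have "c1 * fst (pr u) + c2 * fst (snd (pr u)) + c3 * snd (snd (pr u))
      = of_real k * (c1 * fst (pr q1) + c2 * fst (snd (pr q1)) + c3 * snd (snd (pr q1)))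
      + of_real l * (c1 * fst (pr q2) + c2 * fst (snd (pr q2)) + c3 * snd (snd (pr q2)))"
      unfolding u using assms
      by (simp add: linear_add linear_scale scaleR_conv_of_real algebra_simps)
    then show ?thesis using c by simp
  qed
  then show ?thesis using c(1) q by blast
qed

end

section \<open>Complex eigenfunctions\<close>

definition quasi :: "int \<Rightarrow> int \<Rightarrow> complex \<Rightarrow> (int \<Rightarrow> int \<Rightarrow> complex) \<Rightarrow> (int \<Rightarrow> int \<Rightarrow> complex) \<Rightarrow> bool" where
  "quasi k l z x y \<longleftrightarrow> (\<forall>a b. x (a + k) (b + l) = z * x a b \<and> y (a + k) (b + l) = z * y a b)"

lemma inner_mult_complex: "(l * u) \<bullet> (l * v) = (cmod l)\<^sup>2 * (u \<bullet> v)" for l u v :: complex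
  by (simp add: inner_complex_def cmod_power2) (simp add: algebra_simps power2_eq_square)

lemma gate_solution_triple:
  assumes "gate_solution c s x1 y1" "gate_solution c s x2 y2" "gate_solution c s x3 y3"
  shows "gate_solution c s (\<lambda>a b. (x1 a b, x2 a b, x3 a b)) (\<lambda>a b. (y1 a b, y2 a b, y3 a b))"
  using assms by (auto simp: gate_solution_def)

definition diag3 :: "complex \<Rightarrow> complex \<Rightarrow> complex \<Rightarrow> complex \<times> complex \<times> complex \<Rightarrow> complex \<times> complex \<times> complex" where
  "diag3 p q r = (\<lambda>u. (p * fst u, q * fst (snd u), r * snd (snd u)))"

lemma linear_diag3: "linear (diag3 p q r)"
  by (rule linearI) (auto simp: diag3_def algebra_simps)

lemma ang_diag3:
  assumes "cmod p = \<rho>" "cmod q = \<rho>" "cmod r = \<rho>" "\<rho> > 0"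
  shows "ang (diag3 p q r u) (diag3 p q r v) = ang u v"
proof (rule ang_similarity[OF assms(4)])
  show "diag3 p q r u \<bullet> diag3 p q r v = \<rho>\<^sup>2 * (u \<bullet> v)" for u v
    using assms by (simp add: diag3_def inner_prod_def inner_mult_complex algebra_simps)
qed

context gates begin

text \<open>Multipliers of equal modulus act on the triple as rotations of the coordinates composed
  with one common dilation, so the triple is tight and its values lie in a real plane.\<close>

lemma three_eigensolutions:
  assumes sol: "gate_solution c s x1 y1" "gate_solution c s x2 y2" "gate_solution c s x3 y3"
    and nm: "n > 0" "m > 0"
    and X: "quasi n (- n) z1 x1 y1" "quasi n (- n) z2 x2 y2" "quasi n (- n) z3 x3 y3"
    and Y: "quasi m m w1 x1 y1" "quasi m m w2 x2 y2" "quasi m m w3 x3 y3"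
    and \<rho>: "\<rho> > 0" "cmod z1 = \<rho>" "cmod z2 = \<rho>" "cmod z3 = \<rho>"
    and \<sigma>: "\<sigma> > 0" "cmod w1 = \<sigma>" "cmod w2 = \<sigma>" "cmod w3 = \<sigma>"
  shows "\<exists>c1 c2 c3. (c1, c2, c3) \<noteq> (0, 0, 0) \<and>
    (\<forall>a b. c1 * x1 a b + c2 * x2 a b + c3 * x3 a b = 0 \<and> c1 * y1 a b + c2 * y2 a b + c3 * y3 a b = 0)"
proof -
  let ?x = "\<lambda>a b. (x1 a b, x2 a b, x3 a b)" and ?y = "\<lambda>a b. (y1 a b, y2 a b, y3 a b)"
  have nz: "z1 \<noteq> 0" "z2 \<noteq> 0" "z3 \<noteq> 0" "w1 \<noteq> 0" "w2 \<noteq> 0" "w3 \<noteq> 0"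
    using \<rho> \<sigma> by auto
  have F: "gate_solution c s ?x ?y" by (rule gate_solution_triple) fact+
  have XF: "?x (a + n) (b - n) = diag3 z1 z2 z3 (?x a b)" "?y (a + n) (b - n) = diag3 z1 z2 z3 (?y a b)" for a b
    using X by (auto simp: quasi_def diag3_def)
  have YF: "?x (a + m) (b + m) = diag3 w1 w2 w3 (?x a b)" "?y (a + m) (b + m) = diag3 w1 w2 w3 (?y a b)" for a b
    using Y by (auto simp: quasi_def diag3_def)
  have t: "tight ?x ?y"
    by (rule tight_if_similar[where x = ?x and y = ?y and n = n and m = m
          and \<phi> = "diag3 z1 z2 z3" and \<psi> = "diag3 w1 w2 w3"])
      (fact F nm XF YF | rule ang_diag3[OF \<rho>(2-4,1)] ang_diag3[OF \<sigma>(2-4,1)])+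
  have "\<exists>f g. periodic_tight_solution c s ?x ?y (2 * n * m) f g"
    by (rule periodic_tightI[where x = ?x and y = ?y and n = n and m = m
          and \<phi> = "diag3 z1 z2 z3" and \<psi> = "diag3 w1 w2 w3" and \<phi>' = "diag3 (1/z1) (1/z2) (1/z3)"])
      (fact F t nm XF YF linear_diag3 | use nz in \<open>auto simp: diag3_def inj_def prod_eq_iff\<close>)+
  then obtain f g where "periodic_tight_solution c s ?x ?y (2 * n * m) f g" by blast
  from periodic_tight_solution.complex_dependent[OF this linear_id]
  show ?thesis by simp
qed

text \<open>One vanishing input makes the two inputs dependent over the reals, so the whole solution
  would lie on one real line; comparing a nonzero value with its translates would make both
  multipliers real.\<close>

lemma nonreal_eigensolution_nz:
  assumes sol: "gate_solution c s x y" and nm: "n > 0" "m > 0"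
    and X: "quasi n (- n) z x y" and Y: "quasi m m w x y" and zw: "z \<noteq> 0" "w \<noteq> 0"
    and nonreal: "z \<notin> \<real> \<or> w \<notin> \<real>" and nz: "\<exists>a b. x a b \<noteq> 0 \<or> y a b \<noteq> 0"
  shows "x a b \<noteq> 0" "y a b \<noteq> 0"
proof -
  have XF: "x (a + n) (b - n) = z * x a b" "y (a + n) (b - n) = z * y a b" for a b
    using X by (auto simp: quasi_def)
  have YF: "x (a + m) (b + m) = w * x a b" "y (a + m) (b + m) = w * y a b" for a b
    using Y by (auto simp: quasi_def)
  have iso: "ang (l * u) (l * v) = ang u v" if "l \<noteq> 0" for l u v :: complex
    using that by (intro ang_similarity[of "cmod l"]) (simp_all add: inner_mult_complex)
  have lin: "linear ((*) l)" for l :: complex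
    by (rule linearI) (auto simp: algebra_simps)
  have t: "tight x y"
    by (rule tight_if_similar[where x = x and y = y and n = n and m = m and \<phi> = "(*) z" and \<psi> = "(*) w"])
      (fact sol nm XF YF | rule iso zw)+
  have "\<exists>f g. periodic_tight_solution c s x y (2 * n * m) f g"
    by (rule periodic_tightI[where x = x and y = y and n = n and m = m
          and \<phi> = "(*) z" and \<psi> = "(*) w" and \<phi>' = "(*) (1/z)"])
      (fact sol t nm XF YF lin | use zw in \<open>auto simp: inj_def\<close>)+
  then obtain f g where P: "periodic_tight_solution c s x y (2 * n * m) f g" by blast
  have no_line: False if q: "\<And>a b. x a b \<in> span {q} \<and> y a b \<in> span {q}" for q
  proof -
    have real: "l \<in> \<real>" if u: "u \<in> span {q}" "l * u \<in> span {q}" "u \<noteq> 0" for u l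
    proof -
      obtain j where j: "u = j *\<^sub>R q" using u(1) by (auto simp: span_singleton)
      obtain k where k: "l * u = k *\<^sub>R q" using u(2) unfolding span_singleton by blast
      note jk = j k
      then have "l * of_real j = of_real k" using u(3) by (auto simp: scaleR_conv_of_real)
      then have "l = of_real (k / j)" using jk u(3) by (auto simp: field_simps)
      then show ?thesis by simp
    qed
    obtain a b where "x a b \<noteq> 0 \<or> y a b \<noteq> 0" using nz by blast
    then have "z \<in> \<real> \<and> w \<in> \<real>"
      using real[of "x a b"] real[of "y a b"] q XF[of a b] YF[of a b] by metis
    then show False using nonreal by blast
  qed
  have deg: False if "x a b = 0 \<or> y a b = 0" for a b
  proof -
    have "\<exists>q. x a b \<in> span {q} \<and> y a b \<in> span {q}"
      using that by (metis span_base singletonI span_zero)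
    then obtain q where "\<forall>a b. x a b \<in> span {q} \<and> y a b \<in> span {q}"
      using periodic_tight_solution.degenerate_gate_spreads[OF P] by blast
    then show False using no_line by blast
  qed
  show "x a b \<noteq> 0" "y a b \<noteq> 0" using deg by blast+
qed

section \<open>Nonreal Jordan chains\<close>

lemma tendsto_jordan_ang:
  fixes \<omega> \<kappa> u0 u1 v0 v1 :: complex
  assumes nz: "\<omega> \<noteq> 0" "\<kappa> \<noteq> 0" "u0 \<noteq> 0" "v0 \<noteq> 0"
  defines "G \<equiv> \<lambda>k u0 u1. (\<omega> ^ k * u0, cnj (\<omega> ^ k * u0), \<omega> ^ k * (u1 + of_nat k * \<kappa> * u0))"
  shows "(\<lambda>k. ang (G k u0 u1) (G k v0 v1)) \<longlonglongrightarrow> ang (0::complex, 0::complex, u0) (0, 0, v0)"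
proof -
  \<comment> \<open>The term with the factor \<open>of_nat k\<close> dominates everything else.
    Multiplication by \<open>l k\<close> is a similarity for \<open>k \<ge> 1\<close>, hence
    invisible to angles, and leaves only that term in the limit.\<close>
  define l where "l k = 1 / (\<omega> ^ k * (of_nat k * \<kappa>))" for k
  have lim: "(\<lambda>k. diag3 (l k) (l k) (l k) (G k t0 t1)) \<longlonglongrightarrow> (0, 0, t0)" for t0 t1
  proof -
    have i: "(\<lambda>k. 1 / of_nat k :: complex) \<longlonglongrightarrow> 0" using lim_inverse_n by (simp add: inverse_eq_divide)
    have ev: "\<forall>\<^sub>F k in sequentially. k \<noteq> (0::nat)" by (rule eventually_sequentiallyI[of 1]) simp
    have "(\<lambda>k. t0 / \<kappa> * (1 / of_nat k)) \<longlonglongrightarrow> t0 / \<kappa> * 0" by (intro tendsto_intros i)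
    then have "(\<lambda>k. t0 / \<kappa> * (1 / of_nat k)) \<longlonglongrightarrow> 0" by simp
    then have "(\<lambda>k. l k * (\<omega> ^ k * t0)) \<longlonglongrightarrow> 0"
      by (rule Lim_transform_eventually) (use nz in \<open>auto simp: l_def field_simps\<close>)
    moreover have "(\<lambda>k. l k * cnj (\<omega> ^ k * t0)) \<longlonglongrightarrow> 0"
    proof (rule tendsto_norm_zero_cancel)
      have "(\<lambda>k. norm (l k * (\<omega> ^ k * t0))) \<longlonglongrightarrow> 0" using calculation by (rule tendsto_norm_zero)
      then show "(\<lambda>k. norm (l k * cnj (\<omega> ^ k * t0))) \<longlonglongrightarrow> 0" by (simp add: norm_mult norm_power)
    qed
    moreover have "(\<lambda>k. l k * (\<omega> ^ k * (t1 + of_nat k * \<kappa> * t0))) \<longlonglongrightarrow> t0"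
    proof -
      have "(\<lambda>k. t1 / \<kappa> * (1 / of_nat k) + t0) \<longlonglongrightarrow> t1 / \<kappa> * 0 + t0" by (intro tendsto_intros i)
      then have "(\<lambda>k. t1 / \<kappa> * (1 / of_nat k) + t0) \<longlonglongrightarrow> t0" by simp
      then show ?thesis
        by (rule Lim_transform_eventually)
          (use ev in \<open>eventually_elim, use nz in \<open>auto simp: l_def field_simps\<close>\<close>)
    qed
    ultimately show ?thesis unfolding diag3_def G_def by (intro tendsto_Pair) simp_all
  qed
  have "(\<lambda>k. ang (diag3 (l k) (l k) (l k) (G k u0 u1)) (diag3 (l k) (l k) (l k) (G k v0 v1)))
      \<longlonglongrightarrow> ang (0::complex, 0::complex, u0) (0, 0, v0)"
    by (intro tendsto_ang lim) (use nz in \<open>auto simp: zero_prod_def\<close>)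
  then show ?thesis
  proof (rule Lim_transform_eventually)
    show "\<forall>\<^sub>F k in sequentially. ang (diag3 (l k) (l k) (l k) (G k u0 u1)) (diag3 (l k) (l k) (l k) (G k v0 v1))
        = ang (G k u0 u1) (G k v0 v1)"
      by (rule eventually_sequentiallyI[of 1]) (use nz in \<open>auto simp: l_def intro!: ang_diag3[where \<rho> = "cmod (l _)"]\<close>)
  qed
qed

text \<open>The gates are real, so the conjugate of \<open>x0\<close> is a third solution, with
  multipliers \<open>cnj z\<close> and \<open>cnj w\<close>. In both directions the row length of
  the triple tends to that of the leading term \<open>x0\<close>; hence the triple is tight and
  dependent, and shifting the relation kills all three coefficients.\<close>

lemma no_nonreal_jordan_chain:
  assumes sol: "gate_solution c s x0 y0" "gate_solution c s x1 y1" and nm: "n > 0" "m > 0"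
    and X: "quasi n (- n) z x0 y0" "quasi n (- n) z x1 y1"
    and Y: "quasi m m w x0 y0" "\<And>a b. x1 (a + m) (b + m) = w * x1 a b + x0 a b"
      "\<And>a b. y1 (a + m) (b + m) = w * y1 a b + y0 a b"
    and zw: "z \<noteq> 0" "w \<noteq> 0" and nonreal: "z \<notin> \<real> \<or> w \<notin> \<real>"
    and nz: "\<exists>a b. x0 a b \<noteq> 0 \<or> y0 a b \<noteq> 0"
  shows False
proof -
  note r_nz = nonreal_eigensolution_nz[OF sol(1) nm X(1) Y(1) zw nonreal nz]
  let ?x = "\<lambda>a b. (x0 a b, cnj (x0 a b), x1 a b)" and ?y = "\<lambda>a b. (y0 a b, cnj (y0 a b), y1 a b)"
  have "gate_solution c s (\<lambda>a b. cnj (x0 a b)) (\<lambda>a b. cnj (y0 a b))"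
    using sol(1) by (auto simp: gate_solution_def)
  then have F: "gate_solution c s ?x ?y" by (intro gate_solution_triple sol)
  let ?\<phi> = "diag3 z (cnj z) z"
  let ?\<psi> = "\<lambda>u::complex\<times>complex\<times>complex. (w * fst u, cnj w * fst (snd u), w * snd (snd u) + fst u)"
  have XF: "?x (a + n) (b - n) = ?\<phi> (?x a b)" "?y (a + n) (b - n) = ?\<phi> (?y a b)" for a b
    using X by (auto simp: quasi_def diag3_def)
  have Y0: "x0 (a + m) (b + m) = w * x0 a b" "y0 (a + m) (b + m) = w * y0 a b" for a b
    using Y(1) by (auto simp: quasi_def)
  have YF: "?x (a + m) (b + m) = ?\<psi> (?x a b)" "?y (a + m) (b + m) = ?\<psi> (?y a b)" for a b
    using Y0 Y(2,3) by auto
  have iso: "ang (?\<phi> u) (?\<phi> v) = ang u v" for u v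
    using zw by (intro ang_diag3) auto
  \<comment> \<open>Closed form of iterated shifts: \<open>\<omega> = w\<close> and
    \<open>\<kappa> = 1 / w\<close> upwards, \<open>\<omega> = 1 / w\<close> and
    \<open>\<kappa> = - (1 / w)\<close> downwards.\<close>
  define G where "G \<omega> \<kappa> k u = (\<omega> ^ k * fst u, cnj (\<omega> ^ k * fst u), \<omega> ^ k * (snd (snd u) + of_nat k * \<kappa> * fst u))"
    for \<omega> \<kappa> :: complex and k :: nat and u :: "complex \<times> complex \<times> complex"
  have up: "?x (a + m * int k) (b + m * int k) = G w (1 / w) k (?x a b)"
    "?y (a + m * int k) (b + m * int k) = G w (1 / w) k (?y a b)" for k a b
  proof (induction k)
    case (Suc k)
    case 1
    then show ?case using YF(1)[of "a + m * int k" "b + m * int k"] Suc(1) zw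
      by (simp add: G_def algebra_simps)
    case 2
    then show ?case using YF(2)[of "a + m * int k" "b + m * int k"] Suc(2) zw
      by (simp add: G_def algebra_simps)
  qed (simp_all add: G_def)
  have Yd: "x0 (a - m) (b - m) = x0 a b / w" "y0 (a - m) (b - m) = y0 a b / w"
    "x1 (a - m) (b - m) = x1 a b / w - x0 a b / w\<^sup>2" "y1 (a - m) (b - m) = y1 a b / w - y0 a b / w\<^sup>2" for a b
    using Y0[of "a - m" "b - m"] Y(2)[of "a - m" "b - m"] Y(3)[of "a - m" "b - m"] zw
    by (auto simp: field_simps power2_eq_square)
  have down: "?x (a - m * int k) (b - m * int k) = G (1 / w) (- (1 / w)) k (?x a b)"
    "?y (a - m * int k) (b - m * int k) = G (1 / w) (- (1 / w)) k (?y a b)" for k a b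
  proof -
    have seq: "p k = v ^ k * p 0 \<and> q k = v ^ k * (q 0 + of_nat k * (- v) * p 0)"
      if pq: "\<And>k. p (Suc k) = v * p k" "\<And>k. q (Suc k) = v * q k - v * v * p k"
      for p q :: "nat \<Rightarrow> complex" and v k
    proof (induction k)
      case (Suc k)
      have "p (Suc k) = v * (v ^ k * p 0)" using pq(1)[of k] Suc.IH by metis
      moreover have "q (Suc k) = v * (v ^ k * (q 0 + of_nat k * (- v) * p 0)) - v * v * (v ^ k * p 0)"
        using pq(2)[of k] Suc.IH by metis
      ultimately show ?case by (simp add: algebra_simps)
    qed simp
    have e: "a - m * int (Suc k) = (a - m * int k) - m" for a k by (simp add: algebra_simps)
    show "?x (a - m * int k) (b - m * int k) = G (1 / w) (- (1 / w)) k (?x a b)"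
      using seq[of "\<lambda>k. x0 (a - m * int k) (b - m * int k)" "1 / w" "\<lambda>k. x1 (a - m * int k) (b - m * int k)" k]
      unfolding e Yd by (simp add: G_def power2_eq_square)
    show "?y (a - m * int k) (b - m * int k) = G (1 / w) (- (1 / w)) k (?y a b)"
      using seq[of "\<lambda>k. y0 (a - m * int k) (b - m * int k)" "1 / w" "\<lambda>k. y1 (a - m * int k) (b - m * int k)" k]
      unfolding e Yd by (simp add: G_def power2_eq_square)
  qed
  let ?L = "row_length n (\<lambda>a b. (0::complex, 0::complex, x0 a b)) (\<lambda>a b. (0, 0, y0 a b)) 0"
  have lim: "(\<lambda>k. ang (G \<omega> \<kappa> k u) (G \<omega> \<kappa> k v)) \<longlonglongrightarrow> ang (0::complex, 0::complex, fst u) (0, 0, fst v)"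
    if "\<omega> \<noteq> 0" "\<kappa> \<noteq> 0" "fst u \<noteq> 0" "fst v \<noteq> 0" for \<omega> \<kappa> u v
    using tendsto_jordan_ang[OF that, of "snd (snd u)" "snd (snd v)"] by (simp only: G_def)
  have lims: "(\<lambda>k. \<Sum>a\<in>{0..<n}. ang (G \<omega> \<kappa> k (?x a (- a))) (G \<omega> \<kappa> k (?y a (- a)))
        + ang (G \<omega> \<kappa> k (?y a (- a))) (G \<omega> \<kappa> k (?x (a + 1) (- a - 1)))) \<longlonglongrightarrow> ?L"
    if "\<omega> \<noteq> 0" "\<kappa> \<noteq> 0" for \<omega> \<kappa>
    unfolding row_length_def diff_0
    using lim[OF that, of "?x _ _" "?y _ _"] lim[OF that, of "?y _ _" "?x _ _"] r_nz
    by (intro tendsto_sum tendsto_add) simp_all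
  have rl: "row_length n ?x ?y (2 * k) = (\<Sum>a\<in>{0..<n}. ang (?x (a + k) (- a + k)) (?y (a + k) (- a + k))
       + ang (?y (a + k) (- a + k)) (?x (a + 1 + k) (- a - 1 + k)))" for k
    using row_length_shift[where x = ?x and y = ?y and p = n and \<phi> = ?\<phi> and t = 0 and k = k] nm XF iso
    by simp
  have t: "tight ?x ?y"
  proof (rule tight_if_limits[where x = ?x and y = ?y and p = n and T = "2 * m" and \<phi> = ?\<phi> and L = ?L])
    show "(\<lambda>k. row_length n ?x ?y (2 * m * int k)) \<longlonglongrightarrow> ?L"
      using lims[of w "1 / w"] zw unfolding up[symmetric] rl[symmetric] by (simp add: mult.assoc)
    show "(\<lambda>k. row_length n ?x ?y (- (2 * m * int k))) \<longlonglongrightarrow> ?L"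
      using lims[of "1 / w" "- (1 / w)"] zw unfolding down[symmetric]
      using rl[of "- (m * int k)" for k] by (simp add: algebra_simps)
  qed (fact F XF iso | use nm in simp)+
  have lin: "linear ?\<psi>" by (rule linearI) (auto simp: algebra_simps)
  have "\<exists>f g. periodic_tight_solution c s ?x ?y (2 * n * m) f g"
    by (rule periodic_tightI[where x = ?x and y = ?y and n = n and m = m
          and \<phi> = ?\<phi> and \<psi> = ?\<psi> and \<phi>' = "diag3 (1/z) (1/cnj z) (1/z)"])
      (fact F t nm XF YF linear_diag3 lin | use zw in \<open>auto simp: diag3_def inj_def prod_eq_iff\<close>)+
  then obtain f g where "periodic_tight_solution c s ?x ?y (2 * n * m) f g" by blast
  from periodic_tight_solution.complex_dependent[OF this linear_id]
  obtain c1 c2 c3 where c1: "(c1, c2, c3) \<noteq> (0, 0, 0)" and c': "\<forall>a b. \<forall>u\<in>{?x a b, ?y a b}.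
      c1 * fst (id u) + c2 * fst (snd (id u)) + c3 * snd (snd (id u)) = 0"
    by (elim exE conjE)
  have c2: "c1 * x0 a b + c2 * cnj (x0 a b) + c3 * x1 a b = 0" for a b
    using bspec[OF spec[OF spec[OF c', of a], of b], of "?x a b"] by simp
  note c = c1 c2
  let ?r = "x0 0 0"
  have XX: "x0 n (- n) = z * ?r" "x1 n (- n) = z * x1 0 0"
    using X unfolding quasi_def by (metis add_0 )+
  have YY: "x0 m m = w * ?r" "x1 m m = w * x1 0 0 + ?r" "x0 (m + m) (m + m) = w * (w * ?r)"
    "x1 (m + m) (m + m) = w * (w * x1 0 0 + ?r) + w * ?r"
    using Y0(1)[of 0 0] Y(2)[of 0 0] Y0(1)[of m m] Y(2)[of m m] by simp_all
  have e0: "c1 * ?r + c2 * cnj ?r + c3 * x1 0 0 = 0" by (rule c)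
  have eX: "z * (c1 * ?r + c3 * x1 0 0) + cnj z * (c2 * cnj ?r) = 0"
    using c(2)[of n "- n"] XX by (simp add: algebra_simps)
  have eY: "w * (c1 * ?r + c3 * x1 0 0) + cnj w * (c2 * cnj ?r) + c3 * ?r = 0"
    using c(2)[of m m] YY by (simp add: algebra_simps)
  have eYY: "w * w * (c1 * ?r + c3 * x1 0 0) + cnj w * cnj w * (c2 * cnj ?r) + 2 * w * c3 * ?r = 0"
    using c(2)[of "m + m" "m + m"] YY by (simp add: algebra_simps)
  have s: "c1 * ?r + c3 * x1 0 0 = - (c2 * cnj ?r)" using e0 by (simp add: algebra_simps eq_neg_iff_add_eq_0)
  have 1: "(cnj z - z) * (c2 * cnj ?r) = 0" using eX unfolding s by (simp add: algebra_simps)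
  have 2: "(cnj w - w) * (c2 * cnj ?r) + c3 * ?r = 0" using eY unfolding s by (simp add: algebra_simps)
  have 3: "(cnj w * cnj w - w * w) * (c2 * cnj ?r) + 2 * w * c3 * ?r = 0"
    using eYY unfolding s by (simp add: algebra_simps)
  \<comment> \<open>Combining the relations after one and after two vertical shifts removes
    \<open>c3\<close>, which the Jordan block brings into both.\<close>
  have "(cnj w - w) * (cnj w - w) * (c2 * cnj ?r)
      = (cnj w * cnj w - w * w) * (c2 * cnj ?r) + 2 * w * c3 * ?r
        - 2 * w * ((cnj w - w) * (c2 * cnj ?r) + c3 * ?r)" by (simp add: algebra_simps)
  then have 4: "(cnj w - w) * (cnj w - w) * (c2 * cnj ?r) = 0" using 2 3 by simp
  have "cnj z - z \<noteq> 0 \<or> cnj w - w \<noteq> 0" using nonreal by (auto simp: Reals_cnj_iff)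
  then have "c2 = 0" using 1 4 r_nz by auto
  with 2 have "c3 = 0" using r_nz by auto
  with \<open>c2 = 0\<close> e0 have "c1 = 0" using r_nz by auto
  with \<open>c2 = 0\<close> \<open>c3 = 0\<close> c(1) show False by simp
qed

end

section \<open>Real generalized eigenfunctions\<close>

text \<open>The shift by \<open>(k, k)\<close> divided by its multiplier, minus the identity; its
  nilpotency expresses that \<open>f\<close> is a generalized eigenfunction.\<close>

definition tdiff :: "int \<Rightarrow> real \<Rightarrow> (int \<Rightarrow> int \<Rightarrow> real) \<Rightarrow> int \<Rightarrow> int \<Rightarrow> real" where
  "tdiff k \<sigma> f = (\<lambda>a b. f (a + k) (b + k) / \<sigma> - f a b)"

definition fdiff :: "(int \<Rightarrow> real) \<Rightarrow> int \<Rightarrow> real" where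
  "fdiff g = (\<lambda>t. g (t + 1) - g t)"

lemma tdiff_Suc: "(tdiff k \<sigma> ^^ Suc d) f a b = (tdiff k \<sigma> ^^ d) f (a + k) (b + k) / \<sigma> - (tdiff k \<sigma> ^^ d) f a b"
  by (simp add: tdiff_def[of k \<sigma> "(tdiff k \<sigma> ^^ d) f"])

lemma fdiff_Suc: "(fdiff ^^ Suc d) g t = (fdiff ^^ d) g (t + 1) - (fdiff ^^ d) g t"
  by (simp add: fdiff_def[of "(fdiff ^^ d) g"])

text \<open>A constant \<open>d\<close>-th difference means polynomial growth; each induction step
  sums an eventual lower bound into at least linear growth.\<close>

lemma fdiff_eventually_ge:
  assumes "\<And>t. (fdiff ^^ d) g t = C" "C > 0"
  shows "\<forall>\<^sub>F t::nat in sequentially. g (int t) \<ge> C"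
  using assms(1)
proof (induction d arbitrary: g)
  case (Suc d)
  have "(fdiff ^^ d) (fdiff g) t = C" for t
    using Suc.prems by (simp add: funpow_swap1)
  from Suc.IH[OF this] obtain T where T: "fdiff g (int t) \<ge> C" if "t \<ge> T" for t
    by (auto simp: eventually_sequentially)
  have lin: "g (int (T + j)) \<ge> g (int T) + of_nat j * C" for j
  proof (induction j)
    case (Suc j)
    have "g (int (T + Suc j)) = fdiff g (int (T + j)) + g (int (T + j))"
      by (simp add: fdiff_def algebra_simps)
    then show ?case using Suc T[of "T + j"] by (simp add: algebra_simps)
  qed simp
  obtain J :: nat where J: "of_nat J * C \<ge> C - g (int T)"
    using assms(2) reals_Archimedean3[of C] by (metis less_imp_le)
  show ?case
  proof (rule eventually_sequentiallyI[of "T + J"])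
    fix t assume "T + J \<le> t"
    then obtain j where j: "t = T + (J + j)" by (metis add.assoc le_iff_add)
    have "of_nat J * C \<le> of_nat (J + j) * C" using assms(2) by (intro mult_right_mono) auto
    then show "C \<le> g (int t)" using lin[of "J + j"] J unfolding j by linarith
  qed
qed simp

lemma fdiff_uminus: "(fdiff ^^ d) (\<lambda>t. - g t) = (\<lambda>t. - (fdiff ^^ d) g t)"
  by (induction d) (auto simp: fdiff_def)

lemma fdiff_reflect: "(fdiff ^^ d) (\<lambda>t. g (- t)) t = (- 1) ^ d * (fdiff ^^ d) g (- t - int d)"
proof (induction d arbitrary: t)
  case (Suc d)
  have "- (t + 1) - int d = - t - int (Suc d)" "- t - int d = - t - int (Suc d) + 1" by simp_all
  then show ?case by (simp only: fdiff_Suc Suc.IH) (simp add: algebra_simps)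
qed simp

text \<open>Dominance of the leading coefficient; the parity of the degree \<open>d\<close> shows up
  only towards minus infinity.\<close>

lemma fdiff_eventually_sgn:
  assumes "\<And>t. (fdiff ^^ d) g t = C" "C \<noteq> 0"
  shows "\<forall>\<^sub>F t::nat in sequentially. sgn (g (int t)) = sgn C"
    "\<forall>\<^sub>F t::nat in sequentially. sgn (g (- int t)) = (- 1) ^ d * sgn C"
proof -
  have *: "\<forall>\<^sub>F t::nat in sequentially. sgn (g (int t)) = sgn C"
    if "\<And>t. (fdiff ^^ d) g t = C" "C \<noteq> 0" for g C
  proof (cases "C > 0")
    case True
    show ?thesis using fdiff_eventually_ge[OF that(1) True]
      by eventually_elim (use True in auto)
  next
    case False
    with that have C: "- C > 0" by simp
    have "(fdiff ^^ d) (\<lambda>t. - g t) t = - C" for t using that by (simp add: fdiff_uminus)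
    from fdiff_eventually_ge[OF this C] show ?thesis
      by eventually_elim (use C in auto)
  qed
  show "\<forall>\<^sub>F t::nat in sequentially. sgn (g (int t)) = sgn C" using * assms by blast
  have "\<forall>\<^sub>F t::nat in sequentially. sgn (g (- int t)) = sgn ((- 1) ^ d * C)"
    by (rule *) (use assms in \<open>auto simp: fdiff_reflect\<close>)
  then show "\<forall>\<^sub>F t::nat in sequentially. sgn (g (- int t)) = (- 1) ^ d * sgn C"
    by (simp add: sgn_mult power_sgn[symmetric])
qed

lemma ang_real: "u \<noteq> 0 \<or> v \<noteq> 0 \<Longrightarrow> ang u v = pi / 2 * (1 - sgn u * sgn v)" for u v :: real
  by (cases u "0::real" rule: linorder_cases; cases v "0::real" rule: linorder_cases) (auto simp: ang_def)

lemma tdiff_solution: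
  assumes "gate_solution c s x y" "\<And>a b. c (a + k) (b + k) = c a b" "\<And>a b. s (a + k) (b + k) = s a b"
  shows "gate_solution c s (tdiff k \<sigma> x) (tdiff k \<sigma> y)"
  unfolding gate_solution_def
proof (intro allI conjI)
  fix a b
  have "y (a + k) (b + k + 1) = c a b * x (a + k) (b + k) + s a b * y (a + k) (b + k)"
    "x (a + k + 1) (b + k) = s a b * x (a + k) (b + k) + c a b * y (a + k) (b + k)"
    "y a (b + 1) = c a b * x a b + s a b * y a b" "x (a + 1) b = s a b * x a b + c a b * y a b"
    using assms by (auto simp: gate_solution_def)
  then show "tdiff k \<sigma> y a (b + 1) = c a b *\<^sub>R tdiff k \<sigma> x a b + s a b *\<^sub>R tdiff k \<sigma> y a b"
    "tdiff k \<sigma> x (a + 1) b = s a b *\<^sub>R tdiff k \<sigma> x a b + c a b *\<^sub>R tdiff k \<sigma> y a b"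
    by (simp_all add: tdiff_def add.commute add.left_commute add_divide_distrib algebra_simps)
qed

lemma tdiff_pow_solution:
  assumes "gate_solution c s x y" "\<And>a b. c (a + k) (b + k) = c a b" "\<And>a b. s (a + k) (b + k) = s a b"
  shows "gate_solution c s ((tdiff k \<sigma> ^^ d) x) ((tdiff k \<sigma> ^^ d) y)"
  by (induction d) (use assms tdiff_solution in auto)

lemma tdiff_pow_shift:
  assumes "\<And>a b. f (a + p) (b + q) = \<rho> * f a b"
  shows "(tdiff k \<sigma> ^^ d) f (a + p) (b + q) = \<rho> * (tdiff k \<sigma> ^^ d) f a b"
proof (induction d arbitrary: a b)
  case (Suc d)
  show ?case using Suc[of a b] Suc[of "a + k" "b + k"]
    by (simp add: tdiff_def add.assoc add.commute add.left_commute algebra_simps)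
qed (use assms in simp)

text \<open>Dividing out \<open>\<sigma> powi t\<close> turns the normalised difference along the
  diagonal into the ordinary one, to which the growth statements apply.\<close>

lemma tdiff_pow_fdiff:
  assumes "\<sigma> > 0"
  shows "(fdiff ^^ d) (\<lambda>t. \<sigma> powi (- t) * f (a + k * t) (b + k * t)) t
    = \<sigma> powi (- t) * (tdiff k \<sigma> ^^ d) f (a + k * t) (b + k * t)"
proof (induction d arbitrary: t)
  case (Suc d)
  have "(fdiff ^^ Suc d) (\<lambda>t. \<sigma> powi (- t) * f (a + k * t) (b + k * t)) t
    = \<sigma> powi (- (t + 1)) * (tdiff k \<sigma> ^^ d) f (a + k * (t + 1)) (b + k * (t + 1))
      - \<sigma> powi (- t) * (tdiff k \<sigma> ^^ d) f (a + k * t) (b + k * t)"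
    by (simp only: fdiff_Suc Suc.IH)
  also have "\<sigma> powi (- (t + 1)) = \<sigma> powi (- t) / \<sigma>"
    using assms power_int_add[of \<sigma> "- t" "- 1"] by (simp add: divide_inverse power_int_minus)
  finally show ?case by (simp only: tdiff_Suc) (simp add: algebra_simps)
qed simp

lemma tdiff_pow_zero_below:
  assumes "k > 0" "\<And>a b. a \<le> A \<Longrightarrow> b \<le> B \<Longrightarrow> f a b = 0" "a \<le> A - k * int d" "b \<le> B - k * int d"
  shows "(tdiff k \<sigma> ^^ d) f a b = 0"
  using assms(3,4)
proof (induction d arbitrary: a b)
  case (Suc d)
  have "(tdiff k \<sigma> ^^ d) f (a + k) (b + k) = 0" "(tdiff k \<sigma> ^^ d) f a b = 0"
    using Suc.prems assms(1) by (auto intro!: Suc.IH simp: algebra_simps)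
  then show ?case by (simp only: tdiff_Suc)
qed (use assms in simp)

section \<open>Zeros and signs of real tight solutions\<close>

context tight_solution begin

text \<open>The chain in \<open>tight\<close> starts and ends at the zero vector here, so its length
  is zero and its inner points vanish too; the gate equation does the rest.\<close>

lemma zero_gate_left:
  assumes "x a b = 0" "y a b = 0"
  shows "x (a - 1) b = 0 \<and> y (a - 1) b = 0"
proof -
  have "ang (x a b) (y (a - 1) b) + ang (y (a - 1) b) (x a (b - 1)) + ang (x a (b - 1)) (y a b) = ang (x a b) (y a b)"
    using tight[unfolded tight_def, rule_format, of "a - 1" b] by simp
  then have "ang 0 (y (a - 1) b) = 0"
    using assms ang_nonneg[of 0 "y (a - 1) b"] ang_nonneg[of "y (a - 1) b" "x a (b - 1)"] ang_nonneg[of "x a (b - 1)" 0]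
    by (simp; linarith)
  then have "y (a - 1) b = 0" by (auto simp: ang_eq_0 ray_def)
  then show ?thesis using rec_x[of "a - 1" b] assms s_pos[of "a - 1" b] by simp
qed

lemma zero_gate_right:
  assumes "x a b = 0" "y a b = 0"
  shows "x a (b - 1) = 0 \<and> y a (b - 1) = 0"
proof -
  have "ang (x a b) (y (a - 1) b) + ang (y (a - 1) b) (x a (b - 1)) + ang (x a (b - 1)) (y a b) = ang (x a b) (y a b)"
    using tight[unfolded tight_def, rule_format, of "a - 1" b] by simp
  then have "ang (x a (b - 1)) 0 = 0"
    using assms ang_nonneg[of 0 "y (a - 1) b"] ang_nonneg[of "y (a - 1) b" "x a (b - 1)"] ang_nonneg[of "x a (b - 1)" 0]
    by (simp; linarith)
  then have "x a (b - 1) = 0" by (auto simp: ang_eq_0 ray_def)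
  then show ?thesis using rec_y[of a "b - 1"] assms s_pos[of a "b - 1"] by simp
qed

lemma zero_gate_below:
  assumes "x a b = 0" "y a b = 0" "a' \<le> a" "b' \<le> b"
  shows "x a' b' = 0" "y a' b' = 0"
proof -
  have la: "x (a - int i) b = 0 \<and> y (a - int i) b = 0" for i
  proof (induction i)
    case (Suc i)
    then show ?case using zero_gate_left[of "a - int i" b] by (simp add: algebra_simps)
  qed (use assms in simp)
  have lb: "x (a - int i) (b - int j) = 0 \<and> y (a - int i) (b - int j) = 0" for i j
  proof (induction j)
    case (Suc j)
    then show ?case using zero_gate_right[of "a - int i" "b - int j"] by (simp add: algebra_simps)
  qed (use la in simp)
  show "x a' b' = 0" "y a' b' = 0"
    using lb[of "nat (a - a')" "nat (b - b')"] assms by simp_all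
qed

end

locale real_tight_solution = tight_solution c s x y for c s and x y :: "int \<Rightarrow> int \<Rightarrow> real" +
  assumes nz: "x a b \<noteq> 0 \<or> y a b \<noteq> 0"
begin

lemma out_nz: "y a (b + 1) \<noteq> 0 \<or> x (a + 1) b \<noteq> 0"
  using nz[of a b] x_from_out[of a b] y_from_out[of a b] by auto

lemma sgn_ray: "ray u v \<Longrightarrow> sgn u = sgn v" for u v :: real
  by (auto simp: ray_def sgn_mult)

text \<open>If the inputs of the preceding gate cancel in one output, the other output has the sign
  opposite to \<open>y (a - 1) b\<close>, and tightness hands the sign of \<open>y (a - 1) b\<close>
  on to \<open>y a b\<close>. So on its row the zero \<open>x a b\<close> sits between opposite
  signs.\<close>

lemma x_zero_neighbours:
  assumes "x a b = 0" shows "sgn (y (a - 1) (b + 1)) = - sgn (y a b)"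
proof -
  let ?c = "c (a - 1) b" and ?s = "s (a - 1) b"
  have 0: "?s * x (a - 1) b + ?c * y (a - 1) b = 0" using rec_x[of "a - 1" b] assms by simp
  then have x: "x (a - 1) b = - (?c / ?s) * y (a - 1) b" using s_pos[of "a - 1" b] by (simp add: field_simps)
  have p2: "y (a - 1) b \<noteq> 0" using nz[of "a - 1" b] x by auto
  have "y (a - 1) (b + 1) = (?s - ?c\<^sup>2 / ?s) * y (a - 1) b"
    using rec_y[of "a - 1" b] x by (simp add: algebra_simps power2_eq_square)
  also have "?s - ?c\<^sup>2 / ?s = - (1 / ?s)" unfolding cs using s_pos[of "a - 1" b] by (simp add: field_simps power2_eq_square)
  finally have "sgn (y (a - 1) (b + 1)) = - sgn (y (a - 1) b)" using s_pos[of "a - 1" b] by (simp add: sgn_mult)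
  moreover have "ray (y (a - 1) b) (y a b)"
    using btw124[of "a - 1" b] assms p2 btw_zero_left by simp
  ultimately show ?thesis using sgn_ray by auto
qed

lemma y_zero_neighbours:
  assumes "y a b = 0" shows "sgn (x (a + 1) (b - 1)) = - sgn (x a b)"
proof -
  let ?c = "c a (b - 1)" and ?s = "s a (b - 1)"
  have 0: "?c * x a (b - 1) + ?s * y a (b - 1) = 0" using rec_y[of a "b - 1"] assms by simp
  then have y: "y a (b - 1) = - (?c / ?s) * x a (b - 1)" using s_pos[of a "b - 1"] by (simp add: field_simps)
  have p3: "x a (b - 1) \<noteq> 0" using nz[of a "b - 1"] y by auto
  have "x (a + 1) (b - 1) = (?s - ?c\<^sup>2 / ?s) * x a (b - 1)"
    using rec_x[of a "b - 1"] y by (simp add: algebra_simps power2_eq_square)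
  also have "?s - ?c\<^sup>2 / ?s = - (1 / ?s)" unfolding cs using s_pos[of a "b - 1"] by (simp add: field_simps power2_eq_square)
  finally have "sgn (x (a + 1) (b - 1)) = - sgn (x a (b - 1))" using s_pos[of a "b - 1"] by (simp add: sgn_mult)
  moreover have "ray (x a (b - 1)) (x a b)"
    using btw134[of "a - 1" b] assms p3 btw_zero_right by simp
  ultimately show ?thesis using sgn_ray by auto
qed

text \<open>A zero on the row has neighbours of opposite sign, so its two adjacent angles add up to
  \<open>pi\<close> whatever replaces it. Hence only the signs at nonzero values matter, up to a
  global sign \<open>\<tau>\<close>.\<close>

lemma row_length_eq_if_signs:
  assumes p: "p > 0" and \<rho>: "\<rho> > 0"
    and X: "\<And>a b. x (a + p) (b - p) = \<rho> * x a b" "\<And>a b. y (a + p) (b - p) = \<rho> * y a b"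
    and per: "\<And>a. u (a + p) = \<rho> * u a" "\<And>a. v (a + p) = \<rho> * v a"
    and \<tau>: "\<tau> * \<tau> = (1::real)"
    and u: "\<And>a. a \<in> {0..p} \<Longrightarrow> x a (- a) \<noteq> 0 \<Longrightarrow> sgn (u a) = \<tau> * sgn (x a (- a))"
    and v: "\<And>a. a \<in> {0..p} \<Longrightarrow> y a (- a) \<noteq> 0 \<Longrightarrow> sgn (v a) = \<tau> * sgn (y a (- a))"
  shows "(\<Sum>a\<in>{0..<p}. ang (u a) (v a) + ang (v a) (u (a + 1))) = row_length p x y 0"
proof -
  define e f where "e a = sgn (x a (- a))" and "f a = sgn (y a (- a))" for a
  define t r where "t a = \<tau> * sgn (u a)" and "r a = \<tau> * sgn (v a)" for a
  have \<tau>0: "\<tau> \<noteq> 0" using \<tau> by auto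
  have te: "t a = e a" if "a \<in> {0..p}" "e a \<noteq> 0" for a
  proof -
    have "t a = (\<tau> * \<tau>) * e a" using u[OF that(1)] that(2) by (simp add: t_def e_def sgn_zero_iff)
    then show ?thesis using \<tau> by simp
  qed
  have rf: "r a = f a" if "a \<in> {0..p}" "f a \<noteq> 0" for a
  proof -
    have "r a = (\<tau> * \<tau>) * f a" using v[OF that(1)] that(2) by (simp add: r_def f_def sgn_zero_iff)
    then show ?thesis using \<tau> by simp
  qed
  have nzs: "e a \<noteq> 0 \<or> f a \<noteq> 0" "f a \<noteq> 0 \<or> e (a + 1) \<noteq> 0" for a
  proof -
    have m: "- (a + 1) = - a - 1" by simp
    show "e a \<noteq> 0 \<or> f a \<noteq> 0" using nz[of a "- a"] by (simp add: e_def f_def sgn_zero_iff)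
    show "f a \<noteq> 0 \<or> e (a + 1) \<noteq> 0" using out_nz[of a "- a - 1"] unfolding e_def f_def m by (simp add: sgn_zero_iff)
  qed
  have tr: "sgn (u a) * sgn (v a) = t a * r a" "sgn (v a) * sgn (u (a + 1)) = r a * t (a + 1)" for a
  proof -
    have "t a * r a = (\<tau> * \<tau>) * (sgn (u a) * sgn (v a))" "r a * t (a + 1) = (\<tau> * \<tau>) * (sgn (v a) * sgn (u (a + 1)))"
      by (simp_all only: t_def r_def ac_simps)
    then show "sgn (u a) * sgn (v a) = t a * r a" "sgn (v a) * sgn (u (a + 1)) = r a * t (a + 1)"
      using \<tau> by simp_all
  qed
  have A: "ang (u a) (v a) + ang (v a) (u (a + 1)) = pi / 2 * (2 - (t a * r a + r a * t (a + 1)))"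
    if "a \<in> {0..<p}" for a
  proof -
    have "u a \<noteq> 0 \<or> v a \<noteq> 0" "v a \<noteq> 0 \<or> u (a + 1) \<noteq> 0"
      using nzs[of a] te[of a] te[of "a + 1"] rf[of a] that by (auto simp: t_def r_def)
    then have "ang (u a) (v a) = pi / 2 * (1 - t a * r a)" "ang (v a) (u (a + 1)) = pi / 2 * (1 - r a * t (a + 1))"
      by (simp_all only: ang_real tr)
    then show ?thesis by (simp add: algebra_simps)
  qed
  have B: "ang (x a (- a)) (y a (- a)) + ang (y a (- a)) (x (a + 1) (- a - 1))
      = pi / 2 * (2 - (e a * f a + f a * e (a + 1)))" for a
  proof -
    have m: "- (a + 1) = - a - 1" by simp
    have "ang (x a (- a)) (y a (- a)) = pi / 2 * (1 - e a * f a)"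
      using nz[of a "- a"] by (simp add: ang_real e_def f_def)
    moreover have "ang (y a (- a)) (x (a + 1) (- a - 1)) = pi / 2 * (1 - f a * e (a + 1))"
      using out_nz[of a "- a - 1"] unfolding e_def f_def m by (simp add: ang_real)
    ultimately show ?thesis by (simp add: algebra_simps)
  qed
  \<comment> \<open>The discrepancies are supported on the zeros of the row. Two neighbours never
    vanish together, which kills the mixed terms, and the sign change across a zero kills the linear
    ones.\<close>
  define dt dr where "dt a = t a - e a" and "dr a = r a - f a" for a
  have tp: "t p = t 0" "e p = e 0" using per(1)[of 0] X(1)[of 0 0] \<rho> by (simp_all add: t_def e_def sgn_mult)
  have z1: "dt a * (f a + f (a - 1)) = 0" if "a \<in> {0..p}" for a
  proof (cases "e a = 0")
    case True
    have m: "- (a - 1) = - a + 1" by simp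
    have "f (a - 1) = - f a"
      using x_zero_neighbours[of a "- a"] True unfolding f_def e_def m by (simp add: sgn_zero_iff)
    then show ?thesis by simp
  qed (use te[OF that] in \<open>simp add: dt_def\<close>)
  have z2: "dr a * (e a + e (a + 1)) = 0" if "a \<in> {0..p}" for a
  proof (cases "f a = 0")
    case True
    have m: "- (a + 1) = - a - 1" by simp
    have "e (a + 1) = - e a"
      using y_zero_neighbours[of a "- a"] True unfolding f_def e_def m by (simp add: sgn_zero_iff)
    then show ?thesis by simp
  qed (use rf[OF that] in \<open>simp add: dr_def\<close>)
  have z3: "dt a * dr a = 0" "dr a * dt (a + 1) = 0" if "a \<in> {0..<p}" for a
    using te[of a] te[of "a + 1"] rf[of a] nzs[of a] that by (auto simp: dt_def dr_def)
  have "(\<Sum>a\<in>{0..<p}. t a * r a + r a * t (a + 1)) - (\<Sum>a\<in>{0..<p}. e a * f a + f a * e (a + 1))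
      = (\<Sum>a\<in>{0..<p}. dt a * f a + dt (a + 1) * f a + dr a * (e a + e (a + 1)) + dt a * dr a + dr a * dt (a + 1))"
    unfolding sum_subtractf[symmetric] by (intro sum.cong) (auto simp: dt_def dr_def algebra_simps)
  also have "\<dots> = (\<Sum>a\<in>{0..<p}. dt a * f a + dt (a + 1) * f a)"
  proof (intro sum.cong refl)
    fix a assume a: "a \<in> {0..<p}"
    have "dr a * (e a + e (a + 1)) = 0" "dt a * dr a = 0" "dr a * dt (a + 1) = 0"
      using a z2[of a] z3[of a] by auto
    then show "dt a * f a + dt (a + 1) * f a + dr a * (e a + e (a + 1)) + dt a * dr a + dr a * dt (a + 1)
        = dt a * f a + dt (a + 1) * f a"
      by linarith
  qed
  also have "\<dots> = (\<Sum>a\<in>{0..<p}. dt a * f a) + (\<Sum>a\<in>{0..<p}. dt (a + 1) * f (a + 1 - 1))"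
    by (simp add: sum.distrib)
  also have "(\<Sum>a\<in>{0..<p}. dt (a + 1) * f (a + 1 - 1)) = (\<Sum>a\<in>{0..<p}. dt a * f (a - 1))"
  proof (rule sum_cyclic_shift)
    have "f (p - 1) = f (- 1)"
      using X(2)[of "- 1" 1] \<rho> by (simp add: f_def sgn_mult algebra_simps)
    then show "dt p * f (p - 1) = dt 0 * f (0 - 1)" using tp by (simp add: dt_def)
  qed (use p in simp)
  also have "(\<Sum>a\<in>{0..<p}. dt a * f a) + (\<Sum>a\<in>{0..<p}. dt a * f (a - 1)) = (\<Sum>a\<in>{0..<p}. dt a * (f a + f (a - 1)))"
    by (simp add: sum.distrib algebra_simps)
  also have "\<dots> = 0" by (intro sum.neutral ballI z1) auto
  finally have S: "(\<Sum>a\<in>{0..<p}. t a * r a + r a * t (a + 1)) = (\<Sum>a\<in>{0..<p}. e a * f a + f a * e (a + 1))" by simp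
  have lin: "(\<Sum>a\<in>{0..<p}. pi / 2 * (2 - h a)) = pi / 2 * ((\<Sum>a\<in>{0..<p}. 2) - (\<Sum>a\<in>{0..<p}. h a))"
    for h :: "int \<Rightarrow> real"
    by (simp only: sum_distrib_left[symmetric] sum_subtractf)
  have "(\<Sum>a\<in>{0..<p}. ang (u a) (v a) + ang (v a) (u (a + 1)))
      = (\<Sum>a\<in>{0..<p}. pi / 2 * (2 - (t a * r a + r a * t (a + 1))))" by (intro sum.cong A) auto
  also have "\<dots> = pi / 2 * ((\<Sum>a\<in>{0..<p}. 2) - (\<Sum>a\<in>{0..<p}. t a * r a + r a * t (a + 1)))"
    by (rule lin)
  also have "\<dots> = (\<Sum>a\<in>{0..<p}. pi / 2 * (2 - (e a * f a + f a * e (a + 1))))"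
    unfolding S by (rule lin[symmetric])
  also have "\<dots> = row_length p x y 0" unfolding row_length_def by (simp add: B)
  finally show ?thesis .
qed

end

context gates begin

text \<open>The last nonvanishing difference \<open>ex\<close>, \<open>ey\<close> is a genuine
  eigenfunction, hence tight. Far up and far down, \<open>x\<close> and \<open>y\<close> have its
  signs wherever it is nonzero, up to a global sign, so the row lengths have equal limits and
  \<open>x\<close>, \<open>y\<close> is tight as well. A zero gate then clears a whole quadrant,
  where the difference would have to vanish too.\<close>

lemma real_zero_gate:
  fixes x y :: "int \<Rightarrow> int \<Rightarrow> real"
  assumes sol: "gate_solution c s x y"
    and cper: "\<And>a b. c (a + k) (b + k) = c a b" "\<And>a b. s (a + k) (b + k) = s a b"
    and pk: "p > 0" "k > 0" and \<rho>: "\<rho> > 0" and \<sigma>: "\<sigma> > 0"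
    and X: "\<And>a b. x (a + p) (b - p) = \<rho> * x a b" "\<And>a b. y (a + p) (b - p) = \<rho> * y a b"
    and nil: "\<And>a b. (tdiff k \<sigma> ^^ D) x a b = 0" "\<And>a b. (tdiff k \<sigma> ^^ D) y a b = 0"
    and zero: "x a0 b0 = 0" "y a0 b0 = 0"
  shows "x a b = 0 \<and> y a b = 0"
proof (rule ccontr)
  assume contra: "\<not> ?thesis"
  let ?Z = "\<lambda>d. \<forall>a b. (tdiff k \<sigma> ^^ d) x a b = 0 \<and> (tdiff k \<sigma> ^^ d) y a b = 0"
  have "\<exists>d. \<not> ?Z d \<and> ?Z (Suc d)"
  proof (rule ccontr)
    assume *: "\<not> ?thesis"
    have "\<not> ?Z d" for d
    proof (induction d)
      case 0
      show ?case using contra by (simp, blast)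
    next
      case (Suc d)
      then show ?case using * by blast
    qed
    then show False using nil by blast
  qed
  then obtain d where d: "\<not> ?Z d" "?Z (Suc d)" by blast
  define ex ey where "ex = (tdiff k \<sigma> ^^ d) x" and "ey = (tdiff k \<sigma> ^^ d) y"
  have esol: "gate_solution c s ex ey" unfolding ex_def ey_def
    by (rule tdiff_pow_solution[where c = c and s = s and k = k]) (fact sol cper)+
  have eX: "ex (a + p) (b - p) = \<rho> * ex a b" "ey (a + p) (b - p) = \<rho> * ey a b" for a b
    using tdiff_pow_shift[of x p "- p" \<rho>] tdiff_pow_shift[of y p "- p" \<rho>] X by (auto simp: ex_def ey_def)
  have eY: "ex (a + k) (b + k) = \<sigma> * ex a b" "ey (a + k) (b + k) = \<sigma> * ey a b" for a b
    using d(2)[unfolded tdiff_Suc] \<sigma> by (simp_all add: ex_def ey_def field_simps)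
  have iso: "ang (l * u) (l * v) = ang u v" if "l > 0" for l u v :: real
    using ang_scale[OF that that, of u v] by (simp only: real_scaleR_def)
  have et: "tight ex ey"
    by (rule tight_if_similar[where x = ex and y = ey and n = p and m = k and \<phi> = "(*) \<rho>" and \<psi> = "(*) \<sigma>"])
      (fact esol pk eX eY | rule iso \<rho> \<sigma>)+
  interpret e: tight_solution c s ex ey by unfold_locales (fact esol et)+
  have eYj: "ex (a - k * int j) (b - k * int j) = ex a b / \<sigma> ^ j \<and> ey (a - k * int j) (b - k * int j) = ey a b / \<sigma> ^ j" for a b j
  proof (induction j)
    case (Suc j)
    then show ?case using eY(1)[of "a - k * int (Suc j)" "b - k * int (Suc j)"]
        eY(2)[of "a - k * int (Suc j)" "b - k * int (Suc j)"] \<sigma>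
      by (simp add: algebra_simps divide_simps)
  qed simp
  \<comment> \<open>A zero gate of the eigenfunction clears a quadrant, and the exact periodicity
    moves every other gate into it.\<close>
  have enz: "ex a b \<noteq> 0 \<or> ey a b \<noteq> 0" for a b
  proof (rule ccontr)
    assume "\<not> ?thesis"
    then have 0: "ex a b = 0" "ey a b = 0" by auto
    have "ex a' b' = 0 \<and> ey a' b' = 0" for a' b'
    proof -
      define j where "j = nat (\<bar>a' - a\<bar> + \<bar>b' - b\<bar>)"
      have "int j \<le> k * int j" using pk by (simp add: mult_le_cancel_right1)
      then have "a' - k * int j \<le> a" "b' - k * int j \<le> b" by (auto simp: j_def)
      from e.zero_gate_below[OF 0 this] show ?thesis using eYj[of a' j b'] \<sigma> by simp
    qed
    then show False using d(1) by (auto simp: ex_def ey_def)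
  qed
  interpret e: real_tight_solution c s ex ey by unfold_locales (rule enz)
  let ?L = "row_length p ex ey 0"
  have g: "(fdiff ^^ d) (\<lambda>t. \<sigma> powi (- t) * f (a + k * t) (b + k * t)) t = (tdiff k \<sigma> ^^ d) f a b"
    if f: "\<And>a b. (tdiff k \<sigma> ^^ Suc d) f a b = 0" for f a b t
  proof -
    have step: "(tdiff k \<sigma> ^^ d) f (a + k) (b + k) = \<sigma> * (tdiff k \<sigma> ^^ d) f a b" for a b
      using f[of a b, unfolded tdiff_Suc] \<sigma> by (simp add: field_simps)
    have "(tdiff k \<sigma> ^^ d) f (a + k * t) (b + k * t) = \<sigma> powi t * (tdiff k \<sigma> ^^ d) f a b"
    proof (induction t rule: int_induct[of _ 0])
      case (step1 i)
      then show ?case using step[of "a + k * i" "b + k * i"] \<sigma>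
        by (simp add: algebra_simps power_int_add)
    next
      case (step2 i)
      then show ?case using step[of "a + k * (i - 1)" "b + k * (i - 1)"] \<sigma>
        by (simp add: algebra_simps power_int_diff)
    qed simp
    then show ?thesis unfolding tdiff_pow_fdiff[OF \<sigma>] using \<sigma> by (simp add: power_int_minus)
  qed
  have sgn_ev: "\<forall>\<^sub>F t::nat in sequentially. sgn (f (a + k * int t) (b + k * int t)) = sgn ((tdiff k \<sigma> ^^ d) f a b)"
    "\<forall>\<^sub>F t::nat in sequentially. sgn (f (a - k * int t) (b - k * int t)) = (- 1) ^ d * sgn ((tdiff k \<sigma> ^^ d) f a b)"
    if f: "\<And>a b. (tdiff k \<sigma> ^^ Suc d) f a b = 0" and nz: "(tdiff k \<sigma> ^^ d) f a b \<noteq> 0" for f a b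
  proof -
    have "sgn (\<sigma> powi t * r) = sgn r" "sgn (\<sigma> ^ n * r) = sgn r" for t n r using \<sigma> by (simp_all add: sgn_mult)
    then show "\<forall>\<^sub>F t::nat in sequentially. sgn (f (a + k * int t) (b + k * int t)) = sgn ((tdiff k \<sigma> ^^ d) f a b)"
      "\<forall>\<^sub>F t::nat in sequentially. sgn (f (a - k * int t) (b - k * int t)) = (- 1) ^ d * sgn ((tdiff k \<sigma> ^^ d) f a b)"
      using fdiff_eventually_sgn[OF g[of f a b, OF f] nz] by simp_all
  qed
  have d2: "(tdiff k \<sigma> ^^ Suc d) x a b = 0" "(tdiff k \<sigma> ^^ Suc d) y a b = 0" for a b using d(2) by auto
  have rl: "row_length p x y (2 * j) = (\<Sum>a\<in>{0..<p}. ang (x (a + j) (- a + j)) (y (a + j) (- a + j))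
       + ang (y (a + j) (- a + j)) (x (a + 1 + j) (- (a + 1) + j)))" for j
    using row_length_shift[where x = x and y = y and p = p and \<phi> = "(*) \<rho>" and t = 0 and k = j] pk X iso[OF \<rho>]
    by simp
  have rl_eq: "row_length p x y (2 * j) = ?L"
    if \<tau>: "\<tau> * \<tau> = 1" and u: "\<And>a. a \<in> {0..p} \<Longrightarrow> ex a (- a) \<noteq> 0 \<Longrightarrow> sgn (x (a + j) (- a + j)) = \<tau> * sgn (ex a (- a))"
      and v: "\<And>a. a \<in> {0..p} \<Longrightarrow> ey a (- a) \<noteq> 0 \<Longrightarrow> sgn (y (a + j) (- a + j)) = \<tau> * sgn (ey a (- a))" for j \<tau>
  proof -
    have P: "x (a + p + j) (- (a + p) + j) = \<rho> * x (a + j) (- a + j)" "y (a + p + j) (- (a + p) + j) = \<rho> * y (a + j) (- a + j)" for a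
      using X(1)[of "a + j" "- a + j"] X(2)[of "a + j" "- a + j"] by (simp_all add: algebra_simps)
    show ?thesis unfolding rl
      by (rule e.row_length_eq_if_signs[where u = "\<lambda>a. x (a + j) (- a + j)" and v = "\<lambda>a. y (a + j) (- a + j)",
            OF pk(1) \<rho> eX P \<tau> u v])
  qed
  have up: "\<forall>\<^sub>F t::nat in sequentially. row_length p x y (2 * (k * int t)) = ?L"
  proof -
    have "\<forall>\<^sub>F t::nat in sequentially. \<forall>a\<in>{0..p}. ex a (- a) \<noteq> 0 \<longrightarrow> sgn (x (a + k * int t) (- a + k * int t)) = sgn (ex a (- a))"
    proof (intro eventually_ball_finite ballI)
      fix a show "\<forall>\<^sub>F t::nat in sequentially. ex a (- a) \<noteq> 0 \<longrightarrow> sgn (x (a + k * int t) (- a + k * int t)) = sgn (ex a (- a))"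
        using sgn_ev(1)[where f = x and a = a and b = "- a", OF d2(1)]
        by (cases "ex a (- a) = 0") (simp_all add: ex_def)
    qed simp
    moreover have "\<forall>\<^sub>F t::nat in sequentially. \<forall>a\<in>{0..p}. ey a (- a) \<noteq> 0 \<longrightarrow> sgn (y (a + k * int t) (- a + k * int t)) = sgn (ey a (- a))"
    proof (intro eventually_ball_finite ballI)
      fix a show "\<forall>\<^sub>F t::nat in sequentially. ey a (- a) \<noteq> 0 \<longrightarrow> sgn (y (a + k * int t) (- a + k * int t)) = sgn (ey a (- a))"
        using sgn_ev(1)[where f = y and a = a and b = "- a", OF d2(2)]
        by (cases "ey a (- a) = 0") (simp_all add: ey_def)
    qed simp
    ultimately show ?thesis
      by eventually_elim (rule rl_eq[of 1], auto)
  qed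
  have down: "\<forall>\<^sub>F t::nat in sequentially. row_length p x y (2 * (- (k * int t))) = ?L"
  proof -
    have "\<forall>\<^sub>F t::nat in sequentially. \<forall>a\<in>{0..p}. ex a (- a) \<noteq> 0 \<longrightarrow> sgn (x (a - k * int t) (- a - k * int t)) = (- 1) ^ d * sgn (ex a (- a))"
    proof (intro eventually_ball_finite ballI)
      fix a show "\<forall>\<^sub>F t::nat in sequentially. ex a (- a) \<noteq> 0 \<longrightarrow> sgn (x (a - k * int t) (- a - k * int t)) = (- 1) ^ d * sgn (ex a (- a))"
        using sgn_ev(2)[where f = x and a = a and b = "- a", OF d2(1)]
        by (cases "ex a (- a) = 0") (simp_all add: ex_def)
    qed simp
    moreover have "\<forall>\<^sub>F t::nat in sequentially. \<forall>a\<in>{0..p}. ey a (- a) \<noteq> 0 \<longrightarrow> sgn (y (a - k * int t) (- a - k * int t)) = (- 1) ^ d * sgn (ey a (- a))"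
    proof (intro eventually_ball_finite ballI)
      fix a show "\<forall>\<^sub>F t::nat in sequentially. ey a (- a) \<noteq> 0 \<longrightarrow> sgn (y (a - k * int t) (- a - k * int t)) = (- 1) ^ d * sgn (ey a (- a))"
        using sgn_ev(2)[where f = y and a = a and b = "- a", OF d2(2)]
        by (cases "ey a (- a) = 0") (simp_all add: ey_def)
    qed simp
    ultimately show ?thesis
      by eventually_elim (rule rl_eq[of "(- 1) ^ d"], auto simp flip: power_mult_distrib)
  qed
  have ut: "tight x y"
  proof (rule tight_if_limits[where x = x and y = y and p = p and T = "2 * k" and \<phi> = "(*) \<rho>" and L = ?L])
    show "(\<lambda>t. row_length p x y (2 * k * int t)) \<longlonglongrightarrow> ?L"
      by (rule tendsto_eventually) (use up in \<open>simp add: mult.assoc\<close>)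
    show "(\<lambda>t. row_length p x y (- (2 * k * int t))) \<longlonglongrightarrow> ?L"
      by (rule tendsto_eventually) (use down in \<open>simp add: mult.assoc\<close>)
  qed (fact sol X | use pk iso[OF \<rho>] in simp)+
  interpret u: tight_solution c s x y by unfold_locales (fact sol ut)+
  \<comment> \<open>Each difference looks ahead by \<open>k\<close>, so a \<open>d\<close>-fold
    difference at this gate uses only values in the cleared quadrant.\<close>
  have "ex (a0 - k * int d) (b0 - k * int d) = 0" "ey (a0 - k * int d) (b0 - k * int d) = 0"
    unfolding ex_def ey_def
    using u.zero_gate_below[OF zero]
    by (auto intro!: tdiff_pow_zero_below[OF pk(2), of a0 b0])
  then show False using enz by blast
qed

end

section \<open>Kernels of matrices of power series\<close>

text \<open>Divisibility by \<open>fps_X ^ \<mu>\<close>, expressed through coefficients.\<close>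

definition low :: "nat \<Rightarrow> complex fps \<Rightarrow> bool" where
  "low \<mu> f \<longleftrightarrow> (\<forall>i<\<mu>. fps_nth f i = 0)"

lemma low_mult: "low \<mu> f \<Longrightarrow> low \<mu> (g * f)"
  by (auto simp: low_def fps_mult_nth intro!: sum.neutral)

lemma low_mult': "low \<mu> f \<Longrightarrow> low \<mu> (f * g)"
  using low_mult by (simp add: mult.commute)

lemma low_diff: "low \<mu> f \<Longrightarrow> low \<mu> g \<Longrightarrow> low \<mu> (f - g)"
  by (auto simp: low_def)

lemma low_Suc_X: "low (Suc \<mu>) (fps_X * f) \<longleftrightarrow> low \<mu> f"
proof
  show "low (Suc \<mu>) (fps_X * f) \<Longrightarrow> low \<mu> f"
    unfolding low_def by (metis Suc_less_eq diff_Suc_1 fps_X_mult_nth nat.distinct(1))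
  show "low \<mu> f \<Longrightarrow> low (Suc \<mu>) (fps_X * f)"
    by (auto simp: low_def fps_X_mult_nth less_Suc_eq_0_disj)
qed

lemma low_const_mult: "k \<noteq> 0 \<Longrightarrow> low \<mu> (fps_const k * f) \<longleftrightarrow> low \<mu> f"
  by (auto simp: low_def)

lemma low_X_power: "low \<mu> (fps_X ^ \<mu>)"
  by (auto simp: low_def fps_X_power_nth)

definition fmat :: "nat \<Rightarrow> (nat \<Rightarrow> nat \<Rightarrow> 'a) \<Rightarrow> 'a Matrix.mat" where
  "fmat N M = Matrix.mat N N (\<lambda>(r, k). M r k)"

lemma fmat_carrier: "fmat N M \<in> carrier_mat N N"
  by (simp add: fmat_def)

lemma det_fps_nth_0: "fps_nth (Determinant.det (fmat N M)) 0 = Determinant.det (fmat N (\<lambda>r k. fps_nth (M r k) 0))"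
  for M :: "nat \<Rightarrow> nat \<Rightarrow> complex fps"
proof -
  have "fps_nth (signof p * (\<Prod>i = 0..<N. fmat N M $$ (i, p i))) 0
      = signof p * (\<Prod>i = 0..<N. fmat N (\<lambda>r k. fps_nth (M r k) 0) $$ (i, p i))"
    if "p permutes {0..<N}" for p
  proof -
    have prod0: "fps_nth (prod f A) 0 = (\<Prod>i\<in>A. fps_nth (f i) 0)" for f :: "nat \<Rightarrow> complex fps" and A
      by (induction A rule: infinite_finite_induct) (simp_all add: fps_mult_nth)
    have "fps_nth (\<Prod>i = 0..<N. fmat N M $$ (i, p i)) 0 = (\<Prod>i = 0..<N. fps_nth (fmat N M $$ (i, p i)) 0)"
      by (rule prod0)
    also have "\<dots> = (\<Prod>i = 0..<N. fmat N (\<lambda>r k. fps_nth (M r k) 0) $$ (i, p i))"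
    proof (intro prod.cong refl)
      fix i assume "i \<in> {0..<N}"
      moreover from this have "p i < N" using that by (metis atLeastLessThan_iff permutes_in_image)
      ultimately show "fps_nth (fmat N M $$ (i, p i)) 0 = fmat N (\<lambda>r k. fps_nth (M r k) 0) $$ (i, p i)"
        by (simp add: fmat_def)
    qed
    finally show ?thesis by (simp add: sign_def)
  qed
  then show ?thesis
    by (simp add: Determinant.det_def fps_sum_nth fmat_carrier[THEN carrier_matD(1)] fmat_carrier[THEN carrier_matD(2)])
qed

lemma det_zero_kernel:
  fixes M :: "nat \<Rightarrow> nat \<Rightarrow> complex"
  assumes "Determinant.det (fmat N M) = 0"
  obtains v j where "j < N" "v j \<noteq> 0" "\<And>r. r < N \<Longrightarrow> (\<Sum>k<N. M r k * v k) = 0"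
proof -
  obtain v where v: "v \<in> carrier_vec N" "v \<noteq> 0\<^sub>v N" "fmat N M *\<^sub>v v = 0\<^sub>v N"
    using assms det_0_iff_vec_prod_zero_field[OF fmat_carrier] by blast
  have "\<exists>j<N. vec_index v j \<noteq> 0"
    using v(1,2) by (metis carrier_vecD eq_vecI index_zero_vec)
  then obtain j where "j < N" "vec_index v j \<noteq> 0" by blast
  moreover have "(\<Sum>k<N. M r k * vec_index v k) = 0" if "r < N" for r
  proof -
    have "vec_index (fmat N M *\<^sub>v v) r = (\<Sum>k<N. M r k * vec_index v k)"
      using v(1) that by (simp add: fmat_def scalar_prod_def atLeast0LessThan)
    then show ?thesis using v(3) that by simp
  qed
  ultimately show ?thesis using that by blast
qed

lemma det_replace_col_mult:
  fixes M :: "nat \<Rightarrow> nat \<Rightarrow> 'a::comm_ring_1"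
  assumes "j < N"
  shows "Determinant.det (fmat N (\<lambda>r k. if k = j then t * g r else M r k))
    = t * Determinant.det (fmat N (\<lambda>r k. if k = j then g r else M r k))"
proof -
  let ?A = "fmat N (\<lambda>r k. if k = j then t * g r else M r k)"
  let ?B = "fmat N (\<lambda>r k. if k = j then g r else M r k)"
  have "cofactor ?A i j = cofactor ?B i j" for i
  proof -
    have "mat_delete ?A i j = mat_delete ?B i j"
      by (rule eq_matI) (auto simp: mat_delete_def fmat_def)
    then show ?thesis by (simp add: cofactor_def)
  qed
  then show ?thesis
    unfolding laplace_expansion_column[OF fmat_carrier assms]
    using assms by (simp add: sum_distrib_left fmat_def mult.assoc)
qed

text \<open>Cramer's rule: modulo the other columns, the combination reduces to \<open>v j\<close>
  times column \<open>j\<close>.\<close>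

lemma det_replace_col_mat_vec:
  fixes M :: "nat \<Rightarrow> nat \<Rightarrow> 'a::comm_ring_1"
  assumes "j < N"
  shows "Determinant.det (fmat N (\<lambda>r k. if k = j then (\<Sum>l<N. M r l * v l) else M r k)) = v j * Determinant.det (fmat N M)"
proof -
  have "replace_col (fmat N M) (fmat N M *\<^sub>v Matrix.vec N v) j
      = fmat N (\<lambda>r k. if k = j then (\<Sum>l<N. M r l * v l) else M r k)"
    by (rule eq_matI) (auto simp: replace_col_def fmat_def scalar_prod_def atLeast0LessThan)
  then show ?thesis
    using cramer_lemma_mat[OF fmat_carrier, of "Matrix.vec N v" N j M] assms by simp
qed

text \<open>A local Smith form argument: a kernel vector \<open>v\<close> at \<open>\<epsilon> = 0\<close> lets one divide one column of
  the matrix by \<open>\<epsilon>\<close>, which lowers the order of the determinant by one.\<close>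

lemma truncated_kernel:
  fixes M :: "nat \<Rightarrow> nat \<Rightarrow> complex fps"
  assumes "low \<mu> (Determinant.det (fmat N M))"
  shows "\<exists>U. (\<forall>i<\<mu>. \<forall>r<N. low \<mu> (\<Sum>k<N. M r k * U i k)) \<and>
    (\<forall>c. (\<forall>k<N. low \<mu> (\<Sum>i<\<mu>. fps_const (c i) * U i k)) \<longrightarrow> (\<forall>i<\<mu>. c i = 0))"
  using assms
proof (induction \<mu> arbitrary: M)
  case 0
  show ?case by (rule exI[of _ "\<lambda>_ _. 0"]) auto
next
  case (Suc \<mu>)
  have "Determinant.det (fmat N (\<lambda>r k. fps_nth (M r k) 0)) = 0"
    using Suc.prems zero_less_Suc unfolding low_def det_fps_nth_0[symmetric] by blast
  then obtain v j where vj: "j < N" "v j \<noteq> 0" and v: "\<And>r. r < N \<Longrightarrow> (\<Sum>k<N. fps_nth (M r k) 0 * v k) = 0"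
    by (rule det_zero_kernel) blast
  define w where "w r = (\<Sum>k<N. M r k * fps_const (v k))" for r
  \<comment> \<open>The vector \<open>v\<close> kills the constant terms, so the combined column is
    divisible by \<open>fps_X\<close>; \<open>M'\<close> will carry the quotient in place of column
    \<open>j\<close>.\<close>
  define g where "g r = fps_shift 1 (w r)" for r
  have w: "w r = fps_X * g r" if "r < N" for r
  proof -
    have "fps_nth (w r) 0 = 0" using v[OF that] by (simp add: w_def fps_sum_nth)
    then show ?thesis
      unfolding g_def by (intro fps_ext) (auto simp: fps_X_mult_nth gr0_conv_Suc)
  qed
  define M' where "M' r k = (if k = j then g r else M r k)" for r k
  have "fmat N (\<lambda>r k. if k = j then (\<Sum>l<N. M r l * fps_const (v l)) else M r k)
      = fmat N (\<lambda>r k. if k = j then fps_X * g r else M r k)"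
    by (rule eq_matI) (auto simp: fmat_def w[unfolded w_def])
  note e = this
  have "fps_const (v j) * Determinant.det (fmat N M)
      = Determinant.det (fmat N (\<lambda>r k. if k = j then (\<Sum>l<N. M r l * fps_const (v l)) else M r k))"
    by (rule det_replace_col_mat_vec[OF vj(1), symmetric])
  also have "\<dots> = fps_X * Determinant.det (fmat N M')"
    unfolding e M'_def by (rule det_replace_col_mult[OF vj(1)])
  finally have "low (Suc \<mu>) (fps_X * Determinant.det (fmat N M'))"
    using low_mult[OF Suc.prems, of "fps_const (v j)"] by metis
  then have "low \<mu> (Determinant.det (fmat N M'))" by (simp add: low_Suc_X)
  from Suc.IH[OF this] obtain U where U: "\<And>i r. i < \<mu> \<Longrightarrow> r < N \<Longrightarrow> low \<mu> (\<Sum>k<N. M' r k * U i k)"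
    and ind: "\<And>c. (\<forall>k<N. low \<mu> (\<Sum>i<\<mu>. fps_const (c i) * U i k)) \<Longrightarrow> (\<forall>i<\<mu>. c i = 0)" by blast
  \<comment> \<open>Solutions for \<open>M'\<close> are pulled back along the column operation,
    which multiplies their images by \<open>fps_X\<close>. The one additional solution is the kernel
    vector itself, pushed to order \<open>\<mu>\<close>.\<close>
  define V where "V i k = (if i < \<mu> then (if k = j then 0 else fps_X * U i k) + fps_const (v k) * U i j
    else fps_X ^ \<mu> * fps_const (v k))" for i k
  have MV: "(\<Sum>k<N. M r k * V i k) = fps_X * (\<Sum>k<N. M' r k * U i k)" if "i < \<mu>" "r < N" for i r
  proof -
    have "(\<Sum>k<N. M r k * V i k) = (\<Sum>k<N. M r k * (if k = j then 0 else fps_X * U i k)) + w r * U i j"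
    proof -
      have "M r k * V i k = M r k * (if k = j then 0 else fps_X * U i k) + M r k * fps_const (v k) * U i j" for k
        using that(1) by (simp add: V_def algebra_simps)
      then show ?thesis by (simp only: sum.distrib w_def sum_distrib_right)
    qed
    also have "(\<Sum>k<N. M r k * (if k = j then 0 else fps_X * U i k)) = (\<Sum>k\<in>{..<N} - {j}. M r k * (fps_X * U i k))"
      by (subst sum.remove[of _ j]) (use vj in auto)
    also have "\<dots> = fps_X * (\<Sum>k\<in>{..<N} - {j}. M' r k * U i k)"
      unfolding sum_distrib_left by (intro sum.cong) (auto simp: M'_def algebra_simps)
    also have "w r * U i j = fps_X * (M' r j * U i j)" using w[OF that(2)] by (simp add: M'_def)
    also have "fps_X * (\<Sum>k\<in>{..<N} - {j}. M' r k * U i k) + fps_X * (M' r j * U i j) = fps_X * (\<Sum>k<N. M' r k * U i k)"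
      by (subst (2) sum.remove[of _ j]) (use vj in \<open>auto simp: algebra_simps\<close>)
    finally show ?thesis .
  qed
  have "low (Suc \<mu>) (\<Sum>k<N. M r k * V i k)" if "i < Suc \<mu>" "r < N" for i r
  proof (cases "i < \<mu>")
    case True
    then show ?thesis using MV[OF True that(2)] U that(2) by (simp add: low_Suc_X)
  next
    case False
    then have "(\<Sum>k<N. M r k * V i k) = fps_X ^ \<mu> * w r"
      by (simp add: V_def w_def sum_distrib_left algebra_simps)
    also have "\<dots> = fps_X * (fps_X ^ \<mu> * g r)" using w[OF that(2)] by (simp add: algebra_simps)
    finally show ?thesis using low_mult'[OF low_X_power] by (simp add: low_Suc_X)
  qed
  moreover have "c i = 0" if c: "\<And>k. k < N \<Longrightarrow> low (Suc \<mu>) (\<Sum>i<Suc \<mu>. fps_const (c i) * V i k)" and "i < Suc \<mu>" for c i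
  proof -
    define T where "T k = (\<Sum>i<\<mu>. fps_const (c i) * U i k)" for k
    \<comment> \<open>\<open>R\<close> collects all contributions along \<open>v\<close> and is read
      off in component \<open>j\<close>, where \<open>v j \<noteq> 0\<close>. Once it is known to
      have order \<open>Suc \<mu>\<close>, the other components reduce to the induction
      hypothesis.\<close>
    define R where "R = T j + fps_const (c \<mu>) * fps_X ^ \<mu>"
    have VT: "(\<Sum>i<Suc \<mu>. fps_const (c i) * V i k) = (if k = j then 0 else fps_X * T k) + fps_const (v k) * R" for k
    proof -
      have "(\<Sum>i<\<mu>. fps_const (c i) * V i k) = (\<Sum>i<\<mu>. (if k = j then 0 else fps_X * (fps_const (c i) * U i k))
          + fps_const (v k) * (fps_const (c i) * U i j))"
        by (intro sum.cong) (auto simp: V_def algebra_simps)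
      also have "\<dots> = (if k = j then 0 else fps_X * T k) + fps_const (v k) * T j"
        by (simp add: T_def sum.distrib sum_distrib_left)
      finally show ?thesis by (simp add: V_def R_def algebra_simps)
    qed
    have R: "low (Suc \<mu>) R" using c[OF vj(1)] vj(2) unfolding VT by (simp add: low_const_mult)
    have "low \<mu> (T k)" if "k < N" for k
    proof (cases "k = j")
      case True
      have "low \<mu> R" using R by (auto simp: low_def)
      moreover have "T j = R - fps_const (c \<mu>) * fps_X ^ \<mu>" by (simp add: R_def)
      ultimately show ?thesis using True low_mult[OF low_X_power] low_diff by metis
    next
      case False
      have "fps_X * T k = (\<Sum>i<Suc \<mu>. fps_const (c i) * V i k) - fps_const (v k) * R" using False VT[of k] by simp
      then have "low (Suc \<mu>) (fps_X * T k)" using c[OF that] low_mult[OF R] low_diff by metis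
      then show ?thesis by (simp add: low_Suc_X)
    qed
    then have ci: "\<forall>i<\<mu>. c i = 0" using ind unfolding T_def by blast
    then have "T j = 0" by (simp add: T_def)
    then have "fps_nth R \<mu> = c \<mu>" by (simp add: R_def)
    then have "c \<mu> = 0" using R by (simp add: low_def)
    then show ?thesis using ci \<open>i < Suc \<mu>\<close> by (auto simp: less_Suc_eq)
  qed
  ultimately show ?case by blast
qed

section \<open>From the Fisher graph to gates\<close>

text \<open>The rows of the kernel equation on the covering lattice, with the weights
  \<open>1\<close> inserted. The factors of the \<open>z\<close>- and \<open>w\<close>-edges are
  absent because they move into the quasiperiodicity of the functions.\<close>

definition fisher_solution :: "(int \<Rightarrow> int \<Rightarrow> real) \<Rightarrow> (int \<Rightarrow> int \<Rightarrow> real) \<Rightarrow>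
    (edge_kind \<Rightarrow> int \<Rightarrow> int \<Rightarrow> complex) \<Rightarrow> (edge_kind \<Rightarrow> int \<Rightarrow> int \<Rightarrow> complex) \<Rightarrow> bool" where
  "fisher_solution B C \<beta> \<omega> \<longleftrightarrow> (\<forall>i j.
     \<beta> Kind_b i j - \<beta> Kind_c i j + \<omega> Kind_a i j = 0 \<and>
     \<beta> Kind_c i j - \<beta> Kind_a i j + B i j * \<omega> Kind_b (i + 1) j = 0 \<and>
     \<beta> Kind_a i j - \<beta> Kind_b i j + C i j * \<omega> Kind_c i (j + 1) = 0 \<and>
     \<omega> Kind_b i j - \<omega> Kind_c i j - \<beta> Kind_a i j = 0 \<and>
     \<omega> Kind_c i j - \<omega> Kind_a i j - B (i - 1) j * \<beta> Kind_b (i - 1) j = 0 \<and>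
     \<omega> Kind_a i j - \<omega> Kind_b i j - C i (j - 1) * \<beta> Kind_c i (j - 1) = 0)"

text \<open>Signs alternating with the row make both coefficients of every gate positive; the price
  is the sign \<open>parity_sign m\<close> in the vertical multiplier.\<close>

definition parity_sign :: "int \<Rightarrow> real" where
  "parity_sign j = (if even j then 1 else - 1)"

lemma parity_sign_add1: "parity_sign (j + 1) = - parity_sign j"
  by (simp add: parity_sign_def)

lemma parity_sign_add: "parity_sign (j + k) = parity_sign j * parity_sign k"
  by (simp add: parity_sign_def)

text \<open>The gates are the \<open>b\<close>- and \<open>c\<close>-edges of the underlying square lattice: the light-cone point
  \<open>(i + j, j - i)\<close> is the \<open>b\<close>-edge from \<open>(i, j)\<close> to \<open>(i + 1, j)\<close> and \<open>(i + j, j - i + 1)\<close> is the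
  \<open>c\<close>-edge from \<open>(i, j)\<close> to \<open>(i, j + 1)\<close>. The lines between them are the corners at the sites.\<close>

definition cell_i :: "int \<Rightarrow> int \<Rightarrow> int" where "cell_i a b = (a - b + 1) div 2"
definition cell_j :: "int \<Rightarrow> int \<Rightarrow> int" where "cell_j a b = (a + b) div 2"

lemma cell_b_edge: "cell_i (i + j) (j - i) = i" "cell_j (i + j) (j - i) = j" "even ((i + j) + (j - i) :: int)"
  by (simp_all add: cell_i_def cell_j_def)

lemma cell_c_edge: "cell_i (i + j) (j - i + 1) = i" "cell_j (i + j) (j - i + 1) = j" "odd ((i + j) + (j - i + 1) :: int)"
proof -
  have "i + j - (j - i + 1) + 1 = 2 * i" "i + j + (j - i + 1) = 1 + j * 2" by simp_all
  then show "cell_i (i + j) (j - i + 1) = i" "cell_j (i + j) (j - i + 1) = j" "odd ((i + j) + (j - i + 1) :: int)"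
    by (simp_all add: cell_i_def cell_j_def)
qed

lemma light_cone_cases:
  obtains (b_edge) i j where "a = i + j" "b = j - i" | (c_edge) i j where "a = i + j" "b = j - i + (1::int)"
proof (cases "even (a + b)")
  case True
  then obtain j where "a + b = 2 * j" by (rule evenE)
  then have "a = (a - j) + j" "b = j - (a - j)" by simp_all
  then show ?thesis using b_edge by blast
next
  case False
  then obtain j where "a + b = 2 * j + 1" by (rule oddE)
  then have "a = (a - j) + j" "b = j - (a - j) + 1" by simp_all
  then show ?thesis using c_edge by blast
qed

text \<open>Hyperbolic cosines: \<open>cosh (2 * u)\<close> for \<open>B i j = tanh u\<close> and
  \<open>cosh u\<close> for \<open>C i j = exp (- u)\<close>; \<open>gate_s\<close> has the matching
  hyperbolic sines, positive because the weights lie strictly between \<open>0\<close> and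
  \<open>1\<close>.\<close>

definition gate_c :: "(int \<Rightarrow> int \<Rightarrow> real) \<Rightarrow> (int \<Rightarrow> int \<Rightarrow> real) \<Rightarrow> int \<Rightarrow> int \<Rightarrow> real" where
  "gate_c B C a b = (let i = cell_i a b; j = cell_j a b in
     if even (a + b) then (1 + (B i j)\<^sup>2) / (1 - (B i j)\<^sup>2) else (1 + (C i j)\<^sup>2) / (2 * C i j))"

definition gate_s :: "(int \<Rightarrow> int \<Rightarrow> real) \<Rightarrow> (int \<Rightarrow> int \<Rightarrow> real) \<Rightarrow> int \<Rightarrow> int \<Rightarrow> real" where
  "gate_s B C a b = (let i = cell_i a b; j = cell_j a b in
     if even (a + b) then 2 * B i j / (1 - (B i j)\<^sup>2) else (1 - (C i j)\<^sup>2) / (2 * C i j))"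

text \<open>Together with \<open>corner_y\<close> these are the four signed combinations of the ends
  of a \<open>b\<close>-edge. The kernel equations at a site express each of them through the ends
  of a \<open>c\<close>-edge as well, which links consecutive gates.\<close>

definition corner_x :: "(int \<Rightarrow> int \<Rightarrow> real) \<Rightarrow> (edge_kind \<Rightarrow> int \<Rightarrow> int \<Rightarrow> complex) \<Rightarrow> (edge_kind \<Rightarrow> int \<Rightarrow> int \<Rightarrow> complex) \<Rightarrow>
    int \<Rightarrow> int \<Rightarrow> complex" where
  "corner_x B \<beta> \<omega> a b = (let i = cell_i a b; j = cell_j a b in
     if even (a + b) then of_real (parity_sign j) * (\<beta> Kind_b i j + of_real (B i j) * \<omega> Kind_b (i + 1) j)
     else - complex_of_real (parity_sign j) * (\<omega> Kind_b i j - of_real (B (i - 1) j) * \<beta> Kind_b (i - 1) j))"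

definition corner_y :: "(int \<Rightarrow> int \<Rightarrow> real) \<Rightarrow> (edge_kind \<Rightarrow> int \<Rightarrow> int \<Rightarrow> complex) \<Rightarrow> (edge_kind \<Rightarrow> int \<Rightarrow> int \<Rightarrow> complex) \<Rightarrow>
    int \<Rightarrow> int \<Rightarrow> complex" where
  "corner_y B \<beta> \<omega> a b = (let i = cell_i a b; j = cell_j a b in
     if even (a + b) then - complex_of_real (parity_sign j) * (\<omega> Kind_b (i + 1) j + of_real (B i j) * \<beta> Kind_b i j)
     else of_real (parity_sign j) * (\<beta> Kind_b i j - of_real (B i j) * \<omega> Kind_b (i + 1) j))"

locale fisher_weights =
  fixes B C :: "int \<Rightarrow> int \<Rightarrow> real"
  assumes B01: "0 < B i j" "B i j < 1" and C01: "0 < C i j" "C i j < 1"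
begin

lemma B_sq: "(B i j)\<^sup>2 < 1" and C_sq: "(C i j)\<^sup>2 < 1"
  using B01[of i j] C01[of i j] by (simp_all add: power_less_one_iff)

lemma gates: "gates (gate_c B C) (gate_s B C)"
proof
  fix a b
  show "gate_c B C a b > 0" "gate_s B C a b > 0"
    using B01 C01 B_sq C_sq by (auto simp: gate_c_def gate_s_def Let_def intro!: divide_pos_pos add_pos_nonneg mult_pos_pos)
  let ?B = "B (cell_i a b) (cell_j a b)" and ?C = "C (cell_i a b) (cell_j a b)"
  have "1 - ?B\<^sup>2 \<noteq> 0" "?C \<noteq> 0" using B_sq[of "cell_i a b" "cell_j a b"] C01[of "cell_i a b" "cell_j a b"] by auto
  then have "((1 + ?B\<^sup>2) / (1 - ?B\<^sup>2))\<^sup>2 = 1 + (2 * ?B / (1 - ?B\<^sup>2))\<^sup>2"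
      "((1 + ?C\<^sup>2) / (2 * ?C))\<^sup>2 = 1 + ((1 - ?C\<^sup>2) / (2 * ?C))\<^sup>2"
    by (simp_all add: power_divide add_divide_eq_iff divide_simps) (simp_all add: power2_eq_square algebra_simps)
  then show "(gate_c B C a b)\<^sup>2 = 1 + (gate_s B C a b)\<^sup>2"
    by (simp add: gate_c_def gate_s_def Let_def)
qed

lemma gate_b_edge: "gate_c B C (i + j) (j - i) = (1 + (B i j)\<^sup>2) / (1 - (B i j)\<^sup>2)"
    "gate_s B C (i + j) (j - i) = 2 * B i j / (1 - (B i j)\<^sup>2)"
  by (simp_all add: gate_c_def gate_s_def cell_b_edge Let_def del: add_diff_cancel)

lemma gate_c_edge: "gate_c B C (i + j) (j - i + 1) = (1 + (C i j)\<^sup>2) / (2 * C i j)"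
    "gate_s B C (i + j) (j - i + 1) = (1 - (C i j)\<^sup>2) / (2 * C i j)"
  using cell_c_edge(3)[of i j] by (simp_all add: gate_c_def gate_s_def cell_c_edge Let_def)

lemma corner_b_edge:
  fixes \<beta> \<omega> :: "edge_kind \<Rightarrow> int \<Rightarrow> int \<Rightarrow> complex"
  shows "corner_x B \<beta> \<omega> (i + j) (j - i) = parity_sign j * (\<beta> Kind_b i j + B i j * \<omega> Kind_b (i + 1) j)"
  "corner_y B \<beta> \<omega> (i + j) (j - i) = - complex_of_real (parity_sign j) * (\<omega> Kind_b (i + 1) j + B i j * \<beta> Kind_b i j)"
  by (simp_all add: corner_x_def corner_y_def cell_b_edge Let_def)

lemma corner_c_edge:
  fixes \<beta> \<omega> :: "edge_kind \<Rightarrow> int \<Rightarrow> int \<Rightarrow> complex"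
  shows "corner_x B \<beta> \<omega> (i + j) (j - i + 1) = - complex_of_real (parity_sign j) * (\<omega> Kind_b i j - B (i - 1) j * \<beta> Kind_b (i - 1) j)"
  "corner_y B \<beta> \<omega> (i + j) (j - i + 1) = parity_sign j * (\<beta> Kind_b i j - B i j * \<omega> Kind_b (i + 1) j)"
  using cell_c_edge(3)[of i j] by (simp_all add: corner_x_def corner_y_def cell_c_edge Let_def)

text \<open>Eliminating the two \<open>a\<close>-vertices from the six equations at a site leaves
  one relation for each of its four corners.\<close>

lemma corner_relations:
  fixes \<beta> \<omega> :: "edge_kind \<Rightarrow> int \<Rightarrow> int \<Rightarrow> complex"
  assumes "fisher_solution B C \<beta> \<omega>"
  shows "\<beta> Kind_b i j - B i j * \<omega> Kind_b (i + 1) j = \<beta> Kind_c i j + C i j * \<omega> Kind_c i (j + 1)"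
    "\<omega> Kind_b i j - B (i - 1) j * \<beta> Kind_b (i - 1) j = \<beta> Kind_c i j - C i j * \<omega> Kind_c i (j + 1)"
    "\<omega> Kind_b i j + B (i - 1) j * \<beta> Kind_b (i - 1) j = \<omega> Kind_c i j - C i (j - 1) * \<beta> Kind_c i (j - 1)"
    "\<beta> Kind_b i j + B i j * \<omega> Kind_b (i + 1) j = - (\<omega> Kind_c i j + C i (j - 1) * \<beta> Kind_c i (j - 1))"
proof -
  have alg: "bb - P = bc + Q \<and> ob - R = bc - Q \<and> ob + R = oc - S \<and> bb + P = - (oc + S)"
    if e: "bb - bc + oa = 0 \<and> bc - ba + P = 0 \<and> ba - bb + Q = 0 \<and> ob - oc - ba = 0 \<and> oc - oa - R = 0 \<and> oa - ob - S = 0"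
    for bb bc oa ba P Q ob oc R S :: complex
    using e unfolding complex_eq_iff minus_complex.sel plus_complex.sel uminus_complex.sel zero_complex.sel
    by (intro conjI; elim conjE; linarith)
  show "\<beta> Kind_b i j - B i j * \<omega> Kind_b (i + 1) j = \<beta> Kind_c i j + C i j * \<omega> Kind_c i (j + 1)"
    "\<omega> Kind_b i j - B (i - 1) j * \<beta> Kind_b (i - 1) j = \<beta> Kind_c i j - C i j * \<omega> Kind_c i (j + 1)"
    "\<omega> Kind_b i j + B (i - 1) j * \<beta> Kind_b (i - 1) j = \<omega> Kind_c i j - C i (j - 1) * \<beta> Kind_c i (j - 1)"
    "\<beta> Kind_b i j + B i j * \<omega> Kind_b (i + 1) j = - (\<omega> Kind_c i j + C i (j - 1) * \<beta> Kind_c i (j - 1))"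
    using alg[OF assms[unfolded fisher_solution_def, rule_format, of i j]] by blast+
qed

lemma eq_sum_of_quotients: "d \<noteq> 0 \<Longrightarrow> d * X = A * P + D * Q \<Longrightarrow> X = A / d * P + D / d * Q" for d :: complex
  by (simp add: divide_simps mult.commute)

lemma b_gate_algebra:
  fixes p q e :: complex and t :: real
  assumes "0 < t" "t < 1"
  shows "e * (p - t * q) = of_real ((1 + t\<^sup>2) / (1 - t\<^sup>2)) * (e * (p + t * q)) + of_real (2 * t / (1 - t\<^sup>2)) * (- e * (q + t * p))"
    "- e * (q - t * p) = of_real (2 * t / (1 - t\<^sup>2)) * (e * (p + t * q)) + of_real ((1 + t\<^sup>2) / (1 - t\<^sup>2)) * (- e * (q + t * p))"
proof -
  have "t\<^sup>2 < 1" using assms by (simp add: power_less_one_iff)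
  then have "1 - t\<^sup>2 \<noteq> 0" by simp
  then have d: "(1 - (of_real t)\<^sup>2 :: complex) \<noteq> 0"
    by (metis of_real_1 of_real_diff of_real_eq_0_iff of_real_power)
  have alg: "e * (p - u * q) = (1 + u\<^sup>2) / d * (e * (p + u * q)) + 2 * u / d * (- e * (q + u * p))"
     "- e * (q - u * p) = 2 * u / d * (e * (p + u * q)) + (1 + u\<^sup>2) / d * (- e * (q + u * p))"
    if "d \<noteq> 0" "d = 1 - u\<^sup>2" for d u :: complex
  proof -
    have "d * (e * (p - u * q)) = (1 + u\<^sup>2) * (e * (p + u * q)) + 2 * u * (- e * (q + u * p))"
      "d * (- e * (q - u * p)) = 2 * u * (e * (p + u * q)) + (1 + u\<^sup>2) * (- e * (q + u * p))"
      unfolding that(2) by (simp_all add: algebra_simps power2_eq_square)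
    then show "e * (p - u * q) = (1 + u\<^sup>2) / d * (e * (p + u * q)) + 2 * u / d * (- e * (q + u * p))"
     "- e * (q - u * p) = 2 * u / d * (e * (p + u * q)) + (1 + u\<^sup>2) / d * (- e * (q + u * p))"
      using that(1) eq_sum_of_quotients by blast+
  qed
  show "e * (p - t * q) = of_real ((1 + t\<^sup>2) / (1 - t\<^sup>2)) * (e * (p + t * q)) + of_real (2 * t / (1 - t\<^sup>2)) * (- e * (q + t * p))"
    "- e * (q - t * p) = of_real (2 * t / (1 - t\<^sup>2)) * (e * (p + t * q)) + of_real ((1 + t\<^sup>2) / (1 - t\<^sup>2)) * (- e * (q + t * p))"
    using alg[OF d refl] by simp_all
qed

lemma c_gate_algebra:
  fixes p q e :: complex and t :: real
  assumes "0 < t"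
  shows "e * (q - t * p) = of_real ((1 + t\<^sup>2) / (2 * t)) * (- e * (p - t * q)) + of_real ((1 - t\<^sup>2) / (2 * t)) * (e * (p + t * q))"
    "e * (q + t * p) = of_real ((1 - t\<^sup>2) / (2 * t)) * (- e * (p - t * q)) + of_real ((1 + t\<^sup>2) / (2 * t)) * (e * (p + t * q))"
proof -
  have alg: "e * (q - u * p) = (1 + u\<^sup>2) / (2 * u) * (- e * (p - u * q)) + (1 - u\<^sup>2) / (2 * u) * (e * (p + u * q))"
     "e * (q + u * p) = (1 - u\<^sup>2) / (2 * u) * (- e * (p - u * q)) + (1 + u\<^sup>2) / (2 * u) * (e * (p + u * q))"
    if "u \<noteq> 0" for u :: complex
  proof -
    have "2 * u * (e * (q - u * p)) = (1 + u\<^sup>2) * (- e * (p - u * q)) + (1 - u\<^sup>2) * (e * (p + u * q))"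
     "2 * u * (e * (q + u * p)) = (1 - u\<^sup>2) * (- e * (p - u * q)) + (1 + u\<^sup>2) * (e * (p + u * q))"
      by (simp_all add: algebra_simps power2_eq_square)
    moreover have "2 * u \<noteq> 0" using that by simp
    ultimately show "e * (q - u * p) = (1 + u\<^sup>2) / (2 * u) * (- e * (p - u * q)) + (1 - u\<^sup>2) / (2 * u) * (e * (p + u * q))"
     "e * (q + u * p) = (1 - u\<^sup>2) / (2 * u) * (- e * (p - u * q)) + (1 + u\<^sup>2) / (2 * u) * (e * (p + u * q))"
      using eq_sum_of_quotients by blast+
  qed
  have "of_real t \<noteq> (0::complex)" using assms by simp
  from alg[OF this]
  show "e * (q - t * p) = of_real ((1 + t\<^sup>2) / (2 * t)) * (- e * (p - t * q)) + of_real ((1 - t\<^sup>2) / (2 * t)) * (e * (p + t * q))"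
    "e * (q + t * p) = of_real ((1 - t\<^sup>2) / (2 * t)) * (- e * (p - t * q)) + of_real ((1 + t\<^sup>2) / (2 * t)) * (e * (p + t * q))"
    by simp_all
qed

text \<open>At a \<open>b\<close>-edge inputs and outputs are combinations of the same two values,
  so the gate equations are identities. At a \<open>c\<close>-edge they become so after rewriting
  the four corners by \<open>corner_relations\<close>.\<close>

lemma corner_gate_solution:
  fixes \<beta> \<omega> :: "edge_kind \<Rightarrow> int \<Rightarrow> int \<Rightarrow> complex"
  assumes "fisher_solution B C \<beta> \<omega>"
  shows "gate_solution (gate_c B C) (gate_s B C) (corner_x B \<beta> \<omega>) (corner_y B \<beta> \<omega>)"
  unfolding gate_solution_def
proof (intro allI)
  fix a b
  let ?x = "corner_x B \<beta> \<omega>" and ?y = "corner_y B \<beta> \<omega>" and ?c = "gate_c B C" and ?s = "gate_s B C"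
  show "?y a (b + 1) = ?c a b *\<^sub>R ?x a b + ?s a b *\<^sub>R ?y a b \<and> ?x (a + 1) b = ?s a b *\<^sub>R ?x a b + ?c a b *\<^sub>R ?y a b"
  proof (cases a b rule: light_cone_cases)
    case (b_edge i j)
    let ?p = "\<beta> Kind_b i j" and ?q = "\<omega> Kind_b (i + 1) j"
    have y': "?y a (b + 1) = parity_sign j * (?p - B i j * ?q)"
      using corner_c_edge(2)[of \<beta> \<omega> i j] b_edge by simp
    have X: "?x A' B' = - complex_of_real (parity_sign j) * (?q - B i j * ?p)" if "A' = (i + 1) + j" "B' = j - (i + 1) + 1" for A' B'
      unfolding that corner_c_edge by simp
    have x': "?x (a + 1) b = - complex_of_real (parity_sign j) * (?q - B i j * ?p)"
      by (rule X) (use b_edge in simp_all)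
    have cc: "?c a b = (1 + (B i j)\<^sup>2) / (1 - (B i j)\<^sup>2)" and ss: "?s a b = 2 * B i j / (1 - (B i j)\<^sup>2)"
      unfolding b_edge by (rule gate_b_edge)+
    have x: "?x a b = parity_sign j * (?p + B i j * ?q)" and y: "?y a b = - complex_of_real (parity_sign j) * (?q + B i j * ?p)"
      unfolding b_edge by (rule corner_b_edge)+
    show ?thesis
      unfolding x y x' y' cc ss scaleR_conv_of_real
      by (intro conjI b_gate_algebra B01)
  next
    case (c_edge i j)
    let ?p = "\<beta> Kind_c i j" and ?q = "\<omega> Kind_c i (j + 1)"
    note R = corner_relations[OF assms]
    have y: "?y a b = parity_sign j * (?p + C i j * ?q)"
      using corner_c_edge(2)[of \<beta> \<omega> i j] R(1)[of i j] c_edge by simp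
    have x: "?x a b = - complex_of_real (parity_sign j) * (?p - C i j * ?q)"
      using corner_c_edge(1)[of \<beta> \<omega> i j] R(2)[of i j] c_edge by simp
    have "?y A' B' = parity_sign j * (\<omega> Kind_b i (j + 1) + B (i - 1) (j + 1) * \<beta> Kind_b (i - 1) (j + 1))"
      if "A' = (i - 1) + (j + 1)" "B' = (j + 1) - (i - 1)" for A' B'
      unfolding that corner_b_edge by (simp add: parity_sign_add1)
    then have y': "?y a (b + 1) = parity_sign j * (?q - C i j * ?p)"
      using R(3)[of i "j + 1"] c_edge by simp
    have X: "?x A' B' = - complex_of_real (parity_sign j) * (\<beta> Kind_b i (j + 1) + B i (j + 1) * \<omega> Kind_b (i + 1) (j + 1))"
      if "A' = i + (j + 1)" "B' = (j + 1) - i" for A' B'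
      unfolding that corner_b_edge by (simp add: parity_sign_add1)
    have "?x (a + 1) b = - complex_of_real (parity_sign j) * (\<beta> Kind_b i (j + 1) + B i (j + 1) * \<omega> Kind_b (i + 1) (j + 1))"
      by (rule X) (use c_edge in simp_all)
    then have x': "?x (a + 1) b = parity_sign j * (?q + C i j * ?p)"
      unfolding R(4)[of i "j + 1"] by (simp add: algebra_simps)
    have cc: "?c a b = (1 + (C i j)\<^sup>2) / (2 * C i j)" and ss: "?s a b = (1 - (C i j)\<^sup>2) / (2 * C i j)"
      unfolding c_edge by (rule gate_c_edge)+
    show ?thesis
      unfolding x y x' y' cc ss scaleR_conv_of_real
      by (intro conjI c_gate_algebra C01)
  qed
qed

text \<open>The corners determine the Fisher solution, so independence survives the passage to
  gates: sums and differences of the weighted ends of an edge vanish, hence both ends do, and the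
  \<open>a\<close>-vertices follow from the equations.\<close>

lemma corner_eq_0:
  fixes \<beta> \<omega> :: "edge_kind \<Rightarrow> int \<Rightarrow> int \<Rightarrow> complex"
  assumes sol: "fisher_solution B C \<beta> \<omega>"
    and x0: "\<And>a b. corner_x B \<beta> \<omega> a b = 0" and y0: "\<And>a b. corner_y B \<beta> \<omega> a b = 0"
  shows "\<beta> s i j = 0 \<and> \<omega> s i j = 0"
proof -
  have ps: "of_real (parity_sign j) \<noteq> (0::complex)" for j by (simp add: parity_sign_def)
  have nz: "of_real (B i j) \<noteq> (0::complex)" "of_real (C i j) \<noteq> (0::complex)" for i j
    using B01[of i j] C01[of i j] by auto
  note R = corner_relations[OF sol]
  have 1: "\<beta> Kind_b i j + B i j * \<omega> Kind_b (i + 1) j = 0" "\<beta> Kind_b i j - B i j * \<omega> Kind_b (i + 1) j = 0"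
    "\<omega> Kind_b i j - B (i - 1) j * \<beta> Kind_b (i - 1) j = 0" for i j
    using x0[of "i + j" "j - i"] y0[of "i + j" "j - i + 1"] x0[of "i + j" "j - i + 1"] ps[of j]
    by (auto simp: corner_b_edge corner_c_edge)
  have bb: "\<beta> Kind_b i j = 0" for i j
  proof -
    show ?thesis using 1(1,2)[of i j] unfolding complex_eq_iff by simp
  qed
  have ob: "\<omega> Kind_b i j = 0" for i j using 1(3)[of i j] bb by simp
  have 2: "\<beta> Kind_c i j + C i j * \<omega> Kind_c i (j + 1) = 0" "\<beta> Kind_c i j - C i j * \<omega> Kind_c i (j + 1) = 0" for i j
    using R(1)[of i j] R(2)[of i j] bb ob by simp_all
  have bc: "\<beta> Kind_c i j = 0" for i j
  proof -
    show ?thesis using 2[of i j] unfolding complex_eq_iff by simp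
  qed
  have oc: "\<omega> Kind_c i j = 0" for i j
    using 2(1)[of i "j - 1"] bc nz by simp
  have "\<omega> Kind_a i j = 0" "\<beta> Kind_a i j = 0"
    using sol bb bc ob oc unfolding fisher_solution_def by (metis add_0 diff_0_right diff_self eq_iff_diff_eq_0)+
  then show ?thesis using bb bc ob oc by (cases s) auto
qed

text \<open>A step \<open>(k, l)\<close> between sites is a step \<open>(k + l, l - k)\<close> in
  light-cone coordinates. The inhomogeneous terms \<open>\<beta>'\<close>, \<open>\<omega>'\<close>
  let one computation serve exact multipliers and Jordan chains alike.\<close>

lemma corner_shift:
  fixes \<beta> \<omega> \<beta>' \<omega>' :: "edge_kind \<Rightarrow> int \<Rightarrow> int \<Rightarrow> complex"
  assumes "\<And>s i j. \<beta> s (i + k) (j + l) = z * \<beta> s i j + \<beta>' s i j" "\<And>s i j. \<omega> s (i + k) (j + l) = z * \<omega> s i j + \<omega>' s i j"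
    and per: "\<And>i j. B (i + k) (j + l) = B i j"
  shows "corner_x B \<beta> \<omega> (a + k + l) (b - k + l) = parity_sign l * (z * corner_x B \<beta> \<omega> a b + corner_x B \<beta>' \<omega>' a b)"
    "corner_y B \<beta> \<omega> (a + k + l) (b - k + l) = parity_sign l * (z * corner_y B \<beta> \<omega> a b + corner_y B \<beta>' \<omega>' a b)"
proof -
  have s: "\<beta> s (i + k + 1) (j + l) = z * \<beta> s (i + 1) j + \<beta>' s (i + 1) j" "\<omega> s (i + k + 1) (j + l) = z * \<omega> s (i + 1) j + \<omega>' s (i + 1) j"
    "\<beta> s (i + k - 1) (j + l) = z * \<beta> s (i - 1) j + \<beta>' s (i - 1) j" "\<omega> s (i + k - 1) (j + l) = z * \<omega> s (i - 1) j + \<omega>' s (i - 1) j"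
    "B (i + k - 1) (j + l) = B (i - 1) j" for s i j
    using assms(1)[of s "i + 1" j] assms(2)[of s "i + 1" j] assms(1)[of s "i - 1" j] assms(2)[of s "i - 1" j] per[of "i - 1" j]
    by (simp_all add: algebra_simps)
  have "corner_x B \<beta> \<omega> (a + k + l) (b - k + l) = parity_sign l * (z * corner_x B \<beta> \<omega> a b + corner_x B \<beta>' \<omega>' a b) \<and>
    corner_y B \<beta> \<omega> (a + k + l) (b - k + l) = parity_sign l * (z * corner_y B \<beta> \<omega> a b + corner_y B \<beta>' \<omega>' a b)"
  proof (cases a b rule: light_cone_cases)
    case (b_edge i j)
    have e: "a + k + l = (i + k) + (j + l)" "b - k + l = (j + l) - (i + k)" using b_edge by simp_all
    show ?thesis unfolding e corner_b_edge unfolding b_edge corner_b_edge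
      by (simp add: assms s per parity_sign_add) (simp add: algebra_simps)
  next
    case (c_edge i j)
    have e: "a + k + l = (i + k) + (j + l)" "b - k + l = (j + l) - (i + k) + 1" using c_edge by simp_all
    show ?thesis unfolding e corner_c_edge unfolding c_edge corner_c_edge
      by (simp add: assms s per parity_sign_add) (simp add: algebra_simps)
  qed
  then show "corner_x B \<beta> \<omega> (a + k + l) (b - k + l) = parity_sign l * (z * corner_x B \<beta> \<omega> a b + corner_x B \<beta>' \<omega>' a b)"
    "corner_y B \<beta> \<omega> (a + k + l) (b - k + l) = parity_sign l * (z * corner_y B \<beta> \<omega> a b + corner_y B \<beta>' \<omega>' a b)" by simp_all
qed

lemma gate_shift:
  assumes per: "\<And>i j. B (i + k) (j + l) = B i j" "\<And>i j. C (i + k) (j + l) = C i j"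
  shows "gate_c B C (a + k + l) (b - k + l) = gate_c B C a b" "gate_s B C (a + k + l) (b - k + l) = gate_s B C a b"
proof -
  have "gate_c B C (a + k + l) (b - k + l) = gate_c B C a b \<and> gate_s B C (a + k + l) (b - k + l) = gate_s B C a b"
  proof (cases a b rule: light_cone_cases)
    case (b_edge i j)
    have e: "a + k + l = (i + k) + (j + l)" "b - k + l = (j + l) - (i + k)" using b_edge by simp_all
    show ?thesis unfolding e gate_b_edge unfolding b_edge gate_b_edge by (simp add: per)
  next
    case (c_edge i j)
    have e: "a + k + l = (i + k) + (j + l)" "b - k + l = (j + l) - (i + k) + 1" using c_edge by simp_all
    show ?thesis unfolding e gate_c_edge unfolding c_edge gate_c_edge by (simp add: per)
  qed
  then show "gate_c B C (a + k + l) (b - k + l) = gate_c B C a b" "gate_s B C (a + k + l) (b - k + l) = gate_s B C a b"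
    by simp_all
qed

end

section \<open>Lifting kernel vectors to the covering lattice\<close>

text \<open>The vertical multiplier becomes a power series;
  \<open>\<Omega> = fps_const w + fps_X\<close> expands the matrix around the second coordinate of a
  zero.\<close>

definition fps_factor :: "nat \<Rightarrow> nat \<Rightarrow> complex \<Rightarrow> complex fps \<Rightarrow> vertex \<times> vertex \<Rightarrow> complex fps" where
  "fps_factor m n z \<Omega> e = (if e \<in> z_edges m n then fps_const z else if e \<in> w_edges m n then \<Omega> else 1)"

definition fps_entry :: "nat \<Rightarrow> nat \<Rightarrow> (vertex \<times> vertex \<Rightarrow> real) \<Rightarrow> complex \<Rightarrow> complex fps \<Rightarrow> vertex \<Rightarrow> vertex \<Rightarrow> complex fps" where
  "fps_entry m n W z \<Omega> u v =
     (if (u, v) \<in> oriented_edges m n then fps_const (of_real (W (u, v))) * fps_factor m n z \<Omega> (u, v)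
      else if (v, u) \<in> oriented_edges m n
        then - (fps_const (of_real (W (v, u))) * inverse (fps_factor m n z \<Omega> (v, u)))
      else 0)"

lemma truncated_vertex_kernel:
  fixes E :: "vertex \<Rightarrow> vertex \<Rightarrow> complex fps"
  fixes m n :: nat
  defines "L \<equiv> fisher_vertices m n"
  assumes "low \<mu> (Determinant.det (fmat (6 * m * n) (\<lambda>r k. E (L ! r) (L ! k))))"
  shows "\<exists>u. (\<forall>i<\<mu>. \<forall>v\<in>set L. low \<mu> (\<Sum>v'\<in>set L. E v v' * u i v')) \<and>
    (\<forall>c. (\<forall>v\<in>set L. low \<mu> (\<Sum>i<\<mu>. fps_const (c i) * u i v)) \<longrightarrow> (\<forall>i<\<mu>. c i = 0))"
proof -
  let ?N = "6 * m * n"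
  have bij: "bij_betw ((!) L) {..<?N} (set L)"
    unfolding L_def by (rule bij_betw_nth) (simp_all add: distinct_fisher_vertices length_fisher_vertices)
  define pos where "pos = the_inv_into {..<?N} ((!) L)"
  have pos: "pos (L ! k) = k" if "k < ?N" for k
    unfolding pos_def using bij that by (simp add: the_inv_into_f_f bij_betw_def)
  have surj: "\<exists>k<?N. v = L ! k" if "v \<in> set L" for v
    using that bij by (auto simp: bij_betw_def)
  from truncated_kernel[OF assms(2)] obtain U where
    U: "\<And>i r. i < \<mu> \<Longrightarrow> r < ?N \<Longrightarrow> low \<mu> (\<Sum>k<?N. E (L ! r) (L ! k) * U i k)"
    and ind: "\<And>c. \<forall>k<?N. low \<mu> (\<Sum>i<\<mu>. fps_const (c i) * U i k) \<Longrightarrow> \<forall>i<\<mu>. c i = 0"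
    by blast
  have "low \<mu> (\<Sum>v'\<in>set L. E v v' * U i (pos v'))" if i: "i < \<mu>" and v: "v \<in> set L" for i v
  proof -
    obtain r where r: "r < ?N" "v = L ! r" using surj[OF v] by blast
    have "(\<Sum>v'\<in>set L. E v v' * U i (pos v')) = (\<Sum>k<?N. E v (L ! k) * U i (pos (L ! k)))"
      using sum.reindex_bij_betw[OF bij, of "\<lambda>v'. E v v' * U i (pos v')"] by simp
    also have "\<dots> = (\<Sum>k<?N. E v (L ! k) * U i k)" by (intro sum.cong) (simp_all add: pos)
    finally show ?thesis using U[OF i r(1)] r(2) by simp
  qed
  moreover have "\<forall>i<\<mu>. c i = 0" if "\<forall>v\<in>set L. low \<mu> (\<Sum>i<\<mu>. fps_const (c i) * U i (pos v))" for c
  proof (rule ind, intro allI impI)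
    fix k assume k: "k < ?N"
    then have "L ! k \<in> set L" using bij by (auto simp: bij_betw_def)
    then have "low \<mu> (\<Sum>i<\<mu>. fps_const (c i) * U i (pos (L ! k)))" using that by blast
    then show "low \<mu> (\<Sum>i<\<mu>. fps_const (c i) * U i k)" using pos[OF k] by simp
  qed
  ultimately show ?thesis by (intro exI[of _ "\<lambda>i v. U i (pos v)"]) blast
qed

text \<open>The Fisher graph is cubic: each row of the Kasteleyn matrix is supported on three
  vertices, which are distinct even on the torus of size one by one.\<close>

lemma sum_three:
  fixes g u :: "'a \<Rightarrow> 'b::comm_ring_1"
  assumes "finite S" "p \<in> S" "q \<in> S" "r \<in> S" "p \<noteq> q" "p \<noteq> r" "q \<noteq> r"
    and "\<And>v. v \<in> S \<Longrightarrow> g v = (if v = p then a else if v = q then b else if v = r then c else 0)"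
  shows "(\<Sum>v\<in>S. g v * u v) = a * u p + b * u q + c * u r"
proof -
  have "(\<Sum>v\<in>S. g v * u v) = (\<Sum>v\<in>{p, q, r}. g v * u v)"
    by (rule sum.mono_neutral_right) (use assms in auto)
  then show ?thesis using assms by (simp add: add.assoc)
qed

section \<open>The rows of the Kasteleyn matrix\<close>

definition next_kind :: "edge_kind \<Rightarrow> edge_kind" where
  "next_kind s = (case s of Kind_a \<Rightarrow> Kind_b | Kind_b \<Rightarrow> Kind_c | Kind_c \<Rightarrow> Kind_a)"

lemma next_kind_simps [simp]: "next_kind Kind_a = Kind_b" "next_kind Kind_b = Kind_c" "next_kind Kind_c = Kind_a"
  by (simp_all add: next_kind_def)

lemma oriented_edges_iff:
  "(Beta s x y, Beta t x' y') \<in> oriented_edges m n \<longleftrightarrow> t = next_kind s \<and> x' = x \<and> y' = y \<and> x < n \<and> y < m"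
  "(Omega s x y, Omega t x' y') \<in> oriented_edges m n \<longleftrightarrow> t = next_kind s \<and> x' = x \<and> y' = y \<and> x < n \<and> y < m"
  "(Beta s x y, Omega t x' y') \<in> oriented_edges m n \<longleftrightarrow> t = s \<and> x < n \<and> y < m \<and>
     x' = (if s = Kind_b then (x + 1) mod n else x) \<and> y' = (if s = Kind_c then (y + 1) mod m else y)"
  "(Omega s x y, Beta t x' y') \<notin> oriented_edges m n"
  unfolding oriented_edges_def triangular_edges_def a_edges_def b_edges_def c_edges_def
  by (cases s; cases t; fastforce)+

lemma z_edges_iff:
  "(Beta s x y, Omega t x' y') \<in> z_edges m n \<longleftrightarrow> s = Kind_b \<and> t = Kind_b \<and> x = n - 1 \<and> x' = 0 \<and> y' = y \<and> y < m"
  "(Beta s x y, Beta t x' y') \<notin> z_edges m n" "(Omega s x y, v) \<notin> z_edges m n"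
  by (auto simp: z_edges_def)

lemma w_edges_iff:
  "(Beta s x y, Omega t x' y') \<in> w_edges m n \<longleftrightarrow> s = Kind_c \<and> t = Kind_c \<and> y = m - 1 \<and> y' = 0 \<and> x' = x \<and> x < n"
  "(Beta s x y, Beta t x' y') \<notin> w_edges m n" "(Omega s x y, v) \<notin> w_edges m n"
  by (auto simp: w_edges_def)

lemma Suc_mod_inj: "x < n \<Longrightarrow> x' < n \<Longrightarrow> (x + 1) mod n = (x' + 1) mod n \<longleftrightarrow> x = (x'::nat)"
  by (auto simp: mod_if split: if_splits)

locale toroidal_fisher =
  fixes m n :: nat and W :: "vertex \<times> vertex \<Rightarrow> real"
  assumes m1: "m \<ge> 1" and n1: "n \<ge> 1"
    and W1: "\<And>e. e \<in> triangular_edges m n \<union> a_edges m n \<Longrightarrow> W e = 1"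
    and W01: "\<And>e. e \<in> b_edges m n \<union> c_edges m n \<Longrightarrow> 0 < W e \<and> W e < 1"
begin

lemma W_one:
  assumes xy: "x < n" "y < m"
  shows "W (Beta s x y, Beta (next_kind s) x y) = 1" "W (Omega s x y, Omega (next_kind s) x y) = 1"
    "W (Beta Kind_a x y, Omega Kind_a x y) = 1"
proof -
  have "(Beta s x y, Beta (next_kind s) x y) \<in> triangular_edges m n"
    unfolding triangular_edges_def mem_Collect_eq
    by (rule exI[of _ Beta], rule exI[of _ s], rule exI[of _ "next_kind s"], cases s; simp add: xy)
  then show "W (Beta s x y, Beta (next_kind s) x y) = 1" by (intro W1) simp
  have "(Omega s x y, Omega (next_kind s) x y) \<in> triangular_edges m n"
    unfolding triangular_edges_def mem_Collect_eq
    by (rule exI[of _ Omega], rule exI[of _ s], rule exI[of _ "next_kind s"], cases s; simp add: xy)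
  then show "W (Omega s x y, Omega (next_kind s) x y) = 1" by (intro W1) simp
  show "W (Beta Kind_a x y, Omega Kind_a x y) = 1"
    by (intro W1) (auto simp: a_edges_def xy)
qed

abbreviation "entry \<equiv> fps_entry m n W"
abbreviation "verts \<equiv> set (fisher_vertices m n)"
abbreviation "xf z x \<equiv> (if x = n - 1 then fps_const z else 1 :: complex fps)"
abbreviation "yf \<Omega> y \<equiv> (if y = m - 1 then \<Omega> else 1 :: complex fps)"
abbreviation "Bw x y \<equiv> W (Beta Kind_b x y, Omega Kind_b ((x + 1) mod n) y)"
abbreviation "Cw x y \<equiv> W (Beta Kind_c x y, Omega Kind_c x ((y + 1) mod m))"

lemma row_beta_a:
  assumes "x < n" "y < m"
  shows "(\<Sum>v\<in>verts. entry z \<Omega> (Beta Kind_a x y) v * u v) = u (Beta Kind_b x y) - u (Beta Kind_c x y) + u (Omega Kind_a x y)"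
proof -
  have "(\<Sum>v\<in>verts. entry z \<Omega> (Beta Kind_a x y) v * u v) = 1 * u (Beta Kind_b x y) + (- 1) * u (Beta Kind_c x y) + 1 * u (Omega Kind_a x y)"
  proof (rule sum_three)
    fix v
    assume V: "v \<in> verts"
    show "entry z \<Omega> (Beta Kind_a x y) v = (if v = Beta Kind_b x y then 1 else if v = Beta Kind_c x y then - 1 else if v = Omega Kind_a x y then 1 else 0)"
      by (insert V assms W_one(1,2)[OF assms, of Kind_a] W_one(1,2)[OF assms, of Kind_c] W_one(3)[OF assms],
        (cases v; rename_tac s x' y'; case_tac s), auto simp: fps_entry_def fps_factor_def oriented_edges_iff z_edges_iff w_edges_iff set_fisher_vertices)
  qed (rule finite_set, use assms in \<open>auto simp: set_fisher_vertices\<close>)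
  then show ?thesis by simp
qed

lemma row_omega_a:
  assumes "x < n" "y < m"
  shows "(\<Sum>v\<in>verts. entry z \<Omega> (Omega Kind_a x y) v * u v) = u (Omega Kind_b x y) - u (Omega Kind_c x y) - u (Beta Kind_a x y)"
proof -
  have "(\<Sum>v\<in>verts. entry z \<Omega> (Omega Kind_a x y) v * u v) = 1 * u (Omega Kind_b x y) + (- 1) * u (Omega Kind_c x y) + (- 1) * u (Beta Kind_a x y)"
  proof (rule sum_three)
    fix v
    assume V: "v \<in> verts"
    show "entry z \<Omega> (Omega Kind_a x y) v = (if v = Omega Kind_b x y then 1 else if v = Omega Kind_c x y then - 1 else if v = Beta Kind_a x y then - 1 else 0)"
      by (insert V assms W_one(1,2)[OF assms, of Kind_a] W_one(1,2)[OF assms, of Kind_c] W_one(3)[OF assms],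
        (cases v; rename_tac s x' y'; case_tac s), auto simp: fps_entry_def fps_factor_def oriented_edges_iff z_edges_iff w_edges_iff set_fisher_vertices)
  qed (rule finite_set, use assms in \<open>auto simp: set_fisher_vertices\<close>)
  then show ?thesis by simp
qed

lemma row_beta_b:
  assumes "x < n" "y < m"
  shows "(\<Sum>v\<in>verts. entry z \<Omega> (Beta Kind_b x y) v * u v) = u (Beta Kind_c x y) - u (Beta Kind_a x y)
    + fps_const (of_real (Bw x y)) * xf z x * u (Omega Kind_b ((x + 1) mod n) y)"
proof -
  have "(\<Sum>v\<in>verts. entry z \<Omega> (Beta Kind_b x y) v * u v) = 1 * u (Beta Kind_c x y) + (- 1) * u (Beta Kind_a x y)
    + (fps_const (of_real (Bw x y)) * xf z x) * u (Omega Kind_b ((x + 1) mod n) y)"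
  proof (rule sum_three)
    fix v
    assume V: "v \<in> verts"
    show "entry z \<Omega> (Beta Kind_b x y) v = (if v = Beta Kind_c x y then 1 else if v = Beta Kind_a x y then - 1
        else if v = Omega Kind_b ((x + 1) mod n) y then fps_const (of_real (Bw x y)) * xf z x else 0)"
      by (insert V assms W_one(1,2)[OF assms, of Kind_b] W_one(1,2)[OF assms, of Kind_a] W_one(3)[OF assms],
        (cases v; rename_tac s x' y'; case_tac s), auto simp: fps_entry_def fps_factor_def oriented_edges_iff z_edges_iff w_edges_iff set_fisher_vertices)
  qed (rule finite_set, use assms in \<open>auto simp: set_fisher_vertices\<close>)
  then show ?thesis by simp
qed

lemma row_beta_c:
  assumes "x < n" "y < m"
  shows "(\<Sum>v\<in>verts. entry z \<Omega> (Beta Kind_c x y) v * u v) = u (Beta Kind_a x y) - u (Beta Kind_b x y)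
    + fps_const (of_real (Cw x y)) * yf \<Omega> y * u (Omega Kind_c x ((y + 1) mod m))"
proof -
  have "(\<Sum>v\<in>verts. entry z \<Omega> (Beta Kind_c x y) v * u v) = 1 * u (Beta Kind_a x y) + (- 1) * u (Beta Kind_b x y)
    + (fps_const (of_real (Cw x y)) * yf \<Omega> y) * u (Omega Kind_c x ((y + 1) mod m))"
  proof (rule sum_three)
    fix v
    assume V: "v \<in> verts"
    show "entry z \<Omega> (Beta Kind_c x y) v = (if v = Beta Kind_a x y then 1 else if v = Beta Kind_b x y then - 1
        else if v = Omega Kind_c x ((y + 1) mod m) then fps_const (of_real (Cw x y)) * yf \<Omega> y else 0)"
      by (insert V assms W_one(1,2)[OF assms, of Kind_c] W_one(1,2)[OF assms, of Kind_b] W_one(3)[OF assms],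
        (cases v; rename_tac s x' y'; case_tac s), auto simp: fps_entry_def fps_factor_def oriented_edges_iff z_edges_iff w_edges_iff set_fisher_vertices)
  qed (rule finite_set, use assms in \<open>auto simp: set_fisher_vertices\<close>)
  then show ?thesis by simp
qed

text \<open>The row is indexed by the tail of the incoming \<open>b\<close>-edge, so that weight and
  factor match those of \<open>row_beta_b\<close>.\<close>

lemma row_omega_b:
  assumes "x < n" "y < m"
  defines "x1 \<equiv> (x + 1) mod n"
  shows "(\<Sum>v\<in>verts. entry z \<Omega> (Omega Kind_b x1 y) v * u v) = u (Omega Kind_c x1 y) - u (Omega Kind_a x1 y)
    - fps_const (of_real (Bw x y)) * inverse (xf z x) * u (Beta Kind_b x y)"
proof -
  have x1: "x1 < n" using assms by simp
  have "(\<Sum>v\<in>verts. entry z \<Omega> (Omega Kind_b x1 y) v * u v) = 1 * u (Omega Kind_c x1 y) + (- 1) * u (Omega Kind_a x1 y)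
    + (- (fps_const (of_real (Bw x y)) * inverse (xf z x))) * u (Beta Kind_b x y)"
  proof (rule sum_three)
    fix v
    assume V: "v \<in> verts"
    show "entry z \<Omega> (Omega Kind_b x1 y) v = (if v = Omega Kind_c x1 y then 1 else if v = Omega Kind_a x1 y then - 1
        else if v = Beta Kind_b x y then - (fps_const (of_real (Bw x y)) * inverse (xf z x)) else 0)"
      by (insert V assms(1,2) x1 W_one(1,2)[OF x1 assms(2), of Kind_b] W_one(1,2)[OF x1 assms(2), of Kind_a] W_one(3)[OF x1 assms(2)],
        (cases v; rename_tac s x' y'; case_tac s), auto simp: fps_entry_def fps_factor_def oriented_edges_iff z_edges_iff w_edges_iff set_fisher_vertices x1_def Suc_mod_inj[simplified])
  qed (rule finite_set, use assms x1 in \<open>auto simp: set_fisher_vertices\<close>)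
  then show ?thesis by simp
qed

lemma row_omega_c:
  assumes "x < n" "y < m"
  defines "y1 \<equiv> (y + 1) mod m"
  shows "(\<Sum>v\<in>verts. entry z \<Omega> (Omega Kind_c x y1) v * u v) = u (Omega Kind_a x y1) - u (Omega Kind_b x y1)
    - fps_const (of_real (Cw x y)) * inverse (yf \<Omega> y) * u (Beta Kind_c x y)"
proof -
  have y1: "y1 < m" using assms by simp
  have "(\<Sum>v\<in>verts. entry z \<Omega> (Omega Kind_c x y1) v * u v) = 1 * u (Omega Kind_a x y1) + (- 1) * u (Omega Kind_b x y1)
    + (- (fps_const (of_real (Cw x y)) * inverse (yf \<Omega> y))) * u (Beta Kind_c x y)"
  proof (rule sum_three)
    fix v
    assume V: "v \<in> verts"
    show "entry z \<Omega> (Omega Kind_c x y1) v = (if v = Omega Kind_a x y1 then 1 else if v = Omega Kind_b x y1 then - 1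
        else if v = Beta Kind_c x y then - (fps_const (of_real (Cw x y)) * inverse (yf \<Omega> y)) else 0)"
      by (insert V assms(1,2) y1 W_one(1,2)[OF assms(1) y1, of Kind_c] W_one(1,2)[OF assms(1) y1, of Kind_b] W_one(3)[OF assms(1) y1],
        (cases v; rename_tac s x' y'; case_tac s), auto simp: fps_entry_def fps_factor_def oriented_edges_iff z_edges_iff w_edges_iff set_fisher_vertices y1_def Suc_mod_inj[simplified])
  qed (rule finite_set, use assms y1 in \<open>auto simp: set_fisher_vertices\<close>)
  then show ?thesis by simp
qed

end

section \<open>Quasiperiodic lifts of truncated kernel vectors\<close>

lemma fps_power_int_add_1:
  fixes \<Omega> :: "complex fps"
  assumes "fps_nth \<Omega> 0 \<noteq> 0"
  shows "\<Omega> powi (k + 1) = \<Omega> powi k * \<Omega>"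
proof (cases "k \<ge> 0")
  case True
  then have "nat (k + 1) = Suc (nat k)" by simp
  then show ?thesis using True by (simp add: power_int_def mult.commute)
next
  case False
  then have e: "nat (- k) = Suc (nat (- (k + 1)))" by simp
  have "\<Omega> powi k * \<Omega> = inverse \<Omega> ^ nat (- (k + 1)) * (inverse \<Omega> * \<Omega>)"
    using False by (simp add: power_int_def e algebra_simps del: minus_add_distrib)
  also have "inverse \<Omega> * \<Omega> = 1" using assms by (rule inverse_mult_eq_1)
  finally show ?thesis using False by (auto simp: power_int_def)
qed

text \<open>A unit step enters the next period cell exactly at \<open>x = n - 1\<close>, where the
  edges with a nontrivial factor leave the cell.\<close>

lemma div_mod_next:
  fixes i :: int and n :: nat
  assumes "n \<ge> 1"
  defines "x \<equiv> nat (i mod int n)"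
  shows "x < n" "(i + 1) div int n = i div int n + (if x = n - 1 then 1 else 0)" "nat ((i + 1) mod int n) = (x + 1) mod n"
proof -
  have r: "0 \<le> i mod int n" "i mod int n < int n" using assms(1) by auto
  then show xn: "x < n" using assms(1) by (simp add: x_def nat_less_iff)
  have i: "i = int n * (i div int n) + int x" using r by (simp add: x_def)
  show "(i + 1) div int n = i div int n + (if x = n - 1 then 1 else 0)"
  proof (cases "x = n - 1")
    case True
    have "i + 1 = int n * (i div int n + 1) + 0" using i True assms(1) by (simp add: algebra_simps of_nat_diff)
    then have "(i + 1) div int n = i div int n + 1" by (rule int_div_pos_eq) (use assms(1) in auto)
    then show ?thesis using True by simp
  next
    case False
    have "i + 1 = int n * (i div int n) + (int x + 1)" using i by simp
    then have "(i + 1) div int n = i div int n" by (rule int_div_pos_eq) (use xn False in auto)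
    then show ?thesis using False by simp
  qed
  have "(i + 1) mod int n = (int x + 1) mod int n"
    unfolding x_def using r by (simp add: mod_simps)
  also have "\<dots> = int ((x + 1) mod n)" by (simp add: zmod_int add.commute)
  finally show "nat ((i + 1) mod int n) = (x + 1) mod n" by simp
qed

context toroidal_fisher begin

text \<open>The passage from one cell to the next multiplies by \<open>z\<close> or
  \<open>\<Omega>\<close>, which absorbs the factors of the \<open>z\<close>- and
  \<open>w\<close>-edges.\<close>

definition lift :: "complex \<Rightarrow> complex fps \<Rightarrow> (nat \<Rightarrow> nat \<Rightarrow> complex fps) \<Rightarrow> int \<Rightarrow> int \<Rightarrow> complex fps" where
  "lift z \<Omega> u i j = fps_const (z powi (i div int n)) * \<Omega> powi (j div int m) * u (nat (i mod int n)) (nat (j mod int m))"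

definition B :: "int \<Rightarrow> int \<Rightarrow> real" where
  "B i j = Bw (nat (i mod int n)) (nat (j mod int m))"

definition C :: "int \<Rightarrow> int \<Rightarrow> real" where
  "C i j = Cw (nat (i mod int n)) (nat (j mod int m))"

lemma lift_right:
  assumes "z \<noteq> 0"
  shows "lift z \<Omega> u (i + 1) j = fps_const (z powi (i div int n)) * \<Omega> powi (j div int m) *
    (xf z (nat (i mod int n)) * u ((nat (i mod int n) + 1) mod n) (nat (j mod int m)))"
  unfolding lift_def div_mod_next(2,3)[OF n1]
  using assms by (simp add: power_int_add_1 fps_const_mult [symmetric] del: fps_const_mult)

lemma lift_up:
  assumes "fps_nth \<Omega> 0 \<noteq> 0"
  shows "lift z \<Omega> u i (j + 1) = fps_const (z powi (i div int n)) * \<Omega> powi (j div int m) *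
    (yf \<Omega> (nat (j mod int m)) * u (nat (i mod int n)) ((nat (j mod int m) + 1) mod m))"
  unfolding lift_def div_mod_next(2,3)[OF m1]
  using assms by (simp add: fps_power_int_add_1 mult.assoc)

lemma lift_period:
  assumes "z \<noteq> 0" "fps_nth \<Omega> 0 \<noteq> 0"
  shows "lift z \<Omega> u (i + int n) j = fps_const z * lift z \<Omega> u i j"
    "lift z \<Omega> u i (j + int m) = \<Omega> * lift z \<Omega> u i j"
proof -
  have "(i + int n) div int n = i div int n + 1" "(j + int m) div int m = j div int m + 1"
    using n1 m1 by simp_all
  then show "lift z \<Omega> u (i + int n) j = fps_const z * lift z \<Omega> u i j"
    "lift z \<Omega> u i (j + int m) = \<Omega> * lift z \<Omega> u i j"
    using assms unfolding lift_def
    by (simp_all add: power_int_add_1 fps_power_int_add_1 fps_const_mult [symmetric] mult.assoc mult.left_commute mult.commute del: fps_const_mult)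
qed

lemma lift_cell: "x < n \<Longrightarrow> y < m \<Longrightarrow> lift z \<Omega> u (int x) (int y) = u x y"
  by (simp add: lift_def zmod_int [symmetric] zdiv_int [symmetric])

text \<open>Rows that vanish to order \<open>\<mu>\<close> still do so after multiplication by the
  cell factors, so every coefficient below \<open>\<mu>\<close> satisfies the kernel equations
  exactly.\<close>

lemma lift_fisher:
  fixes u :: "vertex \<Rightarrow> complex fps"
  assumes z: "z \<noteq> 0" and \<Omega>: "fps_nth \<Omega> 0 \<noteq> 0" and \<nu>: "\<nu> < \<mu>"
    and ker: "\<And>v. v \<in> verts \<Longrightarrow> low \<mu> (\<Sum>v'\<in>verts. entry z \<Omega> v v' * u v')"
  defines "\<beta> \<equiv> \<lambda>s. lift z \<Omega> (\<lambda>x y. u (Beta s x y))" and "\<omega> \<equiv> \<lambda>s. lift z \<Omega> (\<lambda>x y. u (Omega s x y))"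
  shows "fisher_solution B C (\<lambda>s i j. fps_nth (\<beta> s i j) \<nu>) (\<lambda>s i j. fps_nth (\<omega> s i j) \<nu>)"
proof -
  have inv_xf: "xf z x * inverse (xf z x) = 1" for x
    using z by (auto simp: fps_const_inverse fps_const_mult [symmetric] inverse_mult_eq_1')
  have inv_yf: "yf \<Omega> y * inverse (yf \<Omega> y) = 1" for y
    using \<Omega> by (auto simp: inverse_mult_eq_1')
  have L: "low \<mu> (\<beta> Kind_b i j - \<beta> Kind_c i j + \<omega> Kind_a i j)"
    "low \<mu> (\<beta> Kind_c i j - \<beta> Kind_a i j + fps_const (of_real (B i j)) * \<omega> Kind_b (i + 1) j)"
    "low \<mu> (\<beta> Kind_a i j - \<beta> Kind_b i j + fps_const (of_real (C i j)) * \<omega> Kind_c i (j + 1))"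
    "low \<mu> (\<omega> Kind_b i j - \<omega> Kind_c i j - \<beta> Kind_a i j)"
    "low \<mu> (\<omega> Kind_c (i + 1) j - \<omega> Kind_a (i + 1) j - fps_const (of_real (B i j)) * \<beta> Kind_b i j)"
    "low \<mu> (\<omega> Kind_a i (j + 1) - \<omega> Kind_b i (j + 1) - fps_const (of_real (C i j)) * \<beta> Kind_c i j)" for i j
  proof -
    define x where "x = nat (i mod int n)"
    define y where "y = nat (j mod int m)"
    define T where "T = fps_const (z powi (i div int n)) * \<Omega> powi (j div int m)"
    have xy: "x < n" "y < m" unfolding x_def y_def using n1 m1 by (auto intro: div_mod_next(1))
    have x1: "(x + 1) mod n < n" and y1: "(y + 1) mod m < m" using xy by simp_all
    have vs: "Beta s x y \<in> verts" "Omega s x y \<in> verts" "Omega s ((x + 1) mod n) y \<in> verts" "Omega s x ((y + 1) mod m) \<in> verts" for s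
      using xy x1 y1 unfolding set_fisher_vertices by blast+
    have \<beta>: "\<beta> s i j = T * u (Beta s x y)" and \<omega>: "\<omega> s i j = T * u (Omega s x y)" for s
      by (simp_all add: \<beta>_def \<omega>_def lift_def T_def x_def y_def)
    have \<omega>r: "\<omega> s (i + 1) j = T * (xf z x * u (Omega s ((x + 1) mod n) y))" for s
      unfolding \<omega>_def lift_right[OF z] T_def x_def y_def by (rule refl)
    have \<omega>u: "\<omega> s i (j + 1) = T * (yf \<Omega> y * u (Omega s x ((y + 1) mod m)))" for s
      unfolding \<omega>_def lift_up[OF \<Omega>] T_def x_def y_def by (rule refl)
    have BC: "B i j = Bw x y" "C i j = Cw x y"
      by (simp_all add: B_def C_def x_def y_def)
    show "low \<mu> (\<beta> Kind_b i j - \<beta> Kind_c i j + \<omega> Kind_a i j)"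
      using low_mult[OF ker[OF vs(1)[of Kind_a]], of T] unfolding row_beta_a[OF xy] \<beta> \<omega>
      by (simp only: ring_distribs right_diff_distrib)
    show "low \<mu> (\<omega> Kind_b i j - \<omega> Kind_c i j - \<beta> Kind_a i j)"
      using low_mult[OF ker[OF vs(2)[of Kind_a]], of T] unfolding row_omega_a[OF xy] \<beta> \<omega>
      by (simp only: ring_distribs right_diff_distrib)
    show "low \<mu> (\<beta> Kind_c i j - \<beta> Kind_a i j + fps_const (of_real (B i j)) * \<omega> Kind_b (i + 1) j)"
      using low_mult[OF ker[OF vs(1)[of Kind_b]], of T] unfolding row_beta_b[OF xy] \<beta> \<omega>r BC
      by (simp only: ring_distribs right_diff_distrib mult_ac)
    show "low \<mu> (\<beta> Kind_a i j - \<beta> Kind_b i j + fps_const (of_real (C i j)) * \<omega> Kind_c i (j + 1))"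
      using low_mult[OF ker[OF vs(1)[of Kind_c]], of T] unfolding row_beta_c[OF xy] \<beta> \<omega>u BC
      by (simp only: ring_distribs right_diff_distrib mult_ac)
    \<comment> \<open>The equation at an \<open>\<omega>\<close>-vertex contains the inverse factor
      of its incoming edge; multiplying by the factor itself moves it to the other two
      terms.\<close>
    have alg: "(T * F) * (p - q - b * G * r) = T * (F * p) - T * (F * q) - b * (T * r)" if "F * G = 1" for F G p q b r :: "complex fps"
    proof -
      have "(T * F) * (p - q - b * G * r) = T * (F * p) - T * (F * q) - b * (T * r) * (F * G)"
        by (simp only: ring_distribs right_diff_distrib mult_ac)
      then show ?thesis using that by simp
    qed
    show "low \<mu> (\<omega> Kind_c (i + 1) j - \<omega> Kind_a (i + 1) j - fps_const (of_real (B i j)) * \<beta> Kind_b i j)"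
      using low_mult[OF ker[OF vs(3)[of Kind_b]], of "T * xf z x"]
      unfolding row_omega_b[OF xy] \<beta> \<omega>r BC alg[OF inv_xf] .
    show "low \<mu> (\<omega> Kind_a i (j + 1) - \<omega> Kind_b i (j + 1) - fps_const (of_real (C i j)) * \<beta> Kind_c i j)"
      using low_mult[OF ker[OF vs(4)[of Kind_c]], of "T * yf \<Omega> y"]
      unfolding row_omega_c[OF xy] \<beta> \<omega>u BC alg[OF inv_yf] .
  qed
  show ?thesis
    unfolding fisher_solution_def
  proof (intro allI)
    fix i j
    show "fps_nth (\<beta> Kind_b i j) \<nu> - fps_nth (\<beta> Kind_c i j) \<nu> + fps_nth (\<omega> Kind_a i j) \<nu> = 0 \<and>
     fps_nth (\<beta> Kind_c i j) \<nu> - fps_nth (\<beta> Kind_a i j) \<nu> + B i j * fps_nth (\<omega> Kind_b (i + 1) j) \<nu> = 0 \<and>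
     fps_nth (\<beta> Kind_a i j) \<nu> - fps_nth (\<beta> Kind_b i j) \<nu> + C i j * fps_nth (\<omega> Kind_c i (j + 1)) \<nu> = 0 \<and>
     fps_nth (\<omega> Kind_b i j) \<nu> - fps_nth (\<omega> Kind_c i j) \<nu> - fps_nth (\<beta> Kind_a i j) \<nu> = 0 \<and>
     fps_nth (\<omega> Kind_c i j) \<nu> - fps_nth (\<omega> Kind_a i j) \<nu> - B (i - 1) j * fps_nth (\<beta> Kind_b (i - 1) j) \<nu> = 0 \<and>
     fps_nth (\<omega> Kind_a i j) \<nu> - fps_nth (\<omega> Kind_b i j) \<nu> - C i (j - 1) * fps_nth (\<beta> Kind_c i (j - 1)) \<nu> = 0"
      using L(1-4)[of i j] L(5)[of "i - 1" j] L(6)[of i "j - 1"] \<nu>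
      unfolding low_def by simp
  qed
qed

text \<open>Multiplication by \<open>fps_const w + fps_X\<close> acts on coefficients as a Jordan
  block, which turns truncated kernel vectors into chains. Independence can be stated for the top
  coefficients alone, because a relation among them is passed down the chain by the vertical
  shift.\<close>

lemma kernel_chain:
  assumes z: "z \<noteq> 0" and w: "w \<noteq> 0"
    and det: "low \<mu> (Determinant.det (fmat (6 * m * n)
      (\<lambda>r k. entry z (fps_const w + fps_X) (fisher_vertices m n ! r) (fisher_vertices m n ! k))))"
  shows "\<exists>\<beta> \<omega>. (\<forall>i<\<mu>. \<forall>\<nu><\<mu>. fisher_solution B C (\<beta> i \<nu>) (\<omega> i \<nu>) \<and>
      (\<forall>s a b. \<beta> i \<nu> s (a + int n) b = z * \<beta> i \<nu> s a b \<and> \<omega> i \<nu> s (a + int n) b = z * \<omega> i \<nu> s a b \<and>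
        \<beta> i \<nu> s a (b + int m) = w * \<beta> i \<nu> s a b + (if \<nu> = 0 then 0 else \<beta> i (\<nu> - 1) s a b) \<and>
        \<omega> i \<nu> s a (b + int m) = w * \<omega> i \<nu> s a b + (if \<nu> = 0 then 0 else \<omega> i (\<nu> - 1) s a b))) \<and>
    (\<forall>c. (\<forall>s a b. (\<Sum>i<\<mu>. c i * \<beta> i (\<mu> - 1) s a b) = 0 \<and> (\<Sum>i<\<mu>. c i * \<omega> i (\<mu> - 1) s a b) = 0) \<longrightarrow> (\<forall>i<\<mu>. c i = 0))"
proof -
  define \<Omega> where "\<Omega> = fps_const w + (fps_X :: complex fps)"
  have \<Omega>0: "fps_nth \<Omega> 0 \<noteq> 0" using w by (simp add: \<Omega>_def)
  from truncated_vertex_kernel[OF det] obtain u where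
    ker: "\<And>i v. i < \<mu> \<Longrightarrow> v \<in> verts \<Longrightarrow> low \<mu> (\<Sum>v'\<in>verts. entry z \<Omega> v v' * u i v')"
    and ind: "\<And>c. \<forall>v\<in>verts. low \<mu> (\<Sum>i<\<mu>. fps_const (c i) * u i v) \<Longrightarrow> \<forall>i<\<mu>. c i = 0"
    unfolding \<Omega>_def by blast
  define \<beta> where "\<beta> = (\<lambda>i \<nu> s a b. fps_nth (lift z \<Omega> (\<lambda>x y. u i (Beta s x y)) a b) \<nu>)"
  define \<omega> where "\<omega> = (\<lambda>i \<nu> s a b. fps_nth (lift z \<Omega> (\<lambda>x y. u i (Omega s x y)) a b) \<nu>)"
  have nth: "fps_nth (\<Omega> * f) \<nu> = w * fps_nth f \<nu> + (if \<nu> = 0 then 0 else fps_nth f (\<nu> - 1))" for f \<nu>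
    by (simp add: \<Omega>_def distrib_right)
  have X: "\<beta> i \<nu> s (a + int n) b = z * \<beta> i \<nu> s a b" "\<omega> i \<nu> s (a + int n) b = z * \<omega> i \<nu> s a b" for i \<nu> s a b
    by (simp_all add: \<beta>_def \<omega>_def lift_period[OF z \<Omega>0])
  have Y: "\<beta> i \<nu> s a (b + int m) = w * \<beta> i \<nu> s a b + (if \<nu> = 0 then 0 else \<beta> i (\<nu> - 1) s a b)"
    "\<omega> i \<nu> s a (b + int m) = w * \<omega> i \<nu> s a b + (if \<nu> = 0 then 0 else \<omega> i (\<nu> - 1) s a b)" for i \<nu> s a b
    by (simp_all only: \<beta>_def \<omega>_def lift_period[OF z \<Omega>0] nth)
  have sol: "fisher_solution B C (\<beta> i \<nu>) (\<omega> i \<nu>)" if "i < \<mu>" "\<nu> < \<mu>" for i \<nu>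
    unfolding \<beta>_def \<omega>_def by (rule lift_fisher[OF z \<Omega>0 that(2)]) (rule ker[OF that(1)])
  have "\<forall>i<\<mu>. c i = 0"
    if c: "\<forall>s a b. (\<Sum>i<\<mu>. c i * \<beta> i (\<mu> - 1) s a b) = 0 \<and> (\<Sum>i<\<mu>. c i * \<omega> i (\<mu> - 1) s a b) = 0" for c
  proof (rule ind, intro ballI)
    have all: "k < \<mu> \<Longrightarrow> \<forall>s a b. (\<Sum>i<\<mu>. c i * \<beta> i (\<mu> - 1 - k) s a b) = 0 \<and> (\<Sum>i<\<mu>. c i * \<omega> i (\<mu> - 1 - k) s a b) = 0" for k
    proof (induction k)
      case 0
      then show ?case using c by simp
    next
      case (Suc k)
      then have IH: "(\<Sum>i<\<mu>. c i * \<beta> i (\<mu> - 1 - k) s a b) = 0" "(\<Sum>i<\<mu>. c i * \<omega> i (\<mu> - 1 - k) s a b) = 0" for s a b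
        by simp_all
      have \<nu>: "\<mu> - 1 - k \<noteq> 0" "\<mu> - 1 - k - 1 = \<mu> - 1 - Suc k" using Suc.prems by simp_all
      show ?case
      proof (intro allI conjI)
        fix s a b
        have "(\<Sum>i<\<mu>. c i * \<beta> i (\<mu> - 1 - k) s a (b + int m)) =
            w * (\<Sum>i<\<mu>. c i * \<beta> i (\<mu> - 1 - k) s a b) + (\<Sum>i<\<mu>. c i * \<beta> i (\<mu> - 1 - Suc k) s a b)"
          unfolding Y sum_distrib_left sum.distrib [symmetric] using \<nu> by (intro sum.cong) (simp_all add: algebra_simps)
        then show "(\<Sum>i<\<mu>. c i * \<beta> i (\<mu> - 1 - Suc k) s a b) = 0" unfolding IH by simp
        have "(\<Sum>i<\<mu>. c i * \<omega> i (\<mu> - 1 - k) s a (b + int m)) =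
            w * (\<Sum>i<\<mu>. c i * \<omega> i (\<mu> - 1 - k) s a b) + (\<Sum>i<\<mu>. c i * \<omega> i (\<mu> - 1 - Suc k) s a b)"
          unfolding Y sum_distrib_left sum.distrib [symmetric] using \<nu> by (intro sum.cong) (simp_all add: algebra_simps)
        then show "(\<Sum>i<\<mu>. c i * \<omega> i (\<mu> - 1 - Suc k) s a b) = 0" unfolding IH by simp
      qed
    qed
    fix v assume "v \<in> verts"
    then obtain s x y where v: "v = Beta s x y \<or> v = Omega s x y" "x < n" "y < m"
      unfolding set_fisher_vertices by blast
    show "low \<mu> (\<Sum>i<\<mu>. fps_const (c i) * u i v)"
      unfolding low_def
    proof (intro allI impI)
      fix \<nu> assume "\<nu> < \<mu>"
      then have "(\<Sum>i<\<mu>. c i * \<beta> i \<nu> s x y) = 0" "(\<Sum>i<\<mu>. c i * \<omega> i \<nu> s x y) = 0"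
        using all[of "\<mu> - 1 - \<nu>"] by simp_all
      then show "fps_nth (\<Sum>i<\<mu>. fps_const (c i) * u i v) \<nu> = 0"
        using v by (auto simp: fps_sum_nth \<beta>_def \<omega>_def lift_cell)
    qed
  qed
  note independent = this
  show ?thesis
  proof (rule exI[of _ \<beta>], rule exI[of _ \<omega>], intro conjI allI impI)
    fix c i assume "\<forall>s a b. (\<Sum>i<\<mu>. c i * \<beta> i (\<mu> - 1) s a b) = 0 \<and> (\<Sum>i<\<mu>. c i * \<omega> i (\<mu> - 1) s a b) = 0" "i < \<mu>"
    then show "c i = 0" using independent by blast
  qed (rule sol X Y; assumption)+
qed

end

section \<open>Chains of gate solutions\<close>

lemma corner_sum:
  fixes \<beta> \<omega> :: "'i \<Rightarrow> edge_kind \<Rightarrow> int \<Rightarrow> int \<Rightarrow> complex"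
  shows "corner_x B (\<lambda>s i j. \<Sum>k\<in>A. c k * \<beta> k s i j) (\<lambda>s i j. \<Sum>k\<in>A. c k * \<omega> k s i j) a b =
      (\<Sum>k\<in>A. c k * corner_x B (\<beta> k) (\<omega> k) a b)"
    "corner_y B (\<lambda>s i j. \<Sum>k\<in>A. c k * \<beta> k s i j) (\<lambda>s i j. \<Sum>k\<in>A. c k * \<omega> k s i j) a b =
      (\<Sum>k\<in>A. c k * corner_y B (\<beta> k) (\<omega> k) a b)"
  by (simp_all add: corner_x_def corner_y_def Let_def sum.distrib sum_subtractf sum_distrib_left sum_negf algebra_simps)

lemma fisher_solution_sum:
  fixes \<beta> \<omega> :: "'i \<Rightarrow> edge_kind \<Rightarrow> int \<Rightarrow> int \<Rightarrow> complex"
  assumes "\<And>k. k \<in> A \<Longrightarrow> fisher_solution B C (\<beta> k) (\<omega> k)"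
  shows "fisher_solution B C (\<lambda>s i j. \<Sum>k\<in>A. c k * \<beta> k s i j) (\<lambda>s i j. \<Sum>k\<in>A. c k * \<omega> k s i j)"
proof -
  have lin: "(\<Sum>k\<in>A. c k * p k) - (\<Sum>k\<in>A. c k * q k) + t * (\<Sum>k\<in>A. c k * r k) = 0"
    if "\<And>k. k \<in> A \<Longrightarrow> p k - q k + t * r k = 0" for p q r and t :: complex
  proof -
    have "(\<Sum>k\<in>A. c k * p k) - (\<Sum>k\<in>A. c k * q k) + t * (\<Sum>k\<in>A. c k * r k) = (\<Sum>k\<in>A. c k * (p k - q k + t * r k))"
      by (simp add: sum.distrib sum_subtractf sum_distrib_left algebra_simps)
    then show ?thesis using that by simp
  qed
  have S: "\<beta> k Kind_b i j - \<beta> k Kind_c i j + 1 * \<omega> k Kind_a i j = 0"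
     "\<beta> k Kind_c i j - \<beta> k Kind_a i j + B i j * \<omega> k Kind_b (i + 1) j = 0"
     "\<beta> k Kind_a i j - \<beta> k Kind_b i j + C i j * \<omega> k Kind_c i (j + 1) = 0"
     "\<omega> k Kind_b i j - \<omega> k Kind_c i j + (- 1) * \<beta> k Kind_a i j = 0"
     "\<omega> k Kind_c i j - \<omega> k Kind_a i j + (- of_real (B (i - 1) j)) * \<beta> k Kind_b (i - 1) j = 0"
     "\<omega> k Kind_a i j - \<omega> k Kind_b i j + (- of_real (C i (j - 1))) * \<beta> k Kind_c i (j - 1) = 0" if "k \<in> A" for k i j
    using assms[OF that] unfolding fisher_solution_def by simp_all
  show ?thesis
    unfolding fisher_solution_def
    using lin[OF S(1)] lin[OF S(2)] lin[OF S(3)] lin[OF S(4)] lin[OF S(5)] lin[OF S(6)] by simp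
qed

lemma parity_sign_sq: "parity_sign j * parity_sign j = 1"
  by (simp add: parity_sign_def)

lemma parity_sign_0: "parity_sign 0 = 1"
  by (simp add: parity_sign_def)

context toroidal_fisher begin

sublocale fisher_weights B C
proof
  fix i j
  have "nat (i mod int n) < n" "nat (j mod int m) < m" using n1 m1 by (auto intro: div_mod_next(1))
  then have "0 < B i j \<and> B i j < 1" "0 < C i j \<and> C i j < 1"
    unfolding B_def C_def by (intro W01; auto simp: b_edges_def c_edges_def)+
  then show "0 < B i j" "B i j < 1" "0 < C i j" "C i j < 1" by simp_all
qed

sublocale gates "gate_c B C" "gate_s B C"
  by (rule gates)

lemma BC_periodic: "B (i + int n) j = B i j" "B i (j + int m) = B i j" "C (i + int n) j = C i j" "C i (j + int m) = C i j"
  by (simp_all add: B_def C_def)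

lemma gate_chains:
  assumes z: "z \<noteq> 0" and w: "w \<noteq> 0"
    and det: "low \<mu> (Determinant.det (fmat (6 * m * n)
      (\<lambda>r k. entry z (fps_const w + fps_X) (fisher_vertices m n ! r) (fisher_vertices m n ! k))))"
  defines "w' \<equiv> of_real (parity_sign (int m)) * w"
  shows "\<exists>x y. (\<forall>i<\<mu>. \<forall>\<nu><\<mu>. gate_solution (gate_c B C) (gate_s B C) (x i \<nu>) (y i \<nu>) \<and> quasi (int n) (- int n) z (x i \<nu>) (y i \<nu>) \<and>
      (\<forall>a b. x i \<nu> (a + int m) (b + int m) = w' * x i \<nu> a b + (if \<nu> = 0 then 0 else x i (\<nu> - 1) a b) \<and>
        y i \<nu> (a + int m) (b + int m) = w' * y i \<nu> a b + (if \<nu> = 0 then 0 else y i (\<nu> - 1) a b))) \<and>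
    (\<forall>c. (\<forall>a b. (\<Sum>i<\<mu>. c i * x i (\<mu> - 1) a b) = 0 \<and> (\<Sum>i<\<mu>. c i * y i (\<mu> - 1) a b) = 0) \<longrightarrow> (\<forall>i<\<mu>. c i = 0))"
proof -
  define e where "e = complex_of_real (parity_sign (int m))"
  have ee: "e * e = 1" unfolding e_def of_real_mult [symmetric] parity_sign_sq by simp
  then have e0: "e \<noteq> 0" by auto
  from kernel_chain[OF z w det] obtain \<beta> \<omega> where
    sol: "\<And>i \<nu>. i < \<mu> \<Longrightarrow> \<nu> < \<mu> \<Longrightarrow> fisher_solution B C (\<beta> i \<nu>) (\<omega> i \<nu>)"
    and X: "\<And>i \<nu> s a b. i < \<mu> \<Longrightarrow> \<nu> < \<mu> \<Longrightarrow> \<beta> i \<nu> s (a + int n) b = z * \<beta> i \<nu> s a b"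
      "\<And>i \<nu> s a b. i < \<mu> \<Longrightarrow> \<nu> < \<mu> \<Longrightarrow> \<omega> i \<nu> s (a + int n) b = z * \<omega> i \<nu> s a b"
    and Y: "\<And>i \<nu> s a b. i < \<mu> \<Longrightarrow> \<nu> < \<mu> \<Longrightarrow>
        \<beta> i \<nu> s a (b + int m) = w * \<beta> i \<nu> s a b + (if \<nu> = 0 then 0 else \<beta> i (\<nu> - 1) s a b)"
      "\<And>i \<nu> s a b. i < \<mu> \<Longrightarrow> \<nu> < \<mu> \<Longrightarrow>
        \<omega> i \<nu> s a (b + int m) = w * \<omega> i \<nu> s a b + (if \<nu> = 0 then 0 else \<omega> i (\<nu> - 1) s a b)"
    and ind: "\<And>c. \<forall>s a b. (\<Sum>i<\<mu>. c i * \<beta> i (\<mu> - 1) s a b) = 0 \<and> (\<Sum>i<\<mu>. c i * \<omega> i (\<mu> - 1) s a b) = 0 \<Longrightarrow> \<forall>i<\<mu>. c i = 0"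
    by blast
  \<comment> \<open>By \<open>corner_shift\<close> the parity sign also multiplies the coupling to
    the previous member of the chain; the factor \<open>e ^ \<nu>\<close> restores coupling constant
    one.\<close>
  define x where "x = (\<lambda>i \<nu> a b. e ^ \<nu> * corner_x B (\<beta> i \<nu>) (\<omega> i \<nu>) a b)"
  define y where "y = (\<lambda>i \<nu> a b. e ^ \<nu> * corner_y B (\<beta> i \<nu>) (\<omega> i \<nu>) a b)"
  have z0: "corner_x B (\<lambda>_ _ _. 0) (\<lambda>_ _ _. 0) a b = 0" "corner_y B (\<lambda>_ _ _. 0) (\<lambda>_ _ _. 0) a b = 0" for a b
    by (simp_all add: corner_x_def corner_y_def Let_def)
  have g: "gate_solution (gate_c B C) (gate_s B C) (x i \<nu>) (y i \<nu>)" if "i < \<mu>" "\<nu> < \<mu>" for i \<nu>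
    using corner_gate_solution[OF sol[OF that]]
    unfolding gate_solution_def x_def y_def by (simp add: scaleR_conv_of_real algebra_simps)
  have qx: "quasi (int n) (- int n) z (x i \<nu>) (y i \<nu>)" if "i < \<mu>" "\<nu> < \<mu>" for i \<nu>
  proof -
    have "corner_x B (\<beta> i \<nu>) (\<omega> i \<nu>) (a + int n + 0) (b - int n + 0) = parity_sign 0 * (z * corner_x B (\<beta> i \<nu>) (\<omega> i \<nu>) a b + corner_x B (\<lambda>_ _ _. 0) (\<lambda>_ _ _. 0) a b)"
      "corner_y B (\<beta> i \<nu>) (\<omega> i \<nu>) (a + int n + 0) (b - int n + 0) = parity_sign 0 * (z * corner_y B (\<beta> i \<nu>) (\<omega> i \<nu>) a b + corner_y B (\<lambda>_ _ _. 0) (\<lambda>_ _ _. 0) a b)" for a b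
      by (rule corner_shift; simp add: X that BC_periodic)+
    then show ?thesis unfolding quasi_def x_def y_def by (simp add: z0 parity_sign_0)
  qed
  have qy: "x i \<nu> (a + int m) (b + int m) = w' * x i \<nu> a b + (if \<nu> = 0 then 0 else x i (\<nu> - 1) a b)"
    "y i \<nu> (a + int m) (b + int m) = w' * y i \<nu> a b + (if \<nu> = 0 then 0 else y i (\<nu> - 1) a b)" if "i < \<mu>" "\<nu> < \<mu>" for i \<nu> a b
  proof -
    let ?\<beta>' = "\<lambda>s a b. if \<nu> = 0 then 0 else \<beta> i (\<nu> - 1) s a b" and ?\<omega>' = "\<lambda>s a b. if \<nu> = 0 then 0 else \<omega> i (\<nu> - 1) s a b"
    have "corner_x B (\<beta> i \<nu>) (\<omega> i \<nu>) (a + 0 + int m) (b - 0 + int m) = parity_sign (int m) * (w * corner_x B (\<beta> i \<nu>) (\<omega> i \<nu>) a b + corner_x B ?\<beta>' ?\<omega>' a b)"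
      "corner_y B (\<beta> i \<nu>) (\<omega> i \<nu>) (a + 0 + int m) (b - 0 + int m) = parity_sign (int m) * (w * corner_y B (\<beta> i \<nu>) (\<omega> i \<nu>) a b + corner_y B ?\<beta>' ?\<omega>' a b)"
      by (rule corner_shift; simp add: Y that BC_periodic)+
    then have c: "corner_x B (\<beta> i \<nu>) (\<omega> i \<nu>) (a + int m) (b + int m) = e * (w * corner_x B (\<beta> i \<nu>) (\<omega> i \<nu>) a b + corner_x B ?\<beta>' ?\<omega>' a b)"
      "corner_y B (\<beta> i \<nu>) (\<omega> i \<nu>) (a + int m) (b + int m) = e * (w * corner_y B (\<beta> i \<nu>) (\<omega> i \<nu>) a b + corner_y B ?\<beta>' ?\<omega>' a b)"
      by (simp_all add: e_def)
    have w': "w' = e * w" by (simp add: w'_def e_def)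
    have "x i \<nu> (a + int m) (b + int m) = w' * x i \<nu> a b + (if \<nu> = 0 then 0 else x i (\<nu> - 1) a b) \<and>
        y i \<nu> (a + int m) (b + int m) = w' * y i \<nu> a b + (if \<nu> = 0 then 0 else y i (\<nu> - 1) a b)"
    proof (cases \<nu>)
      case 0
      then show ?thesis unfolding x_def y_def c w' by (simp add: z0)
    next
      case (Suc k)
      have "e ^ Suc k * (e * (w * A + A')) = e * w * (e ^ Suc k * A) + e ^ k * A'" for A A'
      proof -
        have "e ^ Suc k * (e * (w * A + A')) = e * w * (e ^ Suc k * A) + (e * e) * (e ^ k * A')" by (simp add: algebra_simps)
        then show ?thesis using ee by simp
      qed
      note alg = this
      show ?thesis unfolding x_def y_def unfolding c w' unfolding Suc alg by simp
    qed
    then show "x i \<nu> (a + int m) (b + int m) = w' * x i \<nu> a b + (if \<nu> = 0 then 0 else x i (\<nu> - 1) a b)"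
      "y i \<nu> (a + int m) (b + int m) = w' * y i \<nu> a b + (if \<nu> = 0 then 0 else y i (\<nu> - 1) a b)" by simp_all
  qed
  show ?thesis
  proof (rule exI[of _ x], rule exI[of _ y], intro conjI allI impI)
    fix c i
    assume c: "\<forall>a b. (\<Sum>i<\<mu>. c i * x i (\<mu> - 1) a b) = 0 \<and> (\<Sum>i<\<mu>. c i * y i (\<mu> - 1) a b) = 0" and i: "i < \<mu>"
    let ?\<nu> = "\<mu> - 1"
    let ?b = "\<lambda>s a b. \<Sum>i<\<mu>. c i * \<beta> i ?\<nu> s a b" and ?o = "\<lambda>s a b. \<Sum>i<\<mu>. c i * \<omega> i ?\<nu> s a b"
    have "fisher_solution B C ?b ?o"
      by (rule fisher_solution_sum) (use sol in auto)
    moreover have "corner_x B ?b ?o a b = 0" "corner_y B ?b ?o a b = 0" for a b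
    proof -
      have "e ^ ?\<nu> * (\<Sum>i<\<mu>. c i * corner_x B (\<beta> i ?\<nu>) (\<omega> i ?\<nu>) a b) = (\<Sum>i<\<mu>. c i * x i ?\<nu> a b)"
        "e ^ ?\<nu> * (\<Sum>i<\<mu>. c i * corner_y B (\<beta> i ?\<nu>) (\<omega> i ?\<nu>) a b) = (\<Sum>i<\<mu>. c i * y i ?\<nu> a b)"
        by (simp_all add: x_def y_def sum_distrib_left mult.left_commute)
      then show "corner_x B ?b ?o a b = 0" "corner_y B ?b ?o a b = 0"
        unfolding corner_sum using c e0 by simp_all
    qed
    ultimately have "?b s a b = 0 \<and> ?o s a b = 0" for s a b by (rule corner_eq_0)
    then show "c i = 0" using ind[of c] i by blast
  qed (rule g qx qy; assumption)+
qed

end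

section \<open>The characteristic polynomial\<close>

lemma det_fmat: "Determinant.det (fmat N M) = (\<Sum>p | p permutes {0..<N}. signof p * (\<Prod>i = 0..<N. M i (p i)))"
proof -
  have "Determinant.det (fmat N M) = (\<Sum>p | p permutes {0..<N}. signof p * (\<Prod>i = 0..<N. fmat N M $$ (i, p i)))"
    by (rule det_def') (rule fmat_carrier)
  also have "\<dots> = (\<Sum>p | p permutes {0..<N}. signof p * (\<Prod>i = 0..<N. M i (p i)))"
    by (intro sum.cong refl arg_cong2[where f = times] prod.cong) (auto simp: fmat_def permutes_in_image)
  finally show ?thesis .
qed

lemma char_polynomial_fmat:
  "char_polynomial m n W z w = Determinant.det (fmat (6 * m * n)
     (\<lambda>i j. kasteleyn_entry m n W z w (fisher_vertices m n ! i) (fisher_vertices m n ! j)))"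
  by (simp add: char_polynomial_def kasteleyn_matrix_def fmat_def)

lemma edge_factor_expansion:
  assumes "z \<noteq> 0" "w \<noteq> 0"
  shows "(\<lambda>h. edge_factor m n z (w + h) e) has_fps_expansion fps_factor m n z (fps_const w + fps_X) e"
    "(\<lambda>h. inverse (edge_factor m n z (w + h) e)) has_fps_expansion inverse (fps_factor m n z (fps_const w + fps_X) e)"
proof -
  show "(\<lambda>h. edge_factor m n z (w + h) e) has_fps_expansion fps_factor m n z (fps_const w + fps_X) e"
    by (auto simp: edge_factor_def fps_factor_def intro!: fps_expansion_intros)
  then show "(\<lambda>h. inverse (edge_factor m n z (w + h) e)) has_fps_expansion inverse (fps_factor m n z (fps_const w + fps_X) e)"
    by (rule has_fps_expansion_inverse) (use assms in \<open>auto simp: fps_factor_def\<close>)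
qed

lemma kasteleyn_entry_expansion:
  assumes "z \<noteq> 0" "w \<noteq> 0"
  shows "(\<lambda>h. kasteleyn_entry m n W z (w + h) u v) has_fps_expansion fps_entry m n W z (fps_const w + fps_X) u v"
proof -
  consider "(u, v) \<in> oriented_edges m n" | "(u, v) \<notin> oriented_edges m n" "(v, u) \<in> oriented_edges m n"
    | "(u, v) \<notin> oriented_edges m n" "(v, u) \<notin> oriented_edges m n" by blast
  then show ?thesis
  proof cases
    case 1
    have "(\<lambda>h. of_real (W (u, v)) * edge_factor m n z (w + h) (u, v)) has_fps_expansion
        fps_const (of_real (W (u, v))) * fps_factor m n z (fps_const w + fps_X) (u, v)"
      by (rule has_fps_expansion_cmult_left) (rule edge_factor_expansion[OF assms])
    then show ?thesis using 1 by (simp add: kasteleyn_entry_def fps_entry_def)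
  next
    case 2
    have "(\<lambda>h. - (of_real (W (v, u)) * inverse (edge_factor m n z (w + h) (v, u)))) has_fps_expansion
        - (fps_const (of_real (W (v, u))) * inverse (fps_factor m n z (fps_const w + fps_X) (v, u)))"
      by (intro has_fps_expansion_minus has_fps_expansion_cmult_left edge_factor_expansion assms)
    then show ?thesis using 2 by (simp add: kasteleyn_entry_def fps_entry_def)
  next
    case 3
    then show ?thesis by (simp add: kasteleyn_entry_def fps_entry_def)
  qed
qed

lemma char_polynomial_expansion:
  assumes "z \<noteq> 0" "w \<noteq> 0"
  shows "(\<lambda>h. char_polynomial m n W z (w + h)) has_fps_expansion Determinant.det (fmat (6 * m * n)
     (\<lambda>i j. fps_entry m n W z (fps_const w + fps_X) (fisher_vertices m n ! i) (fisher_vertices m n ! j)))"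
proof -
  have "(\<lambda>_. signof p) has_fps_expansion (signof p :: complex fps)" for p :: "nat \<Rightarrow> nat"
    using has_fps_expansion_minus[OF has_fps_expansion_1] by (cases "evenperm p") (simp_all add: sign_def)
  then show ?thesis
    unfolding char_polynomial_fmat det_fmat
    by (intro has_fps_expansion_sum has_fps_expansion_mult has_fps_expansion_prod kasteleyn_entry_expansion assms)
qed

text \<open>Only derivatives in the second variable enter: the order of vanishing along the line of
  constant \<open>z\<close> is at least the full vanishing order.\<close>

lemma low_det_if_vanishing_order:
  assumes "z \<noteq> 0" "w \<noteq> 0" and ord: "enat \<mu> \<le> vanishing_order (char_polynomial m n W) (z, w)"
  shows "low \<mu> (Determinant.det (fmat (6 * m * n)
     (\<lambda>i j. fps_entry m n W z (fps_const w + fps_X) (fisher_vertices m n ! i) (fisher_vertices m n ! j))))"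
  unfolding low_def
proof (intro allI impI)
  fix k assume k: "k < \<mu>"
  have "mixed_deriv 0 k (char_polynomial m n W) z w = 0"
  proof (rule ccontr)
    assume "mixed_deriv 0 k (char_polynomial m n W) z w \<noteq> 0"
    then have "vanishing_order (char_polynomial m n W) (z, w) \<le> enat (0 + k)"
      unfolding vanishing_order_def prod.case by (intro INF_lower2[of "(0, k)"]) auto
    then have "enat \<mu> \<le> enat k" using order_trans[OF ord, of "enat k"] by simp
    then show False using k by simp
  qed
  then have "(deriv ^^ k) (char_polynomial m n W z) w = 0" by (simp add: mixed_deriv_def)
  then have "(deriv ^^ k) (\<lambda>h. char_polynomial m n W z (w + h)) 0 = 0"
    unfolding higher_deriv_shift_0[of k _ w] by (simp add: o_def)
  then show "fps_nth (Determinant.det (fmat (6 * m * n)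
     (\<lambda>i j. fps_entry m n W z (fps_const w + fps_X) (fisher_vertices m n ! i) (fisher_vertices m n ! j)))) k = 0"
    unfolding fps_nth_fps_expansion[OF char_polynomial_expansion[OF assms(1,2)]] by simp
qed

lemma char_polynomial_holomorphic:
  "w \<noteq> 0 \<Longrightarrow> (\<lambda>z. char_polynomial m n W z w) holomorphic_on - {0}"
  "z \<noteq> 0 \<Longrightarrow> char_polynomial m n W z holomorphic_on - {0}"
proof -
  have f1: "w \<noteq> 0 \<Longrightarrow> (\<lambda>z. edge_factor m n z w e) holomorphic_on - {0}"
    "w \<noteq> 0 \<Longrightarrow> (\<lambda>z. inverse (edge_factor m n z w e)) holomorphic_on - {0}" for w e
    by (cases "e \<in> z_edges m n"; cases "e \<in> w_edges m n"; auto simp: edge_factor_def intro!: holomorphic_intros)+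
  have f2: "z \<noteq> 0 \<Longrightarrow> (\<lambda>w. edge_factor m n z w e) holomorphic_on - {0}"
    "z \<noteq> 0 \<Longrightarrow> (\<lambda>w. inverse (edge_factor m n z w e)) holomorphic_on - {0}" for z e
    by (cases "e \<in> z_edges m n"; cases "e \<in> w_edges m n"; auto simp: edge_factor_def intro!: holomorphic_intros)+
  have k1: "w \<noteq> 0 \<Longrightarrow> (\<lambda>z. kasteleyn_entry m n W z w u v) holomorphic_on - {0}" for u v w
    by (cases "(u, v) \<in> oriented_edges m n"; cases "(v, u) \<in> oriented_edges m n";
        simp add: kasteleyn_entry_def; intro holomorphic_intros f1)
  have k2: "z \<noteq> 0 \<Longrightarrow> (\<lambda>w. kasteleyn_entry m n W z w u v) holomorphic_on - {0}" for u v z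
    by (cases "(u, v) \<in> oriented_edges m n"; cases "(v, u) \<in> oriented_edges m n";
        simp add: kasteleyn_entry_def; intro holomorphic_intros f2)
  show "w \<noteq> 0 \<Longrightarrow> (\<lambda>z. char_polynomial m n W z w) holomorphic_on - {0}"
    unfolding char_polynomial_fmat det_fmat by (intro holomorphic_intros k1)
  show "z \<noteq> 0 \<Longrightarrow> char_polynomial m n W z holomorphic_on - {0}"
    unfolding char_polynomial_fmat det_fmat by (intro holomorphic_intros k2)
qed

lemma char_polynomial_cnj: "char_polynomial m n W (cnj z) (cnj w) = cnj (char_polynomial m n W z w)"
proof -
  have "kasteleyn_entry m n W (cnj z) (cnj w) u v = cnj (kasteleyn_entry m n W z w u v)" for u v
    by (simp add: kasteleyn_entry_def edge_factor_def)
  moreover have "cnj (signof p) = signof p" for p :: "nat \<Rightarrow> nat" by (simp add: sign_def)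
  ultimately show ?thesis unfolding char_polynomial_fmat det_fmat by simp
qed

lemma char_polynomial_real_on_torus:
  assumes "cmod z = 1" "cmod w = 1"
  shows "cnj (char_polynomial m n W z w) = char_polynomial m n W z w"
proof -
  have inv: "inverse z = cnj z" "inverse w = cnj w"
    using assms by (metis complex_norm_square inverse_unique mult.commute of_real_1 one_power2)+
  have inv': "inverse (cnj z) = z" "inverse (cnj w) = w"
    using inv by (metis inverse_inverse_eq)+
  have E: "cnj (kasteleyn_entry m n W z w u v) = - kasteleyn_entry m n W z w v u" for u v
    using oriented_edges_antisym[of u v m n] by (auto simp: kasteleyn_entry_def edge_factor_def inv inv')
  let ?N = "6 * m * n"
  let ?K = "fmat ?N (\<lambda>i j. kasteleyn_entry m n W z w (fisher_vertices m n ! i) (fisher_vertices m n ! j))"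
  let ?K' = "fmat ?N (\<lambda>i j. cnj (kasteleyn_entry m n W z w (fisher_vertices m n ! i) (fisher_vertices m n ! j)))"
  have "cnj (signof p) = signof p" for p :: "nat \<Rightarrow> nat" by (simp add: sign_def)
  then have "cnj (Determinant.det ?K) = Determinant.det ?K'"
    unfolding det_fmat by simp
  also have "?K' = (- 1) \<cdot>\<^sub>m transpose_mat ?K"
    by (rule eq_matI) (auto simp: fmat_def E)
  also have "Determinant.det \<dots> = (- 1) ^ ?N * Determinant.det (transpose_mat ?K)"
    by (simp add: det_smult fmat_def)
  also have "\<dots> = Determinant.det ?K"
    by (simp add: det_transpose[OF fmat_carrier])
  finally show ?thesis unfolding char_polynomial_fmat .
qed

section \<open>Counting zeros on a torus\<close>

text \<open>A total above two contains three distinct points, a double point with a companion, or a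
  triple point.\<close>

lemma torus_count:
  fixes f :: "'a \<Rightarrow> enat"
  assumes one: "\<And>p. p \<in> S \<Longrightarrow> 1 \<le> f p"
    and three: "\<And>p q r. p \<in> S \<Longrightarrow> q \<in> S \<Longrightarrow> r \<in> S \<Longrightarrow> p \<noteq> q \<Longrightarrow> p \<noteq> r \<Longrightarrow> q \<noteq> r \<Longrightarrow> False"
    and two: "\<And>p q. p \<in> S \<Longrightarrow> q \<in> S \<Longrightarrow> p \<noteq> q \<Longrightarrow> 2 \<le> f p \<Longrightarrow> False"
    and triple: "\<And>p. p \<in> S \<Longrightarrow> 3 \<le> f p \<Longrightarrow> False"
  shows "finite S \<and> (\<Sum>p\<in>S. f p) \<le> 2"
proof -
  have le2: "f p \<le> 2" if "p \<in> S" for p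
  proof -
    have "\<not> 3 \<le> f p" using triple[OF that] by blast
    then show ?thesis by (cases "f p") (auto simp: numeral_eq_enat)
  qed
  have le1: "f p \<le> 1" if "p \<in> S" "q \<in> S" "p \<noteq> q" for p q
  proof -
    have "\<not> 2 \<le> f p" using two[OF that] by blast
    then show ?thesis by (cases "f p") (auto simp: numeral_eq_enat one_enat_def)
  qed
  consider "S = {}" | p where "S = {p}" | p q where "p \<in> S" "q \<in> S" "p \<noteq> q" by blast
  then show ?thesis
  proof cases
    case (3 p q)
    then have "S = {p, q}" using three by blast
    moreover have "f p + f q \<le> 1 + 1" using 3 le1 by (intro add_mono) auto
    ultimately show ?thesis using 3(3) by (simp add: one_add_one)
  qed (use le2 in auto)
qed

section \<open>Separating functions by their multipliers\<close>

definition ydiff :: "int \<Rightarrow> complex \<Rightarrow> (int \<Rightarrow> int \<Rightarrow> complex) \<Rightarrow> int \<Rightarrow> int \<Rightarrow> complex" where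
  "ydiff k w f = (\<lambda>a b. f (a + k) (b + k) - w * f a b)"

lemma ydiff_pow_linear:
  "(ydiff k w ^^ d) (\<lambda>a b. \<alpha> * f a b + \<gamma> * g a b) = (\<lambda>a b. \<alpha> * (ydiff k w ^^ d) f a b + \<gamma> * (ydiff k w ^^ d) g a b)"
proof (induction d)
  case (Suc d)
  then show ?case by (simp add: ydiff_def[of k w] algebra_simps)
qed simp

lemma ydiff_pow_eigen:
  assumes "\<And>a b. f (a + k) (b + k) = w' * f a b"
  shows "(ydiff k w ^^ d) f = (\<lambda>a b. (w' - w) ^ d * f a b)"
proof (induction d)
  case (Suc d)
  then show ?case by (simp add: ydiff_def[of k w] assms algebra_simps)
qed simp

lemma ydiff_pow_0: "(ydiff k w ^^ d) (\<lambda>_ _. 0) = (\<lambda>_ _. 0)"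
  by (induction d) (simp_all add: ydiff_def[of k w])

text \<open>An exact eigenfunction in one direction and a generalized one in the other, because only
  \<open>w\<close> is deformed.\<close>

definition generalized :: "int \<Rightarrow> int \<Rightarrow> complex \<Rightarrow> complex \<Rightarrow> nat \<Rightarrow> (int \<Rightarrow> int \<Rightarrow> complex) \<Rightarrow> bool" where
  "generalized n m z w d f \<longleftrightarrow> (\<forall>a b. f (a + n) (b - n) = z * f a b) \<and> (ydiff m w ^^ d) f = (\<lambda>_ _. 0)"

lemma generalized_linear:
  "generalized n m z w d f \<Longrightarrow> generalized n m z w d g \<Longrightarrow> generalized n m z w d (\<lambda>a b. \<alpha> * f a b + \<gamma> * g a b)"
  by (simp add: generalized_def ydiff_pow_linear algebra_simps)

lemma generalized_mono:
  assumes "generalized n m z w d f" "d \<le> e"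
  shows "generalized n m z w e f"
proof -
  have "(ydiff m w ^^ e) f = (ydiff m w ^^ (e - d)) ((ydiff m w ^^ d) f)"
    using assms(2) by (metis comp_apply funpow_add le_add_diff_inverse2)
  then show ?thesis using assms(1) by (simp add: generalized_def ydiff_pow_0)
qed

lemma generalized_1:
  "generalized n m z w 1 f \<longleftrightarrow> (\<forall>a b. f (a + n) (b - n) = z * f a b \<and> f (a + m) (b + m) = w * f a b)"
  by (auto simp: generalized_def ydiff_def fun_eq_iff)

text \<open>Either the multipliers \<open>z\<close> and \<open>z'\<close> differ, or the operator
  that annihilates \<open>f\<close> acts on \<open>g\<close> by the nonzero scalar
  \<open>(w' - w) ^ d\<close>.\<close>

lemma generalized_separate:
  assumes f: "generalized n m z w d f" and g: "generalized n m z' w' 1 g" and ne: "(z, w) \<noteq> (z', w')"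
    and rel: "\<And>a b. f a b + g a b = 0"
  shows "g a b = 0"
proof (cases "z = z'")
  case False
  have "f (a + n) (b - n) + g (a + n) (b - n) = 0" by (rule rel)
  then have "z * f a b + z' * g a b = 0" using f g unfolding generalized_1 by (simp add: generalized_def)
  moreover have "f a b = - g a b" using rel[of a b] by (simp add: add_eq_0_iff)
  ultimately have "(z' - z) * g a b = 0" by (simp add: algebra_simps)
  then show ?thesis using False by simp
next
  case True
  then have w: "w' - w \<noteq> 0" using ne by simp
  have "f = (\<lambda>a b. (- 1) * g a b + 0 * g a b)" using rel by (simp add: fun_eq_iff add_eq_0_iff)
  then have "(ydiff m w ^^ d) f = (\<lambda>a b. - ((w' - w) ^ d * g a b))"
    using g unfolding generalized_1 by (simp only: ydiff_pow_linear) (simp add: ydiff_pow_eigen[where w' = w'])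
  then have "(ydiff m w ^^ d) f a b = - ((w' - w) ^ d * g a b)" by simp
  moreover have "(ydiff m w ^^ d) f a b = 0" using f by (simp add: generalized_def)
  ultimately show ?thesis using w by simp
qed

text \<open>A shift that separates \<open>f1\<close> from \<open>f3\<close> eliminates
  \<open>f1\<close> and keeps a nonzero multiple of \<open>f3\<close>. The points of
  \<open>f1\<close> and \<open>f2\<close> may coincide.\<close>

lemma eigen_separate_three:
  assumes f: "generalized n m z1 w1 1 f1" "generalized n m z2 w2 1 f2" "generalized n m z3 w3 1 f3"
    and ne: "(z1, w1) \<noteq> (z3, w3)" "(z2, w2) \<noteq> (z3, w3)"
    and rel: "\<And>a b. f1 a b + f2 a b + f3 a b = 0"
  shows "f3 a b = 0"
proof -
  obtain t2 t3 where t: "t3 \<noteq> 0" "\<And>a b. t2 * f2 a b + t3 * f3 a b = 0"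
  proof (cases "z1 = z3")
    case False
    have "(z2 - z1) * f2 a b + (z3 - z1) * f3 a b = 0" for a b
    proof -
      have "f1 (a + n) (b - n) + f2 (a + n) (b - n) + f3 (a + n) (b - n) = 0" by (rule rel)
      then have "z1 * f1 a b + z2 * f2 a b + z3 * f3 a b = 0" using f unfolding generalized_1 by simp
      moreover have "f1 a b = - f2 a b - f3 a b" using rel[of a b] by (simp add: algebra_simps eq_neg_iff_add_eq_0)
      ultimately show ?thesis by (simp add: algebra_simps)
    qed
    then show ?thesis using that[of "z3 - z1" "z2 - z1"] False by simp
  next
    case True
    have "(w2 - w1) * f2 a b + (w3 - w1) * f3 a b = 0" for a b
    proof -
      have "f1 (a + m) (b + m) + f2 (a + m) (b + m) + f3 (a + m) (b + m) = 0" by (rule rel)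
      then have "w1 * f1 a b + w2 * f2 a b + w3 * f3 a b = 0" using f unfolding generalized_1 by simp
      moreover have "f1 a b = - f2 a b - f3 a b" using rel[of a b] by (simp add: algebra_simps eq_neg_iff_add_eq_0)
      ultimately show ?thesis by (simp add: algebra_simps)
    qed
    then show ?thesis using that[of "w3 - w1" "w2 - w1"] True ne(1) by simp
  qed
  have "generalized n m z2 w2 1 (\<lambda>a b. t2 * f2 a b)" "generalized n m z3 w3 1 (\<lambda>a b. t3 * f3 a b)"
    using f unfolding generalized_1 by simp_all
  then have "t3 * f3 a b = 0" using ne(2) t(2) by (rule generalized_separate[where f = "\<lambda>a b. t2 * f2 a b" and g = "\<lambda>a b. t3 * f3 a b"])
  then show ?thesis using t(1) by simp
qed

definition ctdiff :: "int \<Rightarrow> real \<Rightarrow> (int \<Rightarrow> int \<Rightarrow> complex) \<Rightarrow> int \<Rightarrow> int \<Rightarrow> complex" where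
  "ctdiff k \<sigma> f = (\<lambda>a b. f (a + k) (b + k) / of_real \<sigma> - f a b)"

lemma ctdiff_pow_linear:
  "(ctdiff k \<sigma> ^^ d) (\<lambda>a b. \<alpha> * f a b + \<gamma> * g a b) = (\<lambda>a b. \<alpha> * (ctdiff k \<sigma> ^^ d) f a b + \<gamma> * (ctdiff k \<sigma> ^^ d) g a b)"
proof (induction d)
  case (Suc d)
  then show ?case by (simp add: ctdiff_def[of k \<sigma>] algebra_simps add_divide_distrib)
qed simp

lemma tdiff_Re_Im:
  "(tdiff k \<sigma> ^^ d) (\<lambda>a b. Re (f a b)) = (\<lambda>a b. Re ((ctdiff k \<sigma> ^^ d) f a b))"
  "(tdiff k \<sigma> ^^ d) (\<lambda>a b. Im (f a b)) = (\<lambda>a b. Im ((ctdiff k \<sigma> ^^ d) f a b))"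
  by (induction d; simp add: tdiff_def[of k \<sigma>] ctdiff_def[of k \<sigma>])+

text \<open>With \<open>T\<close> the shift by \<open>(m, m)\<close>, the operator
  \<open>T\<^sup>2 / w\<^sup>2 - 1\<close> is divisible by \<open>T - w\<close>. Squaring makes real
  multipliers positive and merges points that differ only in signs.\<close>

lemma generalized_imp_ctdiff:
  assumes "generalized n m z w d f" "w \<noteq> 0" "w\<^sup>2 = of_real \<sigma>"
  shows "(ctdiff (2 * m) \<sigma> ^^ d) f = (\<lambda>_ _. 0)"
proof -
  have *: "(ydiff m w ^^ d) f = (\<lambda>_ _. 0) \<Longrightarrow> (ctdiff (2 * m) \<sigma> ^^ d) f = (\<lambda>_ _. 0)" for f
  proof (induction d arbitrary: f)
    case (Suc d)
    let ?g = "ydiff m w f"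
    have "ctdiff (2 * m) \<sigma> f = (\<lambda>a b. (1 / w\<^sup>2) * ydiff m w ?g a b + (2 * w / w\<^sup>2) * ?g a b)"
      using assms(2) by (simp add: ctdiff_def ydiff_def assms(3) [symmetric] fun_eq_iff field_simps power2_eq_square)
    moreover have g: "(ydiff m w ^^ d) ?g = (\<lambda>_ _. 0)" using Suc.prems by (simp add: funpow_Suc_right del: funpow.simps)
    moreover have "(ydiff m w ^^ d) (ydiff m w ?g) = ydiff m w ((ydiff m w ^^ d) ?g)"
      by (simp add: funpow_swap1)
    ultimately have "(ydiff m w ^^ d) (ctdiff (2 * m) \<sigma> f) = (\<lambda>_ _. 0)"
      by (simp only: ydiff_pow_linear) (simp add: ydiff_def)
    then have "(ctdiff (2 * m) \<sigma> ^^ d) (ctdiff (2 * m) \<sigma> f) = (\<lambda>_ _. 0)" by (rule Suc.IH)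
    then show ?case by (simp add: funpow_Suc_right del: funpow.simps)
  qed simp
  show ?thesis using assms(1) * by (simp add: generalized_def)
qed

section \<open>Dimension bounds for generalized eigenfunctions\<close>

context gates begin

text \<open>By induction the shift minus \<open>w\<close> maps the solution to an eigenfunction; if
  that were nonzero, the two would form an excluded Jordan chain.\<close>

lemma generalized_eq_1_if_nonreal:
  assumes "gate_solution c s x y" "n > 0" "m > 0"
    and per: "\<And>a b. c (a + m) (b + m) = c a b" "\<And>a b. s (a + m) (b + m) = s a b"
    and zw: "z \<noteq> 0" "w \<noteq> 0" and nonreal: "z \<notin> \<real> \<or> w \<notin> \<real>"
  shows "generalized n m z w d x \<Longrightarrow> generalized n m z w d y \<Longrightarrow> generalized n m z w 1 x \<and> generalized n m z w 1 y"
  using assms(1)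
proof (induction d arbitrary: x y)
  case 0
  then show ?case by (meson generalized_mono zero_le)
next
  case (Suc d)
  let ?x = "ydiff m w x" and ?y = "ydiff m w y"
  have sol: "gate_solution c s ?x ?y"
    using Suc.prems(3) unfolding gate_solution_def ydiff_def
  proof (intro allI)
    fix a b
    assume "\<forall>a b. y a (b + 1) = c a b *\<^sub>R x a b + s a b *\<^sub>R y a b \<and> x (a + 1) b = s a b *\<^sub>R x a b + c a b *\<^sub>R y a b"
    note e = this[rule_format, of a b] this[rule_format, of "a + m" "b + m"]
    have "b + 1 + m = b + m + 1" "a + 1 + m = a + m + 1" by simp_all
    then show "y (a + m) (b + 1 + m) - w * y a (b + 1) = c a b *\<^sub>R (x (a + m) (b + m) - w * x a b) + s a b *\<^sub>R (y (a + m) (b + m) - w * y a b) \<and>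
      x (a + 1 + m) (b + m) - w * x (a + 1) b = s a b *\<^sub>R (x (a + m) (b + m) - w * x a b) + c a b *\<^sub>R (y (a + m) (b + m) - w * y a b)"
      using e by (simp add: per scaleR_conv_of_real algebra_simps)
  qed
  have "generalized n m z w d (ydiff m w f)" if "generalized n m z w (Suc d) f" for f
  proof -
    have "f (a + n + m) (b - n + m) = z * f (a + m) (b + m)" for a b
    proof -
      have "f ((a + m) + n) ((b + m) - n) = z * f (a + m) (b + m)" using that unfolding generalized_def by blast
      moreover have "(a + m) + n = a + n + m" "(b + m) - n = b - n + m" by simp_all
      ultimately show ?thesis by simp
    qed
    then show ?thesis
      using that unfolding generalized_def funpow_Suc_right o_apply
      by (simp add: ydiff_def[of m w f] algebra_simps)
  qed
  then have g: "generalized n m z w d ?x" "generalized n m z w d ?y"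
    using Suc.prems(1,2) by blast+
  from Suc.IH[OF g sol] have e: "generalized n m z w 1 ?x" "generalized n m z w 1 ?y" by simp_all
  have "\<not> (\<exists>a b. ?x a b \<noteq> 0 \<or> ?y a b \<noteq> 0)"
  proof
    assume nz: "\<exists>a b. ?x a b \<noteq> 0 \<or> ?y a b \<noteq> 0"
    show False
      by (rule no_nonreal_jordan_chain[OF sol Suc.prems(3) assms(2,3) _ _ _ _ _ zw nonreal nz])
        (use e Suc.prems(1,2) in \<open>simp_all add: generalized_1[unfolded One_nat_def] quasi_def generalized_def[of _ _ _ _ "Suc d"], simp_all add: ydiff_def\<close>)
  qed
  then have "?x = (\<lambda>_ _. 0)" "?y = (\<lambda>_ _. 0)" by (auto simp: fun_eq_iff)
  then show ?case using Suc.prems(1,2) by (simp add: generalized_def)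
qed

text \<open>Three coefficients suffice to annihilate both inputs of one gate;
  \<open>real_zero_gate\<close> then annihilates the real and the imaginary part of the combination
  everywhere. Doubled periods provide the positive multipliers it asks for.\<close>

lemma three_real_solutions:
  assumes sol: "gate_solution c s x1 y1" "gate_solution c s x2 y2" "gate_solution c s x3 y3"
    and per: "\<And>a b. c (a + 2 * m) (b + 2 * m) = c a b" "\<And>a b. s (a + 2 * m) (b + 2 * m) = s a b"
    and nm: "n > 0" "m > 0" and \<rho>: "\<rho> > 0" and \<sigma>: "\<sigma> > 0"
    and zw: "z1\<^sup>2 = of_real \<rho>" "z2\<^sup>2 = of_real \<rho>" "z3\<^sup>2 = of_real \<rho>" "w1\<^sup>2 = of_real \<sigma>" "w2\<^sup>2 = of_real \<sigma>" "w3\<^sup>2 = of_real \<sigma>"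
    and g: "generalized n m z1 w1 d x1" "generalized n m z1 w1 d y1" "generalized n m z2 w2 d x2" "generalized n m z2 w2 d y2"
      "generalized n m z3 w3 d x3" "generalized n m z3 w3 d y3"
  shows "\<exists>c1 c2 c3. (c1, c2, c3) \<noteq> (0, 0, 0) \<and>
    (\<forall>a b. c1 * x1 a b + c2 * x2 a b + c3 * x3 a b = 0 \<and> c1 * y1 a b + c2 * y2 a b + c3 * y3 a b = 0)"
proof -
  obtain c1 c2 c3 where ne: "(c1, c2, c3) \<noteq> (0, 0, 0)"
    and zero: "c1 * x1 0 0 + c2 * x2 0 0 + c3 * x3 0 0 = 0" "c1 * y1 0 0 + c2 * y2 0 0 + c3 * y3 0 0 = 0"
    by (rule common_annihilator)
  define x where "x = (\<lambda>a b. c1 * x1 a b + 1 * (c2 * x2 a b + c3 * x3 a b))"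
  define y where "y = (\<lambda>a b. c1 * y1 a b + 1 * (c2 * y2 a b + c3 * y3 a b))"
  have w0: "w1 \<noteq> 0" "w2 \<noteq> 0" "w3 \<noteq> 0" using zw \<sigma> by auto
  have T: "(ctdiff (2 * m) \<sigma> ^^ d) x = (\<lambda>_ _. 0)" "(ctdiff (2 * m) \<sigma> ^^ d) y = (\<lambda>_ _. 0)"
    unfolding x_def y_def ctdiff_pow_linear
    using g w0 zw by (simp_all add: generalized_imp_ctdiff[where w = w1] generalized_imp_ctdiff[where w = w2] generalized_imp_ctdiff[where w = w3])
  have two: "f (a + 2 * n) (b - 2 * n) = of_real \<rho> * f a b" if "generalized n m z w d f" "z\<^sup>2 = of_real \<rho>" for z w f a b
  proof -
    have "f (a + n + n) (b - n - n) = z * (z * f a b)" using that(1) unfolding generalized_def by metis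
    moreover have "z * (z * f a b) = of_real \<rho> * f a b" unfolding that(2) [symmetric] by (simp add: power2_eq_square)
    moreover have "a + n + n = a + 2 * n" "b - n - n = b - 2 * n" by simp_all
    ultimately show ?thesis by (simp only:)
  qed
  have X: "x (a + 2 * n) (b - 2 * n) = of_real \<rho> * x a b" "y (a + 2 * n) (b - 2 * n) = of_real \<rho> * y a b" for a b
    unfolding x_def y_def
    using two[OF g(1) zw(1)] two[OF g(2) zw(1)] two[OF g(3) zw(2)] two[OF g(4) zw(2)] two[OF g(5) zw(3)] two[OF g(6) zw(3)]
    by (simp_all add: algebra_simps)
  have xy: "gate_solution c s x y"
    using sol unfolding gate_solution_def x_def y_def by (simp add: scaleR_conv_of_real algebra_simps)
  have R: "gate_solution c s (\<lambda>a b. Re (x a b)) (\<lambda>a b. Re (y a b))" "gate_solution c s (\<lambda>a b. Im (x a b)) (\<lambda>a b. Im (y a b))"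
    using xy unfolding gate_solution_def by simp_all
  have z: "Re (x 0 0) = 0" "Re (y 0 0) = 0" "Im (x 0 0) = 0" "Im (y 0 0) = 0"
    using zero by (simp_all only: x_def y_def mult_1 add.assoc zero_complex.sel)
  have "2 * n > 0" "2 * m > 0" using nm by simp_all
  note zg = real_zero_gate[where k = "2 * m" and p = "2 * n" and D = d, OF _ per this \<rho> \<sigma>]
  have "Re (x a b) = 0 \<and> Re (y a b) = 0" for a b
    by (rule zg[OF R(1), where ?a0.0 = 0 and ?b0.0 = 0]) (simp_all add: X T z tdiff_Re_Im)
  moreover have "Im (x a b) = 0 \<and> Im (y a b) = 0" for a b
    by (rule zg[OF R(2), where ?a0.0 = 0 and ?b0.0 = 0]) (simp_all add: X T z tdiff_Re_Im)
  ultimately have "x a b = 0 \<and> y a b = 0" for a b by (simp add: complex_eq_iff)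
  then show ?thesis using ne unfolding x_def y_def by (intro exI[of _ c1] exI[of _ c2] exI[of _ c3]) (simp add: add.assoc)
qed

end

lemma vanishing_order_ge_1: "F z w = 0 \<Longrightarrow> 1 \<le> vanishing_order F (z, w)"
proof -
  assume "F z w = 0"
  then have "mixed_deriv 0 0 F z w = 0" by (simp add: mixed_deriv_def)
  then have "(1::enat) \<le> enat (i + j)" if "mixed_deriv i j F z w \<noteq> 0" for i j
    using that by (cases "i + j = 0") (auto simp: one_enat_def)
  then show "1 \<le> vanishing_order F (z, w)"
    unfolding vanishing_order_def prod.case by (intro INF_greatest) auto
qed

section \<open>Gate solutions attached to a zero of \<open>P\<close>\<close>

context toroidal_fisher begin

abbreviation "P \<equiv> char_polynomial m n W"
abbreviation "signed w \<equiv> of_real (parity_sign (int m)) * w :: complex"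

definition generalized_solution :: "complex \<Rightarrow> complex \<Rightarrow> nat \<Rightarrow> (int \<Rightarrow> int \<Rightarrow> complex) \<Rightarrow> (int \<Rightarrow> int \<Rightarrow> complex) \<Rightarrow> bool" where
  "generalized_solution z w d x y \<longleftrightarrow> gate_solution (gate_c B C) (gate_s B C) x y \<and>
     generalized (int n) (int m) z (signed w) d x \<and> generalized (int n) (int m) z (signed w) d y"

text \<open>The top members of the chains are used, one for each independent truncated kernel
  vector; the position in the chain bounds the order of nilpotency.\<close>

lemma generalized_solution_solutions:
  assumes z: "z \<noteq> 0" and w: "w \<noteq> 0" and ord: "enat \<mu> \<le> vanishing_order P (z, w)"
  shows "\<exists>x y. (\<forall>i<\<mu>. generalized_solution z w \<mu> (x i) (y i)) \<and>
    (\<forall>c. (\<forall>a b. (\<Sum>i<\<mu>. c i * x i a b) = 0 \<and> (\<Sum>i<\<mu>. c i * y i a b) = 0) \<longrightarrow> (\<forall>i<\<mu>. c i = 0))"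
proof -
  from gate_chains[OF z w low_det_if_vanishing_order[OF z w ord]] obtain x y where
    sol: "\<And>i \<nu>. i < \<mu> \<Longrightarrow> \<nu> < \<mu> \<Longrightarrow> gate_solution (gate_c B C) (gate_s B C) (x i \<nu>) (y i \<nu>)"
    and q: "\<And>i \<nu>. i < \<mu> \<Longrightarrow> \<nu> < \<mu> \<Longrightarrow> quasi (int n) (- int n) z (x i \<nu>) (y i \<nu>)"
    and Y: "\<And>i \<nu> a b. i < \<mu> \<Longrightarrow> \<nu> < \<mu> \<Longrightarrow>
        x i \<nu> (a + int m) (b + int m) = signed w * x i \<nu> a b + (if \<nu> = 0 then 0 else x i (\<nu> - 1) a b)"
      "\<And>i \<nu> a b. i < \<mu> \<Longrightarrow> \<nu> < \<mu> \<Longrightarrow>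
        y i \<nu> (a + int m) (b + int m) = signed w * y i \<nu> a b + (if \<nu> = 0 then 0 else y i (\<nu> - 1) a b)"
    and ind: "\<And>c. \<forall>a b. (\<Sum>i<\<mu>. c i * x i (\<mu> - 1) a b) = 0 \<and> (\<Sum>i<\<mu>. c i * y i (\<mu> - 1) a b) = 0 \<Longrightarrow> \<forall>i<\<mu>. c i = 0"
    by blast
  have nil: "(ydiff (int m) (signed w) ^^ Suc \<nu>) (f \<nu>) = (\<lambda>_ _. 0)"
    if "\<nu> < \<mu>" "\<And>\<nu> a b. \<nu> < \<mu> \<Longrightarrow> f \<nu> (a + int m) (b + int m) = signed w * f \<nu> a b + (if \<nu> = 0 then 0 else f (\<nu> - 1) a b)"
    for f :: "nat \<Rightarrow> int \<Rightarrow> int \<Rightarrow> complex" and \<nu>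
    using that(1)
  proof (induction \<nu>)
    case 0
    then show ?case by (simp add: ydiff_def that(2))
  next
    case (Suc \<nu>)
    have "ydiff (int m) (signed w) (f (Suc \<nu>)) = f \<nu>" using Suc.prems by (simp add: ydiff_def that(2))
    then show ?case using Suc by (simp add: funpow_Suc_right del: funpow.simps)
  qed
  have "generalized_solution z w \<mu> (x i (\<mu> - 1)) (y i (\<mu> - 1))" if i: "i < \<mu>" for i
  proof -
    have \<mu>: "\<mu> - 1 < \<mu>" "Suc (\<mu> - 1) = \<mu>" using i by simp_all
    have "(ydiff (int m) (signed w) ^^ Suc (\<mu> - 1)) (x i (\<mu> - 1)) = (\<lambda>_ _. 0)"
      "(ydiff (int m) (signed w) ^^ Suc (\<mu> - 1)) (y i (\<mu> - 1)) = (\<lambda>_ _. 0)"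
      by (rule nil[where f = "x i"] nil[where f = "y i"], rule \<mu>(1), rule Y[OF i], assumption)+
    then show ?thesis
      using sol[OF i \<mu>(1)] q[OF i \<mu>(1)] unfolding \<mu>(2) generalized_solution_def generalized_def quasi_def by simp
  qed
  then have "\<forall>i<\<mu>. generalized_solution z w \<mu> (x i (\<mu> - 1)) (y i (\<mu> - 1))" by blast
  moreover have "\<forall>c. (\<forall>a b. (\<Sum>i<\<mu>. c i * x i (\<mu> - 1) a b) = 0 \<and> (\<Sum>i<\<mu>. c i * y i (\<mu> - 1) a b) = 0) \<longrightarrow> (\<forall>i<\<mu>. c i = 0)"
    using ind by blast
  ultimately show ?thesis
    by - (rule exI[of _ "\<lambda>i. x i (\<mu> - 1)"], rule exI[of _ "\<lambda>i. y i (\<mu> - 1)"], rule conjI; assumption)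
qed

lemma generalized_solution_zero:
  assumes "z \<noteq> 0" "w \<noteq> 0" "P z w = 0"
  obtains x y where "generalized_solution z w 1 x y" "\<exists>a b. x a b \<noteq> 0 \<or> y a b \<noteq> 0"
proof -
  have "enat 1 \<le> vanishing_order P (z, w)"
    using vanishing_order_ge_1[where F = P, OF assms(3)] by (simp add: one_enat_def)
  from generalized_solution_solutions[OF assms(1,2) this] obtain x y where g: "\<And>i. i < 1 \<Longrightarrow> generalized_solution z w 1 (x (i::nat)) (y i)"
    and ind: "\<And>c. \<forall>a b. (\<Sum>i<1. c i * x i a b) = 0 \<and> (\<Sum>i<1. c i * y i a b) = 0 \<Longrightarrow> \<forall>i<1. c (i::nat) = (0::complex)" by blast
  have "\<exists>a b. x 0 a b \<noteq> 0 \<or> y 0 a b \<noteq> 0"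
  proof (rule ccontr)
    assume "\<not> ?thesis"
    then have "\<forall>i<1. (\<lambda>_. 1 :: complex) (i::nat) = 0" by (intro ind) simp
    from this[rule_format, of 0] show False by simp
  qed
  moreover have "generalized_solution z w 1 (x 0) (y 0)" using g by simp
  ultimately show ?thesis using that by blast
qed

lemma generalized_solution_double:
  assumes "z \<noteq> 0" "w \<noteq> 0" "2 \<le> vanishing_order P (z, w)"
  obtains x1 y1 x2 y2 where "generalized_solution z w 2 x1 y1" "generalized_solution z w 2 x2 y2"
    "\<And>c1 c2. \<forall>a b. c1 * x1 a b + c2 * x2 a b = 0 \<and> c1 * y1 a b + c2 * y2 a b = 0 \<Longrightarrow> c1 = 0 \<and> c2 = 0"
proof -
  have "enat 2 \<le> vanishing_order P (z, w)" using assms(3) by (simp add: numeral_eq_enat)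
  from generalized_solution_solutions[OF assms(1,2) this] obtain x y where g: "\<And>i. i < 2 \<Longrightarrow> generalized_solution z w 2 (x (i::nat)) (y i)"
    and ind: "\<And>c. \<forall>a b. (\<Sum>i<2. c i * x i a b) = 0 \<and> (\<Sum>i<2. c i * y i a b) = 0 \<Longrightarrow> \<forall>i<2. c (i::nat) = (0::complex)" by blast
  show ?thesis
  proof (rule that[OF g[of 0] g[of 1]])
    fix c1 c2 assume "\<forall>a b. c1 * x 0 a b + c2 * x 1 a b = 0 \<and> c1 * y 0 a b + c2 * y 1 a b = 0"
    then have "\<forall>i<2. (\<lambda>i. if i = 0 then c1 else c2) (i::nat) = 0"
      by (intro ind) (simp add: numeral_2_eq_2)
    from this[rule_format, of 0] this[rule_format, of 1] show "c1 = 0 \<and> c2 = 0" by simp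
  qed simp_all
qed

lemma generalized_solution_triple:
  assumes "z \<noteq> 0" "w \<noteq> 0" "3 \<le> vanishing_order P (z, w)"
  obtains x1 y1 x2 y2 x3 y3 where "generalized_solution z w 3 x1 y1" "generalized_solution z w 3 x2 y2" "generalized_solution z w 3 x3 y3"
    "\<And>c1 c2 c3. \<forall>a b. c1 * x1 a b + c2 * x2 a b + c3 * x3 a b = 0 \<and> c1 * y1 a b + c2 * y2 a b + c3 * y3 a b = 0 \<Longrightarrow>
      c1 = 0 \<and> c2 = 0 \<and> c3 = 0"
proof -
  have "enat 3 \<le> vanishing_order P (z, w)" using assms(3) by (simp add: numeral_eq_enat)
  from generalized_solution_solutions[OF assms(1,2) this] obtain x y where g: "\<And>i. i < 3 \<Longrightarrow> generalized_solution z w 3 (x (i::nat)) (y i)"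
    and ind: "\<And>c. \<forall>a b. (\<Sum>i<3. c i * x i a b) = 0 \<and> (\<Sum>i<3. c i * y i a b) = 0 \<Longrightarrow> \<forall>i<3. c (i::nat) = (0::complex)" by blast
  show ?thesis
  proof (rule that[OF g[of 0] g[of 1] g[of 2]])
    fix c1 c2 c3 assume "\<forall>a b. c1 * x 0 a b + c2 * x 1 a b + c3 * x 2 a b = 0 \<and> c1 * y 0 a b + c2 * y 1 a b + c3 * y 2 a b = 0"
    then have "\<forall>i<3. (\<lambda>i. if i = 0 then c1 else if i = 1 then c2 else c3) (i::nat) = 0"
      by (intro ind) (simp add: numeral_3_eq_3 numeral_2_eq_2)
    from this[rule_format, of 0] this[rule_format, of 1] this[rule_format, of 2] show "c1 = 0 \<and> c2 = 0 \<and> c3 = 0" by simp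
  qed simp_all
qed

lemma signed_inj: "signed w = signed w' \<longleftrightarrow> w = w'"
  by (simp add: parity_sign_def)

lemma signed_norm: "cmod (signed w) = cmod w"
  by (simp add: parity_sign_def norm_mult)

lemma signed_Reals: "signed w \<in> \<real> \<longleftrightarrow> w \<in> \<real>"
  by (simp add: parity_sign_def)

lemma signed_sq: "(signed w)\<^sup>2 = w\<^sup>2"
  by (simp add: parity_sign_def power_mult_distrib)

lemma gate_periodic:
  "gate_c B C (a + int m) (b + int m) = gate_c B C a b" "gate_s B C (a + int m) (b + int m) = gate_s B C a b"
  using gate_shift[of 0 "int m" a b] by (simp_all add: BC_periodic)

lemma gate_periodic2:
  "gate_c B C (a + 2 * int m) (b + 2 * int m) = gate_c B C a b" "gate_s B C (a + 2 * int m) (b + 2 * int m) = gate_s B C a b"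
  using gate_periodic[of "a + int m" "b + int m"] gate_periodic[of a b] by (simp_all add: algebra_simps)

lemma generalized_solution_nonreal:
  assumes "generalized_solution z w d x y" "z \<noteq> 0" "w \<noteq> 0" "z \<notin> \<real> \<or> w \<notin> \<real>"
  shows "generalized_solution z w 1 x y"
proof -
  have "generalized (int n) (int m) z (signed w) 1 x \<and> generalized (int n) (int m) z (signed w) 1 y"
    by (rule generalized_eq_1_if_nonreal[where d = d])
      (use assms n1 m1 gate_periodic signed_Reals in \<open>auto simp: generalized_solution_def parity_sign_def\<close>)
  then show ?thesis using assms(1) unfolding generalized_solution_def by blast
qed

lemma three_eigen_relation:
  assumes g: "generalized_solution z1 w1 1 x1 y1" "generalized_solution z2 w2 1 x2 y2" "generalized_solution z3 w3 1 x3 y3"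
    and \<rho>: "\<rho> > 0" "cmod z1 = \<rho>" "cmod z2 = \<rho>" "cmod z3 = \<rho>"
    and \<sigma>: "\<sigma> > 0" "cmod w1 = \<sigma>" "cmod w2 = \<sigma>" "cmod w3 = \<sigma>"
  obtains c1 c2 c3 where "(c1, c2, c3) \<noteq> (0, 0, 0)"
    "\<forall>a b. c1 * x1 a b + c2 * x2 a b + c3 * x3 a b = 0 \<and> c1 * y1 a b + c2 * y2 a b + c3 * y3 a b = 0"
proof -
  have q: "quasi (int n) (- int n) z x y" "quasi (int m) (int m) (signed w) x y" "gate_solution (gate_c B C) (gate_s B C) x y"
    if "generalized_solution z w 1 x y" for z w x y
    using that unfolding generalized_solution_def generalized_1 quasi_def by simp_all
  have "\<exists>c1 c2 c3. (c1, c2, c3) \<noteq> (0, 0, 0) \<and>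
    (\<forall>a b. c1 * x1 a b + c2 * x2 a b + c3 * x3 a b = 0 \<and> c1 * y1 a b + c2 * y2 a b + c3 * y3 a b = 0)"
    by (rule three_eigensolutions[OF q(3)[OF g(1)] q(3)[OF g(2)] q(3)[OF g(3)] _ _
          q(1)[OF g(1)] q(1)[OF g(2)] q(1)[OF g(3)] q(2)[OF g(1)] q(2)[OF g(2)] q(2)[OF g(3)] \<rho> \<sigma>(1)])
      (use n1 m1 \<sigma> signed_norm in auto)
  then show ?thesis using that by blast
qed

lemma three_real_relation:
  assumes g: "generalized_solution z1 w1 d x1 y1" "generalized_solution z2 w2 d x2 y2" "generalized_solution z3 w3 d x3 y3"
    and \<rho>: "\<rho> > 0" "z1\<^sup>2 = of_real \<rho>" "z2\<^sup>2 = of_real \<rho>" "z3\<^sup>2 = of_real \<rho>"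
    and \<sigma>: "\<sigma> > 0" "w1\<^sup>2 = of_real \<sigma>" "w2\<^sup>2 = of_real \<sigma>" "w3\<^sup>2 = of_real \<sigma>"
  obtains c1 c2 c3 where "(c1, c2, c3) \<noteq> (0, 0, 0)"
    "\<forall>a b. c1 * x1 a b + c2 * x2 a b + c3 * x3 a b = 0 \<and> c1 * y1 a b + c2 * y2 a b + c3 * y3 a b = 0"
proof -
  have "\<exists>c1 c2 c3. (c1, c2, c3) \<noteq> (0, 0, 0) \<and>
    (\<forall>a b. c1 * x1 a b + c2 * x2 a b + c3 * x3 a b = 0 \<and> c1 * y1 a b + c2 * y2 a b + c3 * y3 a b = 0)"
    by (rule three_real_solutions[where n = "int n" and m = "int m" and \<rho> = \<rho> and \<sigma> = \<sigma> and d = d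
          and ?z1.0 = z1 and ?z2.0 = z2 and ?z3.0 = z3 and ?w1.0 = "signed w1" and ?w2.0 = "signed w2" and ?w3.0 = "signed w3"])
      (use g \<rho> \<sigma> n1 m1 in \<open>simp_all add: generalized_solution_def gate_periodic2 signed_sq\<close>)
  then show ?thesis using that by blast
qed

lemma generalized_solution_separate_three:
  assumes g: "generalized_solution z1 w1 1 x1 y1" "generalized_solution z2 w2 1 x2 y2" "generalized_solution z3 w3 1 x3 y3"
    and ne: "(z1, w1) \<noteq> (z3, w3)" "(z2, w2) \<noteq> (z3, w3)" and nz: "\<exists>a b. x3 a b \<noteq> 0 \<or> y3 a b \<noteq> 0"
    and rel: "\<forall>a b. c1 * x1 a b + c2 * x2 a b + c3 * x3 a b = 0 \<and> c1 * y1 a b + c2 * y2 a b + c3 * y3 a b = 0"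
  shows "c3 = 0"
proof -
  have s: "generalized (int n) (int m) z (signed w) 1 (\<lambda>a b. c * f a b)" if "generalized (int n) (int m) z (signed w) 1 f" for z w c f
    using that unfolding generalized_1 by simp
  have ne': "(z1, signed w1) \<noteq> (z3, signed w3)" "(z2, signed w2) \<noteq> (z3, signed w3)"
    using ne unfolding prod.inject signed_inj by blast+
  have "c3 * x3 a b = 0" for a b
    by (rule eigen_separate_three[where ?f1.0 = "\<lambda>a b. c1 * x1 a b" and ?f2.0 = "\<lambda>a b. c2 * x2 a b" and ?f3.0 = "\<lambda>a b. c3 * x3 a b", OF _ _ _ ne'])
      (use g rel in \<open>auto simp only: generalized_solution_def intro!: s\<close>)
  moreover have "c3 * y3 a b = 0" for a b
    by (rule eigen_separate_three[where ?f1.0 = "\<lambda>a b. c1 * y1 a b" and ?f2.0 = "\<lambda>a b. c2 * y2 a b" and ?f3.0 = "\<lambda>a b. c3 * y3 a b", OF _ _ _ ne'])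
      (use g rel in \<open>auto simp only: generalized_solution_def intro!: s\<close>)
  ultimately show ?thesis using nz by auto
qed

lemma generalized_solution_separate_two:
  assumes g: "generalized_solution z1 w1 d x1 y1" "generalized_solution z1 w1 d x2 y2" "generalized_solution z3 w3 1 x3 y3"
    and ne: "(z1, w1) \<noteq> (z3, w3)" and nz: "\<exists>a b. x3 a b \<noteq> 0 \<or> y3 a b \<noteq> 0"
    and rel: "\<forall>a b. c1 * x1 a b + c2 * x2 a b + c3 * x3 a b = 0 \<and> c1 * y1 a b + c2 * y2 a b + c3 * y3 a b = 0"
  shows "c3 = 0"
proof -
  have s: "generalized (int n) (int m) z (signed w) 1 (\<lambda>a b. c * f a b)" if "generalized (int n) (int m) z (signed w) 1 f" for z w c f
    using that unfolding generalized_1 by simp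
  have ne': "(z1, signed w1) \<noteq> (z3, signed w3)"
    using ne unfolding prod.inject signed_inj .
  have "c3 * x3 a b = 0" for a b
    by (rule generalized_separate[where d = d and f = "\<lambda>a b. c1 * x1 a b + c2 * x2 a b" and g = "\<lambda>a b. c3 * x3 a b", OF _ _ ne'])
      (use g rel in \<open>auto simp only: generalized_solution_def intro!: s generalized_linear\<close>)
  moreover have "c3 * y3 a b = 0" for a b
    by (rule generalized_separate[where d = d and f = "\<lambda>a b. c1 * y1 a b + c2 * y2 a b" and g = "\<lambda>a b. c3 * y3 a b", OF _ _ ne'])
      (use g rel in \<open>auto simp only: generalized_solution_def intro!: s generalized_linear\<close>)
  ultimately show ?thesis using nz by auto
qed

section \<open>The three excluded configurations of zeros\<close>

lemma torus_zero_facts: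
  assumes "(z, w) \<in> torus_zeros P r s" "r > 0" "s > 0"
  shows "z \<noteq> 0" "w \<noteq> 0" "cmod z = r" "cmod w = s" "P z w = 0"
  using assms by (auto simp: torus_zeros_def)

text \<open>One eigenfunction for each zero gives a linear relation, and different multipliers
  separate its terms.\<close>

lemma no_three_zeros:
  assumes rs: "r > 0" "s > 0" and p: "p1 \<in> torus_zeros P r s" "p2 \<in> torus_zeros P r s" "p3 \<in> torus_zeros P r s"
    and ne: "p1 \<noteq> p2" "p1 \<noteq> p3" "p2 \<noteq> p3"
  shows False
proof -
  obtain z1 w1 z2 w2 z3 w3 where e: "p1 = (z1, w1)" "p2 = (z2, w2)" "p3 = (z3, w3)" by (cases p1, cases p2, cases p3) blast
  note f1 = torus_zero_facts[OF p(1)[unfolded e] rs] and f2 = torus_zero_facts[OF p(2)[unfolded e] rs]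
    and f3 = torus_zero_facts[OF p(3)[unfolded e] rs]
  obtain x1 y1 where g1: "generalized_solution z1 w1 1 x1 y1" "\<exists>a b. x1 a b \<noteq> 0 \<or> y1 a b \<noteq> 0" by (rule generalized_solution_zero[OF f1(1,2,5)])
  obtain x2 y2 where g2: "generalized_solution z2 w2 1 x2 y2" "\<exists>a b. x2 a b \<noteq> 0 \<or> y2 a b \<noteq> 0" by (rule generalized_solution_zero[OF f2(1,2,5)])
  obtain x3 y3 where g3: "generalized_solution z3 w3 1 x3 y3" "\<exists>a b. x3 a b \<noteq> 0 \<or> y3 a b \<noteq> 0" by (rule generalized_solution_zero[OF f3(1,2,5)])
  obtain c1 c2 c3 where c: "(c1, c2, c3) \<noteq> (0, 0, 0)"
    "\<forall>a b. c1 * x1 a b + c2 * x2 a b + c3 * x3 a b = 0 \<and> c1 * y1 a b + c2 * y2 a b + c3 * y3 a b = 0"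
    by (rule three_eigen_relation[OF g1(1) g2(1) g3(1) rs(1) f1(3) f2(3) f3(3) rs(2) f1(4) f2(4) f3(4)])
  have "c3 = 0" by (rule generalized_solution_separate_three[OF g1(1) g2(1) g3(1) _ _ g3(2) c(2)]) (use ne e in auto)
  moreover have "c2 = 0"
    by (rule generalized_solution_separate_three[OF g1(1) g3(1) g2(1) _ _ g2(2), of c1 c3]) (use ne e c(2) in \<open>auto simp: algebra_simps\<close>)
  moreover have "c1 = 0"
    by (rule generalized_solution_separate_three[OF g2(1) g3(1) g1(1) _ _ g1(2), of c2 c3]) (use ne e c(2) in \<open>auto simp: algebra_simps\<close>)
  ultimately show False using c(1) by simp
qed

lemma real_square: "z \<in> \<real> \<Longrightarrow> z\<^sup>2 = of_real ((cmod z)\<^sup>2)"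
  by (elim Reals_cases) (simp flip: of_real_power)

lemma cnj_torus_zero: "(z, w) \<in> torus_zeros P r s \<Longrightarrow> (cnj z, cnj w) \<in> torus_zeros P r s"
  by (simp add: torus_zeros_def char_polynomial_cnj)

text \<open>If the double zero is nonreal, its two solutions are true eigenfunctions and the
  relation for equal moduli applies. If both zeros are real, the squared multipliers agree. In the
  mixed case the conjugate of the nonreal zero is a third distinct zero.\<close>

lemma no_double_zero_and_another:
  assumes rs: "r > 0" "s > 0" and p: "p \<in> torus_zeros P r s" "q \<in> torus_zeros P r s" and ne: "p \<noteq> q"
    and ord: "2 \<le> vanishing_order P p"
  shows False
proof -
  obtain z w z' w' where e: "p = (z, w)" "q = (z', w')" by (cases p, cases q) blast
  note f = torus_zero_facts[OF p(1)[unfolded e] rs] and f' = torus_zero_facts[OF p(2)[unfolded e] rs]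
  obtain x1 y1 x2 y2 where g: "generalized_solution z w 2 x1 y1" "generalized_solution z w 2 x2 y2"
    and ind: "\<And>c1 c2. \<forall>a b. c1 * x1 a b + c2 * x2 a b = 0 \<and> c1 * y1 a b + c2 * y2 a b = 0 \<Longrightarrow> c1 = 0 \<and> c2 = 0"
    by (rule generalized_solution_double[OF f(1,2) ord[unfolded e(1)]]) (rule that; assumption)
  obtain x3 y3 where g3: "generalized_solution z' w' 1 x3 y3" "\<exists>a b. x3 a b \<noteq> 0 \<or> y3 a b \<noteq> 0" by (rule generalized_solution_zero[OF f'(1,2,5)])
  have contra: False if c: "(c1, c2, c3) \<noteq> (0, 0, 0)"
    "\<forall>a b. c1 * x1 a b + c2 * x2 a b + c3 * x3 a b = 0 \<and> c1 * y1 a b + c2 * y2 a b + c3 * y3 a b = 0" for c1 c2 c3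
  proof -
    have c3: "c3 = 0" by (rule generalized_solution_separate_two[OF g g3(1) _ g3(2) c(2)]) (use ne e in auto)
    have "\<forall>a b. c1 * x1 a b + c2 * x2 a b = 0 \<and> c1 * y1 a b + c2 * y2 a b = 0"
      using c(2) unfolding c3 mult_zero_left add_0_right .
    then have "c1 = 0 \<and> c2 = 0" by (rule ind)
    then show False using c(1) c3 by simp
  qed
  show False
  proof (cases "z \<in> \<real> \<and> w \<in> \<real>")
    case False
    then have g1: "generalized_solution z w 1 x1 y1" "generalized_solution z w 1 x2 y2" using generalized_solution_nonreal g f by blast+
    show False
    proof -
      from three_eigen_relation[OF g1 g3(1) rs(1) f(3) f(3) f'(3) rs(2) f(4) f(4) f'(4)] obtain c1 c2 c3 where
        c: "(c1, c2, c3) \<noteq> (0, 0, 0)"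
        "\<forall>a b. c1 * x1 a b + c2 * x2 a b + c3 * x3 a b = 0 \<and> c1 * y1 a b + c2 * y2 a b + c3 * y3 a b = 0" .
      show False by (rule contra[OF c])
    qed
  next
    case True
    show False
    proof (cases "z' \<in> \<real> \<and> w' \<in> \<real>")
      case False
      then have "(cnj z', cnj w') \<noteq> (z', w')" "(cnj z', cnj w') \<noteq> (z, w)"
        using True by (auto simp: Reals_cnj_iff)
      then show False
        by (intro no_three_zeros[OF rs p cnj_torus_zero[OF p(2)[unfolded e(2)]] ne]) (auto simp: e)
    next
      case T': True
      have g3': "generalized_solution z' w' 2 x3 y3" using g3(1) unfolding generalized_solution_def by (metis generalized_mono one_le_numeral)
      show False
      proof -
        have sq: "z\<^sup>2 = of_real (r\<^sup>2)" "w\<^sup>2 = of_real (s\<^sup>2)" "r\<^sup>2 > 0" "s\<^sup>2 > 0"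
          using True f(3,4) real_square[of z] real_square[of w] rs by simp_all
        have sq': "z'\<^sup>2 = of_real (r\<^sup>2)" "w'\<^sup>2 = of_real (s\<^sup>2)"
          using T' f'(3,4) real_square[of z'] real_square[of w'] by simp_all
        from three_real_relation[OF g g3' sq(3) sq(1) sq(1) sq'(1) sq(4) sq(2) sq(2) sq'(2)] obtain c1 c2 c3 where
          c: "(c1, c2, c3) \<noteq> (0, 0, 0)"
          "\<forall>a b. c1 * x1 a b + c2 * x2 a b + c3 * x3 a b = 0 \<and> c1 * y1 a b + c2 * y2 a b + c3 * y3 a b = 0" .
        show False by (rule contra[OF c])
      qed
    qed
  qed
qed

lemma no_triple_zero:
  assumes rs: "r > 0" "s > 0" and p: "p \<in> torus_zeros P r s" and ord: "3 \<le> vanishing_order P p"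
  shows False
proof -
  obtain z w where e: "p = (z, w)" by (cases p)
  note f = torus_zero_facts[OF p(1)[unfolded e] rs]
  obtain x1 y1 x2 y2 x3 y3 where g: "generalized_solution z w 3 x1 y1" "generalized_solution z w 3 x2 y2" "generalized_solution z w 3 x3 y3"
    and ind: "\<And>c1 c2 c3. \<forall>a b. c1 * x1 a b + c2 * x2 a b + c3 * x3 a b = 0 \<and> c1 * y1 a b + c2 * y2 a b + c3 * y3 a b = 0 \<Longrightarrow>
      c1 = 0 \<and> c2 = 0 \<and> c3 = 0"
    by (rule generalized_solution_triple[OF f(1,2) ord[unfolded e]]) (rule that; assumption)
  have contra: False if c: "(c1, c2, c3) \<noteq> (0, 0, 0)"
    "\<forall>a b. c1 * x1 a b + c2 * x2 a b + c3 * x3 a b = 0 \<and> c1 * y1 a b + c2 * y2 a b + c3 * y3 a b = 0" for c1 c2 c3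
    using ind[OF c(2)] c(1) by simp
  show False
  proof (cases "z \<in> \<real> \<and> w \<in> \<real>")
    case False
    then have g1: "generalized_solution z w 1 x1 y1" "generalized_solution z w 1 x2 y2" "generalized_solution z w 1 x3 y3" using generalized_solution_nonreal g f by blast+
    show False
    proof -
      from three_eigen_relation[OF g1 rs(1) f(3) f(3) f(3) rs(2) f(4) f(4) f(4)] obtain c1 c2 c3 where
        c: "(c1, c2, c3) \<noteq> (0, 0, 0)"
        "\<forall>a b. c1 * x1 a b + c2 * x2 a b + c3 * x3 a b = 0 \<and> c1 * y1 a b + c2 * y2 a b + c3 * y3 a b = 0" .
      show False by (rule contra[OF c])
    qed
  next
    case True
    show False
    proof -
      have sq: "z\<^sup>2 = of_real (r\<^sup>2)" "w\<^sup>2 = of_real (s\<^sup>2)" "r\<^sup>2 > 0" "s\<^sup>2 > 0"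
        using True f(3,4) real_square[of z] real_square[of w] rs by simp_all
      show False by (rule three_real_relation[OF g sq(3,1,1,1,4,2,2,2)]) (rule contra)
    qed
  qed
qed

lemma torus_zeros_bound:
  assumes rs: "r > 0" "s > 0"
  shows "finite (torus_zeros P r s) \<and> (\<Sum>p\<in>torus_zeros P r s. vanishing_order P p) \<le> 2"
proof (rule torus_count)
  fix p assume "p \<in> torus_zeros P r s"
  then show "1 \<le> vanishing_order P p" by (cases p) (auto simp: torus_zeros_def intro: vanishing_order_ge_1)
qed (use no_three_zeros[OF rs] no_double_zero_and_another[OF rs] no_triple_zero[OF rs] in blast)+

lemma harnack: "harnack P"
  unfolding harnack_def using torus_zeros_bound by blast

end

section \<open>The unit torus\<close>

text \<open>Along one circle the real-valued function changes sign at the zero; the change persists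
  on nearby parallel circles, each of which then carries a zero by the intermediate value
  theorem.\<close>

lemma infinite_zeros_near_simple_zero:
  fixes F :: "complex \<Rightarrow> complex \<Rightarrow> complex"
  assumes hz: "\<And>w. w \<noteq> 0 \<Longrightarrow> continuous_on (- {0}) (\<lambda>z. F z w)" and hw: "\<And>z. z \<noteq> 0 \<Longrightarrow> F z holomorphic_on - {0}"
    and real: "\<And>z w. cmod z = 1 \<Longrightarrow> cmod w = 1 \<Longrightarrow> cnj (F z w) = F z w"
    and p: "cmod z0 = 1" "cmod w0 = 1" "F z0 w0 = 0" and simple: "deriv (F z0) w0 \<noteq> 0"
  shows "infinite {(z, w). cmod z = 1 \<and> cmod w = 1 \<and> F z w = 0}"
proof -
  let ?Z = "{(z, w). cmod z = 1 \<and> cmod w = 1 \<and> F z w = 0}"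
  define Ez where "Ez = (\<lambda>s::real. z0 * exp (\<i> * of_real s))"
  define Ew where "Ew = (\<lambda>t::real. w0 * exp (\<i> * of_real t))"
  have nE: "cmod (Ez s) = 1" "cmod (Ew s) = 1" for s
    using p by (simp_all add: Ez_def Ew_def norm_mult)
  have E0: "Ez s \<noteq> 0" "Ew s \<noteq> 0" for s using nE[of s] by auto
  have cE: "continuous_on UNIV Ez" "continuous_on UNIV Ew"
    unfolding Ez_def Ew_def by (intro continuous_intros)+
  have im: "Im (F (Ez s) (Ew t)) = 0" for s t
    using arg_cong[OF real[OF nE(1)[of s] nE(2)[of t]], of Im] by simp
  define g where "g = (\<lambda>s t. Re (F (Ez s) (Ew t)))"
  have zero: "F (Ez s) (Ew t) = 0" if "g s t = 0" for s t
    using im[of s t] that by (simp add: g_def complex_eq_iff)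
  have EE: "Ez 0 = z0" "Ew 0 = w0" by (simp_all add: Ez_def Ew_def)
  have z0: "z0 \<noteq> 0" "w0 \<noteq> 0" using p by auto
  define D where "D = w0 * \<i> * deriv (F z0) w0"
  have "(Ew has_vector_derivative w0 * \<i>) (at 0)"
    unfolding Ew_def by (rule has_vector_derivative_real_field) (auto intro!: derivative_eq_intros)
  moreover have "(F z0 has_field_derivative deriv (F z0) w0) (at (Ew 0))"
    unfolding EE by (rule holomorphic_derivI[OF hw[OF z0(1)]]) (use z0 in auto)
  ultimately have der: "((F z0 \<circ> Ew) has_vector_derivative D) (at 0)"
    unfolding D_def by (rule field_vector_diff_chain_at)
  have "((\<lambda>t. Im ((F z0 \<circ> Ew) t)) has_vector_derivative Im D) (at 0)"
    by (rule bounded_linear.has_vector_derivative[OF bounded_linear_Im der])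
  moreover have "(\<lambda>t. Im ((F z0 \<circ> Ew) t)) = (\<lambda>t. 0)"
    using im[of 0] by (simp add: EE fun_eq_iff)
  \<comment> \<open>The restriction to the circle is real, so its derivative is real; since it is
    nonzero, its real part is.\<close>
  ultimately have "Im D = 0"
    using vector_derivative_unique_at[of "\<lambda>t. 0" "Im D" "0::real" 0] by simp
  moreover have "D \<noteq> 0" using simple z0 by (simp add: D_def)
  ultimately have ReD: "Re D \<noteq> 0" by (simp add: complex_eq_iff)
  have "((\<lambda>t. Re ((F z0 \<circ> Ew) t)) has_vector_derivative Re D) (at 0)"
    by (rule bounded_linear.has_vector_derivative[OF bounded_linear_Re der])
  then have dg: "(g 0 has_real_derivative Re D) (at 0)"
    by (simp add: g_def EE has_real_derivative_iff_has_vector_derivative)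
  have g00: "g 0 0 = 0" using p by (simp add: g_def EE)
  obtain h where h: "h > 0" "g 0 h > 0 \<and> g 0 (- h) < 0 \<or> g 0 h < 0 \<and> g 0 (- h) > 0"
  proof (cases "Re D > 0")
    case True
    obtain d1 where d1: "d1 > 0" "\<And>h. h > 0 \<Longrightarrow> h < d1 \<Longrightarrow> g 0 0 < g 0 (0 + h)"
      using DERIV_pos_inc_right[OF dg True] by blast
    obtain d2 where d2: "d2 > 0" "\<And>h. h > 0 \<Longrightarrow> h < d2 \<Longrightarrow> g 0 (0 - h) < g 0 0"
      using DERIV_pos_inc_left[OF dg True] by blast
    show ?thesis using that[of "min d1 d2 / 2"] d1(1) d2(1) d1(2)[of "min d1 d2 / 2"] d2(2)[of "min d1 d2 / 2"] g00 by auto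
  next
    case False
    then have neg: "Re D < 0" using ReD by simp
    obtain d1 where d1: "d1 > 0" "\<And>h. h > 0 \<Longrightarrow> h < d1 \<Longrightarrow> g 0 0 > g 0 (0 + h)"
      using DERIV_neg_dec_right[OF dg neg] by blast
    obtain d2 where d2: "d2 > 0" "\<And>h. h > 0 \<Longrightarrow> h < d2 \<Longrightarrow> g 0 (0 - h) > g 0 0"
      using DERIV_neg_dec_left[OF dg neg] by blast
    show ?thesis using that[of "min d1 d2 / 2"] d1(1) d2(1) d1(2)[of "min d1 d2 / 2"] d2(2)[of "min d1 d2 / 2"] g00 by auto
  qed
  have lim: "((\<lambda>s. g s t) \<longlongrightarrow> g 0 t) (at_right 0)" for t
  proof -
    have "continuous_on UNIV (\<lambda>s. F (Ez s) (Ew t))"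
      by (rule continuous_on_compose2[where g = "\<lambda>z. F z (Ew t)" and f = Ez, OF hz[OF E0(2)] cE(1)]) (use E0 in auto)
    then have "continuous_on UNIV (\<lambda>s. g s t)" unfolding g_def by (rule continuous_on_Re)
    then have "isCont (\<lambda>s. g s t) 0" by (simp add: continuous_on_eq_continuous_at)
    then show ?thesis unfolding isCont_def filterlim_at_split by blast
  qed
  have "\<forall>\<^sub>F s in at_right 0. g s h > 0 \<and> g s (- h) < 0 \<or> g s h < 0 \<and> g s (- h) > 0"
    using h(2)
  proof (elim disjE conjE)
    assume "g 0 h > 0" "g 0 (- h) < 0"
    then have "\<forall>\<^sub>F s in at_right 0. g s h > 0" "\<forall>\<^sub>F s in at_right 0. g s (- h) < 0"
      using order_tendstoD[OF lim] by blast+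
    then show ?thesis by eventually_elim simp
  next
    assume "g 0 h < 0" "g 0 (- h) > 0"
    then have "\<forall>\<^sub>F s in at_right 0. g s h < 0" "\<forall>\<^sub>F s in at_right 0. g s (- h) > 0"
      using order_tendstoD[OF lim] by blast+
    then show ?thesis by eventually_elim simp
  qed
  then obtain e where e: "e > 0" "\<And>s. 0 < s \<Longrightarrow> s < e \<Longrightarrow> g s h > 0 \<and> g s (- h) < 0 \<or> g s h < 0 \<and> g s (- h) > 0"
    by (auto simp: eventually_at_right_field)
  have cg: "continuous_on {- h..h} (g s)" for s
  proof -
    have "continuous_on UNIV (\<lambda>t. F (Ez s) (Ew t))"
      by (rule continuous_on_compose2[where g = "F (Ez s)" and f = Ew, OF holomorphic_on_imp_continuous_on[OF hw[OF E0(1)]] cE(2)]) (use E0 in auto)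
    then have "continuous_on UNIV (g s)" unfolding g_def by (rule continuous_on_Re)
    then show ?thesis by (rule continuous_on_subset) simp
  qed
  have ex: "\<exists>t. g s t = 0" if "0 < s" "s < e" for s
    using e(2)[OF that]
  proof (elim disjE conjE)
    assume "g s h > 0" "g s (- h) < 0"
    then show ?thesis using IVT'[of "g s" "- h" 0 h] cg[of s] h(1) by auto
  next
    assume "g s h < 0" "g s (- h) > 0"
    then show ?thesis using IVT2'[of "g s" h 0 "- h"] cg[of s] h(1) by auto
  qed
  let ?I = "{0<..<min e 1}"
  have "Ez ` ?I \<subseteq> fst ` ?Z"
  proof
    fix u assume "u \<in> Ez ` ?I"
    then obtain s where s: "u = Ez s" "0 < s" "s < e" by auto
    obtain t where "g s t = 0" using ex[OF s(2,3)] by blast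
    then have "(Ez s, Ew t) \<in> ?Z" using zero nE by simp
    then show "u \<in> fst ` ?Z" using s(1) by force
  qed
  \<comment> \<open>Parameters below \<open>1\<close> stay where sine is injective, so different
    circles carry different zeros.\<close>
  moreover have "inj_on Ez ?I"
  proof (rule inj_onI)
    fix s t assume st: "s \<in> ?I" "t \<in> ?I" "Ez s = Ez t"
    have "Im (exp (\<i> * of_real s)) = Im (exp (\<i> * of_real t))" using st(3) z0 by (simp add: Ez_def)
    then have "sin s = sin t" by (simp add: Im_exp)
    moreover have "1 \<le> pi / 2" using pi_ge_two by simp
    ultimately show "s = t" using st(1,2) by - (rule sin_inj_pi, auto)
  qed
  moreover have "infinite ?I" using e(1) by (simp add: infinite_Ioo)
  ultimately have "infinite (fst ` ?Z)" using finite_subset finite_imageD by blast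
  then show ?thesis using finite_imageI by blast
qed

context toroidal_fisher begin

text \<open>The sign-change argument is used along each of the two coordinate circles, so both first
  derivatives vanish, and these are the only mixed derivatives of order one.\<close>

lemma unit_torus_zero_double:
  assumes "(z, w) \<in> torus_zeros P 1 1"
  shows "2 \<le> vanishing_order P (z, w)"
proof -
  have fin: "finite (torus_zeros P 1 1)" using torus_zeros_bound[of 1 1] by simp
  have p: "cmod z = 1" "cmod w = 1" "P z w = 0" using assms by (simp_all add: torus_zeros_def)
  have 1: "deriv (P z) w = 0"
  proof (rule ccontr)
    assume "\<not> ?thesis"
    then have "infinite {(z, w). cmod z = 1 \<and> cmod w = 1 \<and> P z w = 0}"
      by (intro infinite_zeros_near_simple_zero[of P z w] p char_polynomial_real_on_torus char_polynomial_holomorphic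
          holomorphic_on_imp_continuous_on[OF char_polynomial_holomorphic(1)])
    then show False using fin by (simp add: torus_zeros_def)
  qed
  have 2: "deriv (\<lambda>u. P u w) z = 0"
  proof (rule ccontr)
    assume "\<not> ?thesis"
    then have "infinite {(w, z). cmod w = 1 \<and> cmod z = 1 \<and> P z w = 0}"
      by (intro infinite_zeros_near_simple_zero[of "\<lambda>w z. P z w" w z] p char_polynomial_real_on_torus char_polynomial_holomorphic
          holomorphic_on_imp_continuous_on[OF char_polynomial_holomorphic(2)])
    moreover have "{(w, z). cmod w = 1 \<and> cmod z = 1 \<and> P z w = 0} = prod.swap ` torus_zeros P 1 1"
      by (auto simp: torus_zeros_def image_iff)
    ultimately show False using fin by simp
  qed
  have "enat 2 \<le> enat (i + j)" if "mixed_deriv i j P z w \<noteq> 0" for i j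
  proof (rule ccontr)
    assume "\<not> ?thesis"
    then consider "i = 0" "j = 0" | "i = 0" "j = 1" | "i = 1" "j = 0" by (cases i; cases j) auto
    then show False by cases (use that p 1 2 in \<open>simp_all add: mixed_deriv_def\<close>)
  qed
  then show ?thesis
    unfolding vanishing_order_def prod.case numeral_eq_enat by (intro INF_greatest) auto
qed

lemma unit_torus_zeros:
  "torus_zeros P 1 1 = {} \<or> (\<exists>p\<in>{1, - 1} \<times> {1, - 1}. torus_zeros P 1 1 = {p} \<and> vanishing_order P p = 2)"
proof (cases "torus_zeros P 1 1 = {}")
  case False
  then obtain z w where p: "(z, w) \<in> torus_zeros P 1 1" by auto
  have only: "q = (z, w)" if "q \<in> torus_zeros P 1 1" for q
    using no_double_zero_and_another[of 1 1 "(z, w)" q] p that unit_torus_zero_double[OF p] by auto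
  then have "(cnj z, cnj w) = (z, w)" using cnj_torus_zero[OF p] by blast
  then have "z \<in> \<real>" "w \<in> \<real>" by (auto simp: Reals_cnj_iff)
  moreover have "cmod z = 1" "cmod w = 1" using p by (simp_all add: torus_zeros_def)
  ultimately have "(z, w) \<in> {1, - 1} \<times> {1, - 1}" by (auto elim!: Reals_cases simp: abs_if split: if_splits)
  moreover have "\<not> 3 \<le> vanishing_order P (z, w)" using no_triple_zero[of 1 1, OF _ _ p] by auto
  then have "vanishing_order P (z, w) = 2"
    using unit_torus_zero_double[OF p] by (cases "vanishing_order P (z, w)") (auto simp: numeral_eq_enat)
  ultimately show ?thesis using only p by blast
qed simp

end

theorem theorem1p2:
  fixes m n :: nat and W :: "vertex \<times> vertex \<Rightarrow> real"
  assumes "m \<ge> 1" and "n \<ge> 1"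
    and "\<And>e. e \<in> triangular_edges m n \<union> a_edges m n \<Longrightarrow> W e = 1"
    and "\<And>e. e \<in> b_edges m n \<union> c_edges m n \<Longrightarrow> 0 < W e \<and> W e < 1"
  shows "harnack (char_polynomial m n W)
    \<and> (torus_zeros (char_polynomial m n W) 1 1 = {}
       \<or> (\<exists>p \<in> {1, -1} \<times> {1, -1}.
            torus_zeros (char_polynomial m n W) 1 1 = {p}
            \<and> vanishing_order (char_polynomial m n W) p = 2))"
proof -
  interpret toroidal_fisher m n W
    by unfold_locales (fact assms)+
  show ?thesis using harnack unit_torus_zeros by blast
qed

end
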